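(* For any complex number $z$, as formal power series in $T$, $$\sum_{\lambda\in\mathcal{DD}'}(-1)^{d_\lambda}T^{|\lambda|/2}\prod_{s\in\lambda}\left(1-\frac{(2z-2)\varepsilon'_s}{h_s}\right)=(T;T)_{\infty}^{2z^2-z}=\sum_{\lambda\in\mathcal{DD}}(-1)^{d_\lambda}T^{|\lambda|/2}\prod_{s\in\lambda}\left(1+\frac{(2z-2)\varepsilon_s}{h_s}\right).$$
   Context: $(T;T)_\infty=\prod_{j\ge1}(1-T^j)$, and its complex power is the formal power series with constant term $1$. For a partition $\lambda$, $h_s$ is the hook length of a box $s$ and $d_\lambda=\max\{s:\lambda_s\ge s\}$ is the Durfee square size. In the Ferrers diagram (English convention): $\varepsilon_s=-1$ if $s$ is strictly below the main diagonal and $\varepsilon_s=1$ otherwise; $\varepsilon'_s=1$ if $s$ is strictly above the main diagonal and $\varepsilon'_s=-1$ otherwise. $\mathcal{DD}$ is the set of doubled distinct partitions, i.e. partitions $\lambda$ with $\lambda_i=\lambda'_i+1$ for $1\le i\le d_\lambda$ ($\lambda'$ the conjugate; the empty partition is included), and $\mathcal{DD}'=\{\lambda'\mid\lambda\in\mathcal{DD}\}$. *)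

theory Defs
  imports "HOL-Analysis.Analysis" "HOL-Computational_Algebra.Formal_Power_Series"
begin

text \<open>Infinite sums and products of formal power series are the library's \<open>has_sum\<close> and
  \<^const>\<open>prodinf\<close> for the metric (\<open>X\<close>-adic) topology on \<^typ>\<open>complex fps\<close>: a limit there is a
  coefficientwise eventually constant limit, see \<open>tendsto_fps_iff\<close>.\<close>

definition euler_product :: "complex fps" where
  "euler_product = prodinf (\<lambda>j. 1 - fps_X ^ Suc j)"

text \<open>For \<open>F\<close> with constant term \<open>1\<close> this is the binomial series
  \<open>F\<^sup>c = (\<Sum>n. (c gchoose n) * (F - 1)\<^sup>n)\<close>; the composition is junk for other constant terms.\<close>

definition fps_cpow :: "complex fps \<Rightarrow> complex \<Rightarrow> complex fps" where
  "fps_cpow F c = fps_compose (fps_binomial c) (F - 1)"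

text \<open>A partition is the list of its positive parts in weakly decreasing order. Rows, columns and
  parts are numbered from \<open>1\<close>; \<open>part l i = 0\<close> beyond the last part (and for the unused index \<open>0\<close>).\<close>

definition is_partition :: "nat list \<Rightarrow> bool" where
  "is_partition l \<longleftrightarrow> sorted_wrt (\<ge>) l \<and> 0 \<notin> set l"

definition part :: "nat list \<Rightarrow> nat \<Rightarrow> nat" where
  "part l i = (if 1 \<le> i \<and> i \<le> length l then l ! (i - 1) else 0)"

definition conjugate :: "nat list \<Rightarrow> nat list" where
  "conjugate l = map (\<lambda>j. card {i. 1 \<le> i \<and> i \<le> length l \<and> j \<le> part l i}) [1..<Suc (part l 1)]"

text \<open>The box \<open>(i, j)\<close> lies in row \<open>i\<close> and column \<open>j\<close> (English convention).\<close>

definition ferrers :: "nat list \<Rightarrow> (nat \<times> nat) set" where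
  "ferrers l = {(i, j). 1 \<le> i \<and> i \<le> length l \<and> 1 \<le> j \<and> j \<le> part l i}"

definition hook_length :: "nat list \<Rightarrow> nat \<times> nat \<Rightarrow> nat" where
  "hook_length l s = card {t \<in> ferrers l.
     (fst t = fst s \<and> snd t \<ge> snd s) \<or> (snd t = snd s \<and> fst t \<ge> fst s)}"

text \<open>The value \<open>s = 0\<close> always belongs to the set, so the empty partition has Durfee size \<open>0\<close>.\<close>

definition durfee :: "nat list \<Rightarrow> nat" where
  "durfee l = Max {s. s \<le> part l s}"

definition eps :: "nat \<times> nat \<Rightarrow> complex" where
  "eps s = (if fst s > snd s then -1 else 1)"

definition eps' :: "nat \<times> nat \<Rightarrow> complex" where
  "eps' s = (if fst s < snd s then 1 else -1)"

definition DD :: "nat list set" where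
  "DD = {l. is_partition l \<and> (\<forall>i. 1 \<le> i \<and> i \<le> durfee l \<longrightarrow> part l i = part (conjugate l) i + 1)}"

definition DD' :: "nat list set" where
  "DD' = conjugate ` DD"

lemma fps_nth_prod_one_minus_X_power:
  assumes "n \<le> N"
  shows "fps_nth (\<Prod>j\<le>N. 1 - fps_X ^ Suc j :: complex fps) n
       = fps_nth (\<Prod>j\<le>n. 1 - fps_X ^ Suc j) n"
  using assms
proof (induction N rule: dec_induct)
  case (step N)
  have "fps_nth ((\<Prod>j\<le>N. 1 - fps_X ^ Suc j :: complex fps) * fps_X ^ Suc (Suc N)) n = 0"
    using step by (subst fps_X_power_mult_right_nth) auto
  then show ?case using step by (simp add: algebra_simps)
qed simp

lemma one_minus_X_power_nz: "1 - fps_X ^ Suc j \<noteq> (0 :: complex fps)"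
proof
  assume "1 - fps_X ^ Suc j = (0 :: complex fps)"
  then have "fps_nth (1 - fps_X ^ Suc j :: complex fps) 0 = 0" by (simp only: fps_zero_nth)
  then show False by simp
qed

lemma euler_product_has_prod: "(\<lambda>j. 1 - fps_X ^ Suc j) has_prod euler_product"
proof -
  let ?f = "\<lambda>j. 1 - fps_X ^ Suc j :: complex fps"
  define P where "P = Abs_fps (\<lambda>n. fps_nth (\<Prod>j\<le>n. ?f j) n)"
  have "(\<lambda>n. \<Prod>j\<le>n. ?f j) \<longlonglongrightarrow> P"
    unfolding tendsto_fps_iff P_def fps_nth_Abs_fps
    by (intro allI eventually_sequentiallyI fps_nth_prod_one_minus_X_power)
  moreover have "fps_nth P 0 = 1" by (simp add: P_def)
  then have "P \<noteq> 0" by auto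
  ultimately have P: "?f has_prod P" by (simp add: has_prod_def raw_has_prod_def)
  have "Q = P" if "?f has_prod Q" for Q
    using P that one_minus_X_power_nz
    by (auto simp: has_prod_def raw_has_prod_def simp del: power_Suc intro: LIMSEQ_unique)
  with P have "(THE p. ?f has_prod p) = P" by blast
  with P show ?thesis by (simp add: euler_product_def prodinf_def)
qed

lemma euler_product_nth_0: "fps_nth euler_product 0 = 1"
proof -
  have "(\<lambda>n. \<Prod>j\<le>n. 1 - fps_X ^ Suc j) \<longlonglongrightarrow> euler_product"
    using euler_product_has_prod one_minus_X_power_nz by (auto simp: has_prod_def raw_has_prod_def simp del: power_Suc)
  then have "\<forall>\<^sub>F n in sequentially.
      fps_nth (\<Prod>j\<le>n. 1 - fps_X ^ Suc j) 0 = fps_nth euler_product 0"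
    unfolding tendsto_fps_iff by (rule spec)
  moreover have "fps_nth (\<Prod>j\<le>n. 1 - fps_X ^ Suc j :: complex fps) 0 = 1" for n
    by (induction n) auto
  ultimately show ?thesis by simp
qed

lemma part_antimono:
  assumes "is_partition l" "1 \<le> i" "i \<le> j"
  shows "part l j \<le> part l i"
proof (cases "i < j \<and> j \<le> length l")
  case True
  with assms have "l ! (j - 1) \<le> l ! (i - 1)"
    unfolding is_partition_def by (auto simp: sorted_wrt_iff_nth_less)
  then show ?thesis using True assms by (simp add: part_def)
next
  case False
  then show ?thesis using assms by (cases "i = j") (auto simp: part_def)
qed

lemma ferrers_alt: "ferrers l = {(i, j). 1 \<le> j \<and> j \<le> part l i}"
  by (auto simp: ferrers_def part_def split: if_splits)

lemma part_conjugate: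
  assumes "is_partition l" "1 \<le> j"
  shows "part (conjugate l) j = card {i. 1 \<le> i \<and> j \<le> part l i}"
proof (cases "j \<le> part l 1")
  case True
  have *: "{i. 1 \<le> i \<and> i \<le> length l \<and> j \<le> part l i} = {i. 1 \<le> i \<and> j \<le> part l i}"
    using assms(2) by (auto simp: part_def split: if_splits)
  have "[1..<Suc (part l 1)] ! (j - 1) = j" using True assms(2) by (subst nth_upt) auto
  moreover have "length [1..<Suc (part l 1)] = part l 1" by simp
  ultimately have "part (conjugate l) j = card {i. 1 \<le> i \<and> i \<le> length l \<and> j \<le> part l i}"
    unfolding part_def[of "conjugate l"] unfolding conjugate_def
    using True assms(2) by (subst nth_map) (simp_all del: upt_Suc One_nat_def)
  then show ?thesis unfolding * .
next
  case False
  have "{i. 1 \<le> i \<and> j \<le> part l i} = {}"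
    using False part_antimono[OF assms(1), of 1] by (auto dest: le_trans)
  moreover have "part (conjugate l) j = 0"
    using False unfolding part_def[of "conjugate l"] by (simp add: conjugate_def del: upt_Suc)
  ultimately show ?thesis by (simp only: card.empty)
qed

lemma column_eq:
  assumes "is_partition l" "1 \<le> j"
  shows "{i. 1 \<le> i \<and> j \<le> part l i} = {1..part (conjugate l) j}"
proof -
  let ?C = "{i. 1 \<le> i \<and> j \<le> part l i}"
  have fin: "finite ?C"
    by (rule finite_subset[of _ "{..length l}"])
       (use assms(2) in \<open>auto simp: part_def split: if_splits\<close>)
  have sub: "{1..i} \<subseteq> ?C" if "i \<in> ?C" for i
  proof
    fix x assume "x \<in> {1..i}"
    then show "x \<in> ?C" using that part_antimono[OF assms(1), of x i] by simp
  qed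
  have "?C = {1..card ?C}"
  proof (cases "?C = {}")
    case False
    have "Max ?C \<in> ?C" using False fin by (rule Max_in[rotated])
    moreover have "x \<le> Max ?C" if "x \<in> ?C" for x using that fin by (rule Max_ge[rotated])
    ultimately have *: "?C = {1..Max ?C}" using sub by auto
    have "card ?C = Max ?C" by (subst *) simp
    with * show ?thesis by simp
  next
    case True
    then show ?thesis by (simp only: card.empty) simp
  qed
  then show ?thesis using part_conjugate[OF assms] by simp
qed

lemma column_iff:
  assumes "is_partition l" "1 \<le> i" "1 \<le> j"
  shows "j \<le> part l i \<longleftrightarrow> i \<le> part (conjugate l) j"
proof -
  have "i \<in> {i. 1 \<le> i \<and> j \<le> part l i} \<longleftrightarrow> i \<in> {1..part (conjugate l) j}"
    unfolding column_eq[OF assms(1,3)] ..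
  with assms(2) show ?thesis by simp
qed

lemma swap_mem: "(i, j) \<in> (\<lambda>(i, j). (j, i)) ` S \<longleftrightarrow> (j, i) \<in> S"
  by force

lemma ferrers_conjugate:
  assumes "is_partition l"
  shows "ferrers (conjugate l) = (\<lambda>(i, j). (j, i)) ` ferrers l"
proof -
  have "(j, i) \<in> ferrers (conjugate l) \<longleftrightarrow> (i, j) \<in> ferrers l" for i j
  proof (cases "1 \<le> i \<and> 1 \<le> j")
    case True
    then show ?thesis using column_iff[OF assms, of i j] by (simp add: ferrers_alt)
  qed (auto simp: ferrers_alt part_def split: if_splits)
  then show ?thesis by (auto simp only: set_eq_iff swap_mem Un_iff split_paired_all)
qed

lemma card_ferrers: "card (ferrers l) = sum_list l"
proof -
  have "ferrers l = (SIGMA i:{1..length l}. {1..part l i})"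
    by (auto simp: ferrers_def)
  then have "card (ferrers l) = (\<Sum>i = 1..length l. part l i)" by simp
  also have "\<dots> = (\<Sum>i = 0..<length l. l ! i)"
    by (rule sum.reindex_bij_witness[of _ Suc "\<lambda>i. i - 1"]) (auto simp: part_def)
  finally show ?thesis by (simp add: sum_list_sum_nth)
qed

lemma sum_list_conjugate:
  assumes "is_partition l"
  shows "sum_list (conjugate l) = sum_list l"
proof -
  have "inj_on (\<lambda>(i, j). (j, i)) (ferrers l)" by (auto simp: inj_on_def)
  from card_image[OF this] show ?thesis
    using ferrers_conjugate[OF assms] by (simp flip: card_ferrers)
qed

lemma le_durfee: "i \<le> part l i \<Longrightarrow> i \<le> durfee l"
  and durfee_le_part: "durfee l \<le> part l (durfee l)"
proof -
  have fin: "finite {s. s \<le> part l s}"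
    by (rule finite_subset[of _ "{..length l}"]) (auto simp: part_def split: if_splits)
  show "i \<le> part l i \<Longrightarrow> i \<le> durfee l" using fin by (simp add: durfee_def)
  have "Max {s. s \<le> part l s} \<in> {s. s \<le> part l s}"
    using fin by (rule Max_in) auto
  then show "durfee l \<le> part l (durfee l)" by (simp add: durfee_def)
qed

text \<open>Hence \<open>sum_list l div 2\<close> is exact on \<open>DD\<close> and \<open>DD'\<close>.\<close>

lemma DD_even:
  assumes "l \<in> DD"
  shows "even (sum_list l)"
proof -
  let ?c = "conjugate l" and ?d = "durfee l"
  have l: "is_partition l" using assms by (simp add: DD_def)
  define A where "A = (SIGMA i:{1..?d}. {i..part l i})"
  define B where "B = (SIGMA j:{1..?d}. {j<..part ?c j})"
  have col: "j \<le> part l i \<longleftrightarrow> i \<le> part ?c j" if "1 \<le> i" "1 \<le> j" for i j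
    using column_iff[OF l that] .
  have "ferrers l = A \<union> (\<lambda>(i, j). (j, i)) ` B"
  proof -
    have "(i, j) \<in> ferrers l \<longleftrightarrow> (i, j) \<in> A \<or> (j, i) \<in> B" for i j
    proof (cases "1 \<le> i \<and> 1 \<le> j")
      case True
      show ?thesis
      proof (cases "i \<le> j")
        case le: True
        then have "i \<le> ?d" if "j \<le> part l i" using le_durfee[of i l] that by simp
        then show ?thesis using True le by (auto simp: ferrers_alt A_def B_def)
      next
        case False
        then have "j \<le> ?d" if "j \<le> part l i"
          using le_durfee[of j l] part_antimono[OF l, of j i] that True by simp
        then show ?thesis using True False col by (auto simp: ferrers_alt A_def B_def)
      qed
    qed (auto simp: ferrers_alt A_def B_def part_def split: if_splits)
    then show ?thesis by (auto simp only: set_eq_iff swap_mem Un_iff split_paired_all)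
  qed
  moreover have "finite A" "finite B" by (simp_all add: A_def B_def)
  moreover have "A \<inter> (\<lambda>(i, j). (j, i)) ` B = {}" by (auto simp: A_def B_def)
  moreover have "card ((\<lambda>(i, j). (j, i)) ` B) = card B"
    by (rule card_image) (auto simp: inj_on_def)
  ultimately have "sum_list l = card A + card B"
    by (simp add: card_Un_disjoint flip: card_ferrers)
  also have "card A = (\<Sum>i = 1..?d. Suc (part l i) - i)" by (simp add: A_def)
  also have "\<dots> = (\<Sum>i = 1..?d. (part ?c i - i) + 2)"
  proof (rule sum.cong[OF refl])
    fix i assume i: "i \<in> {1..?d}"
    then have "?d \<le> part l i" using part_antimono[OF l, of i ?d] durfee_le_part[of l] by simp
    with i have "i \<le> part ?c i" using col[of i i] by simp
    moreover have "part l i = part ?c i + 1" using assms i by (simp add: DD_def)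
    ultimately show "Suc (part l i) - i = (part ?c i - i) + 2" by simp
  qed
  also have "\<dots> = card B + 2 * ?d" unfolding sum.distrib by (simp add: B_def)
  finally show ?thesis by simp
qed

lemma DD'_even: "l \<in> DD' \<Longrightarrow> even (sum_list l)"
  using DD_even by (auto simp: DD'_def sum_list_conjugate DD_def)

end

theory Submission
  imports Defs "HOL-Library.Groups_Big_Fun"
begin

text \<open>Both sides of the identity have coefficients polynomial in \<open>z\<close>, so it suffices to treat \<open>z = -n\<close>
  for all large integers \<open>n\<close>; then \<open>2 z\<^sup>2 - z\<close> is the dimension of the Lie algebra of \<open>Sp(2 n)\<close>. The
  Macdonald identity of affine type \<open>C\<close>, considered modulo \<open>T ^ (n + 1)\<close>, expands the product of
  \<open>1 - T\<^sup>k x\<^sup>\<alpha>\<close> as a sum over subsets \<open>S\<close> of \<open>{1..n}\<close>, the term of \<open>S\<close> being the numerator of a Weyl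
  character: in \<open>\<rho> = (n, \<dots>, 1)\<close> every entry \<open>n + 1 - s\<close> with \<open>s \<in> S\<close> is replaced by \<open>n + 1 + s\<close>.
  Specialising \<open>x i = q ^ i\<close> and letting \<open>q\<close> tend to \<open>1\<close> turns characters into dimensions. Doubled distinct
  partitions correspond to finite sets \<open>S\<close> of positive integers (the arm lengths of the principal
  hooks), and removing principal hooks one at a time identifies the hook product with the dimension.\<close>

text \<open>The x i are genuine nonzero complex numbers and only T is formal. The shift x -> T x
  then has no meaning for values, so quasi-periodicity is imposed on coefficient arrays. Truncating
  at T^n is what makes the sum run over subsets: of the theta series attached to an index r in 1..n,
  only two terms reach degree n in T, those with exponents r and r - (2 n + 2) of x, and expanding a
  determinant by rows chooses one of the two for each r. The scalar in front of that determinant is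
  never evaluated: the coefficient of T^0 in the same identity is the Weyl denominator formula with
  the same scalar, so the scalar cancels. At z = -n the hook parameter 2 - 2 z is 2 n + 2, the
  period of the exponents of x, and also the constant to which the entries n + 1 - s and n + 1 + s
  add up; this is why flipping such entries in the dimension formula yields factors of hook
  type.\<close>

subsection \<open>Theta-like functions and their quasi-period\<close>

text \<open>An array \<open>c m k\<close> stands for the double series with coefficient \<open>c m k\<close> at \<open>x powi m * T ^ k\<close>,
  where \<open>x\<close> is a complex number and \<open>T\<close> the variable of the power series. The exponents of \<open>T\<close>
  are integers so that the substitution of \<open>T x\<close> for \<open>x\<close> can be expressed on arrays.\<close>

definition laurent_eval :: "(int \<Rightarrow> int \<Rightarrow> complex) \<Rightarrow> complex \<Rightarrow> complex fps" where
  "laurent_eval c x = Abs_fps (\<lambda>k. Sum_any (\<lambda>m. c m (int k) * x powi m))"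

text \<open>Nonnegative powers of T only, and a Laurent polynomial in x at each of them: this keeps
  products and evaluations finite in every degree.\<close>

definition locfin :: "(int \<Rightarrow> int \<Rightarrow> complex) \<Rightarrow> bool" where
  "locfin c \<longleftrightarrow> (\<forall>m k. k < 0 \<longrightarrow> c m k = 0) \<and> (\<forall>k. finite {m. c m k \<noteq> 0})"

definition conv :: "(int \<Rightarrow> int \<Rightarrow> complex) \<Rightarrow> (int \<Rightarrow> int \<Rightarrow> complex) \<Rightarrow> int \<Rightarrow> int \<Rightarrow> complex" where
  "conv f g m k = Sum_any (\<lambda>(a, i). f a i * g (m - a) (k - i))"

text \<open>Only the degrees 0..k of T occur up to k, so one symmetric window of exponents of x
  serves them all. It turns \<open>Sum_any\<close> into sums over boxes.\<close>

lemma locfin_bound: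
  assumes "locfin c"
  shows "\<exists>L\<ge>0. \<forall>m i. i \<le> k \<longrightarrow> c m i \<noteq> 0 \<longrightarrow> m \<in> {-L..L}"
proof -
  let ?A = "\<Union>i\<in>{0..k}. {m. c m i \<noteq> 0}"
  have "finite (abs ` ?A)" using assms by (auto simp: locfin_def)
  then obtain L where L: "\<And>y. y \<in> abs ` ?A \<Longrightarrow> y \<le> L"
    by (meson bdd_above_finite bdd_above.E)
  show ?thesis
  proof (intro exI[of _ "max L 0"] conjI allI impI)
    fix m i assume "i \<le> k" "c m i \<noteq> 0"
    then have "i \<ge> 0" using assms unfolding locfin_def by (metis not_le)
    then have "m \<in> ?A" using \<open>i \<le> k\<close> \<open>c m i \<noteq> 0\<close> by auto
    then have "\<bar>m\<bar> \<le> L" using L by blast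
    then show "m \<in> {- max L 0..max L 0}" by auto
  qed simp
qed

lemma conv_support:
  assumes "locfin f" "locfin g" "\<forall>m i. i \<le> k \<longrightarrow> f m i \<noteq> 0 \<longrightarrow> m \<in> {-L..L}"
  shows "{p. (case p of (a, i) \<Rightarrow> f a i * g (m - a) (k - i)) \<noteq> 0} \<subseteq> {-L..L} \<times> {0..k}"
proof clarify
  fix a i assume *: "f a i * g (m - a) (k - i) \<noteq> 0"
  then have "i \<ge> 0" "k - i \<ge> 0"
    using assms(1,2) unfolding locfin_def by (metis mult_eq_0_iff not_le)+
  then show "a \<in> {-L..L} \<and> i \<in> {0..k}" using assms(3)[rule_format, of i a] * by auto
qed

lemma conv_finite:
  assumes "locfin f" "locfin g"
  shows "finite {p. (case p of (a, i) \<Rightarrow> f a i * g (m - a) (k - i)) \<noteq> 0}"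
proof -
  obtain L where L: "\<forall>m i. i \<le> k \<longrightarrow> f m i \<noteq> 0 \<longrightarrow> m \<in> {-L..L}"
    using locfin_bound[OF assms(1), of k] by blast
  show ?thesis by (rule finite_subset[OF conv_support[OF assms L]]) simp_all
qed

lemma conv_sum:
  assumes "locfin f" "locfin g" "\<forall>m i. i \<le> k \<longrightarrow> f m i \<noteq> 0 \<longrightarrow> m \<in> {-L..L}"
  shows "conv f g m k = (\<Sum>a\<in>{-L..L}. \<Sum>i\<in>{0..k}. f a i * g (m - a) (k - i))"
proof -
  have "conv f g m k = (\<Sum>(a, i)\<in>{-L..L} \<times> {0..k}. f a i * g (m - a) (k - i))"
    unfolding conv_def
    by (rule Sum_any.expand_superset[OF _ conv_support[OF assms]]) simp_all
  then show ?thesis by (simp only: sum.cartesian_product)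
qed

lemma conv_support_bound:
  assumes "locfin f" "locfin g"
    "\<forall>m i. i \<le> k \<longrightarrow> f m i \<noteq> 0 \<longrightarrow> m \<in> {-L..L}"
    "\<forall>m i. i \<le> k \<longrightarrow> g m i \<noteq> 0 \<longrightarrow> m \<in> {-L'..L'}"
    and nz: "conv f g m k \<noteq> 0"
  shows "m \<in> {-(L+L')..L+L'}"
proof -
  obtain p where p: "(case p of (a, i) \<Rightarrow> f a i * g (m - a) (k - i)) \<noteq> 0"
    using nz unfolding conv_def by (rule Sum_any.not_neutral_obtains_not_neutral)
  obtain a i where ai: "p = (a, i)" by force
  have "a \<in> {-L..L}" "i \<in> {0..k}"
    using conv_support[OF assms(1,2,3), of m] p ai by blast+
  moreover have "m - a \<in> {-L'..L'}" using assms(4)[rule_format, of "k - i" "m - a"] p ai \<open>i \<in> {0..k}\<close> by auto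
  ultimately show ?thesis by auto
qed

lemma locfin_conv:
  assumes "locfin f" "locfin g"
  shows "locfin (conv f g)"
  unfolding locfin_def
proof (intro conjI allI impI)
  fix m k :: int assume k: "k < 0"
  obtain L where L: "\<forall>m i. i \<le> k \<longrightarrow> f m i \<noteq> 0 \<longrightarrow> m \<in> {-L..L}" using locfin_bound[OF assms(1), of k] by blast
  show "conv f g m k = 0" using k by (simp add: conv_sum[OF assms L])
next
  fix k :: int
  obtain L where L: "L \<ge> 0" "\<forall>m i. i \<le> k \<longrightarrow> f m i \<noteq> 0 \<longrightarrow> m \<in> {-L..L}" using locfin_bound[OF assms(1), of k] by blast
  obtain L' where L': "L' \<ge> 0" "\<forall>m i. i \<le> k \<longrightarrow> g m i \<noteq> 0 \<longrightarrow> m \<in> {-L'..L'}" using locfin_bound[OF assms(2), of k] by blast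
  have "{m. conv f g m k \<noteq> 0} \<subseteq> {-(L+L')..L+L'}"
    using conv_support_bound[OF assms L(2) L'(2)] by blast
  then show "finite {m. conv f g m k \<noteq> 0}" by (rule finite_subset) simp
qed

lemma laurent_eval_nth:
  assumes "\<And>m. c m (int k) \<noteq> 0 \<Longrightarrow> m \<in> A" "finite A"
  shows "fps_nth (laurent_eval c x) k = (\<Sum>m\<in>A. c m (int k) * x powi m)"
  unfolding laurent_eval_def fps_nth_Abs_fps
  by (rule Sum_any.expand_superset) (use assms in auto)

lemma laurent_eval_conv:
  assumes f: "locfin f" and g: "locfin g" and x: "x \<noteq> 0"
  shows "laurent_eval (conv f g) x = laurent_eval f x * laurent_eval g x"
proof (rule fps_ext)
  fix k
  obtain L where L: "L \<ge> 0" "\<forall>m i. i \<le> int k \<longrightarrow> f m i \<noteq> 0 \<longrightarrow> m \<in> {-L..L}" using locfin_bound[OF f, of k] by blast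
  obtain L' where L': "L' \<ge> 0" "\<forall>m i. i \<le> int k \<longrightarrow> g m i \<noteq> 0 \<longrightarrow> m \<in> {-L'..L'}" using locfin_bound[OF g, of k] by blast
  have supp: "m \<in> {-(L+L')..L+L'}" if "conv f g m k \<noteq> 0" for m
    by (rule conv_support_bound[OF f g L(2) L'(2) that])
  have inner: "(\<Sum>m\<in>{-(L+L')..L+L'}. f a i * g (m - a) (k - i) * x powi m)
      = (\<Sum>b\<in>{-L'..L'}. f a i * x powi a * (g b (k - i) * x powi b))"
    if a: "a \<in> {-L..L}" and i: "i \<in> {0..int k}" for a and i :: int
  proof -
    have "(\<Sum>m\<in>{-(L+L')..L+L'}. f a i * g (m - a) (k - i) * x powi m)
       = (\<Sum>m\<in>(\<lambda>b. a + b) ` {-L'..L'}. f a i * g (m - a) (k - i) * x powi m)"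
    proof (rule sum.mono_neutral_right; safe?)
      fix m assume m: "m \<in> {-(L+L')..L+L'}" "m \<notin> (\<lambda>b. a + b) ` {-L'..L'}"
      then have "m - a \<notin> {-L'..L'}" by (metis add_diff_cancel_left' add.commute diff_add_cancel image_eqI)
      then have "g (m - a) (k - i) = 0" using L'(2)[rule_format, of "k - i" "m - a"] i by auto
      then show "f a i * g (m - a) (k - i) * x powi m = 0" by simp
    qed (use a in auto)
    also have "\<dots> = (\<Sum>b\<in>{-L'..L'}. f a i * g b (k - i) * x powi (a + b))"
      by (subst sum.reindex) (auto simp: inj_on_def)
    also have "\<dots> = (\<Sum>b\<in>{-L'..L'}. f a i * x powi a * (g b (k - i) * x powi b))"
      using x by (intro sum.cong refl) (simp add: power_int_add)
    finally show ?thesis .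
  qed
  have "fps_nth (laurent_eval (conv f g) x) k = (\<Sum>m\<in>{-(L+L')..L+L'}. conv f g m (int k) * x powi m)"
    by (rule laurent_eval_nth[OF supp]) simp_all
  also have "\<dots> = (\<Sum>m\<in>{-(L+L')..L+L'}. \<Sum>a\<in>{-L..L}. \<Sum>i\<in>{0..int k}. f a i * g (m - a) (k - i) * x powi m)"
    by (intro sum.cong refl) (unfold conv_sum[OF f g L(2)] sum_distrib_right, rule refl)
  also have "\<dots> = (\<Sum>a\<in>{-L..L}. \<Sum>m\<in>{-(L+L')..L+L'}. \<Sum>i\<in>{0..int k}. f a i * g (m - a) (k - i) * x powi m)"
    by (rule sum.swap)
  also have "\<dots> = (\<Sum>a\<in>{-L..L}. \<Sum>i\<in>{0..int k}. \<Sum>m\<in>{-(L+L')..L+L'}. f a i * g (m - a) (k - i) * x powi m)"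
    by (rule sum.cong[OF refl], rule sum.swap)
  also have "\<dots> = (\<Sum>a\<in>{-L..L}. \<Sum>i\<in>{0..int k}. \<Sum>b\<in>{-L'..L'}. f a i * x powi a * (g b (k - i) * x powi b))"
    by (rule sum.cong[OF refl], rule sum.cong[OF refl], rule inner)
  also have "\<dots> = (\<Sum>i\<in>{0..int k}. (\<Sum>a\<in>{-L..L}. f a i * x powi a) * (\<Sum>b\<in>{-L'..L'}. g b (k - i) * x powi b))"
    by (subst sum.swap) (simp only: sum_product)
  also have "\<dots> = (\<Sum>i=0..k. (\<Sum>a\<in>{-L..L}. f a (int i) * x powi a) * (\<Sum>b\<in>{-L'..L'}. g b (int (k - i)) * x powi b))"
    by (rule sum.reindex_bij_witness[of _ int nat]) (auto simp: of_nat_diff)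
  also have "\<dots> = (\<Sum>i=0..k. fps_nth (laurent_eval f x) i * fps_nth (laurent_eval g x) (k - i))"
  proof (rule sum.cong[OF refl], rule arg_cong2[of _ _ _ _ "(*)"])
    fix i assume i: "i \<in> {0..k}"
    show "(\<Sum>a\<in>{-L..L}. f a (int i) * x powi a) = fps_nth (laurent_eval f x) i"
      by (rule laurent_eval_nth[symmetric]) (use L(2)[rule_format, of "int i"] i in auto)
    show "(\<Sum>b\<in>{-L'..L'}. g b (int (k - i)) * x powi b) = fps_nth (laurent_eval g x) (k - i)"
      by (rule laurent_eval_nth[symmetric]) (use L'(2)[rule_format, of "int (k - i)"] i in auto)
  qed
  also have "\<dots> = fps_nth (laurent_eval f x * laurent_eval g x) k"
    by (simp add: fps_mult_nth)
  finally show "fps_nth (laurent_eval (conv f g) x) k = fps_nth (laurent_eval f x * laurent_eval g x) k" .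
qed

text \<open>Formally, the recurrence says \<open>F x = b * x powi d * T powi e * F (T x)\<close>.\<close>

definition theta_like :: "int \<Rightarrow> int \<Rightarrow> complex \<Rightarrow> (complex \<Rightarrow> complex fps) \<Rightarrow> bool" where
  "theta_like d e b F \<longleftrightarrow> (\<exists>c. locfin c \<and> (\<forall>m k. c (m + d) k = b * c m (k - m - e)) \<and>
     (\<forall>x. x \<noteq> 0 \<longrightarrow> F x = laurent_eval c x))"

lemma theta_like_mult:
  assumes "theta_like d e b F" "theta_like d' e' b' F'"
  shows "theta_like (d + d') (e + e') (b * b') (\<lambda>x. F x * F' x)"
proof -
  obtain c where c: "locfin c" "\<And>m k. c (m + d) k = b * c m (k - m - e)" "\<And>x. x \<noteq> 0 \<Longrightarrow> F x = laurent_eval c x"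
    using assms(1) unfolding theta_like_def by blast
  obtain c' where c': "locfin c'" "\<And>m k. c' (m + d') k = b' * c' m (k - m - e')" "\<And>x. x \<noteq> 0 \<Longrightarrow> F' x = laurent_eval c' x"
    using assms(2) unfolding theta_like_def by blast
  have "conv c c' (m + (d + d')) k = b * b' * conv c c' m (k - m - (e + e'))" for m k
  proof -
    \<comment> \<open>Moving the index (a, i) of the factor \<open>c\<close> by (d, a + e) uses up
      the recurrence of \<open>c\<close> and leaves exactly the shift that the recurrence of
      \<open>c'\<close> absorbs.\<close>
    let ?l = "\<lambda>(a, i). (a + d, i + a + e)"
    let ?g = "\<lambda>(a, i). c a i * c' (m + (d + d') - a) (k - i)"
    let ?h = "\<lambda>(a, i). c a i * c' (m - a) (k - m - (e + e') - i)"
    have fin: "finite {p. ?h p \<noteq> 0}" by (rule conv_finite[OF c(1) c'(1)])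
    have "bij ?l"
      by (rule bij_betw_byWitness[where f' = "\<lambda>(a, i). (a - d, i - (a - d) - e)"]) auto
    moreover have "?g \<circ> ?l = (\<lambda>p. (b * b') * ?h p)"
    proof
      fix p :: "int \<times> int"
      obtain a i where p: "p = (a, i)" by force
      have "c' (m + (d + d') - (a + d)) (k - (i + a + e)) = c' ((m - a) + d') (k - i - a - e)"
        by (simp add: algebra_simps)
      also have "\<dots> = b' * c' (m - a) (k - m - (e + e') - i)"
        unfolding c'(2) by (simp add: algebra_simps)
      finally show "(?g \<circ> ?l) p = (b * b') * ?h p" using c(2)[of a "i + a + e"] by (simp add: p)
    qed
    ultimately have "Sum_any ?g = Sum_any (\<lambda>p. (b * b') * ?h p)" by (rule Sum_any.reindex_cong)
    also have "\<dots> = (b * b') * Sum_any ?h" by (rule Sum_any_right_distrib[OF fin, symmetric])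
    finally show ?thesis unfolding conv_def .
  qed
  moreover have "F x * F' x = laurent_eval (conv c c') x" if "x \<noteq> 0" for x
    using c(3) c'(3) that laurent_eval_conv[OF c(1) c'(1) that] by simp
  ultimately show ?thesis
    unfolding theta_like_def using locfin_conv[OF c(1) c'(1)] by blast
qed


text \<open>The factor x^(-p) picks up T^(-p) under x -> T x, and e grows by p to
  compensate.\<close>

lemma theta_like_shift:
  assumes "theta_like d e b F"
  shows "theta_like d (e + p) b (\<lambda>x. fps_const (x powi (-p)) * F x)"
proof -
  obtain c where c: "locfin c" "\<And>m k. c (m + d) k = b * c m (k - m - e)" "\<And>x. x \<noteq> 0 \<Longrightarrow> F x = laurent_eval c x"
    using assms unfolding theta_like_def by blast
  let ?c = "\<lambda>m k. c (m + p) k"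
  have lf: "locfin ?c"
  proof -
    have "finite {m. c (m + p) k \<noteq> 0}" for k
    proof -
      have "{m. c (m + p) k \<noteq> 0} = (\<lambda>m. m - p) ` {m. c m k \<noteq> 0}" by force
      then show ?thesis using c(1) by (simp add: locfin_def)
    qed
    then show ?thesis using c(1) by (simp add: locfin_def)
  qed
  have rec: "?c (m + d) k = b * ?c m (k - m - (e + p))" for m k
    using c(2)[of "m + p" k] by (simp add: algebra_simps)
  have "fps_const (x powi (-p)) * F x = laurent_eval ?c x" if x: "x \<noteq> 0" for x
  proof (rule fps_ext)
    fix k
    let ?S = "{m. c m (int k) \<noteq> 0}"
    have fin: "finite ?S" using c(1) by (simp add: locfin_def)
    have "fps_nth (fps_const (x powi (-p)) * F x) k = x powi (-p) * (\<Sum>m\<in>?S. c m (int k) * x powi m)"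
      using c(3)[OF x] fin by (simp add: laurent_eval_nth[where A = ?S])
    also have "\<dots> = (\<Sum>m\<in>?S. c m (int k) * x powi (m - p))"
      using x by (simp add: sum_distrib_left power_int_diff power_int_minus divide_simps)
    also have "\<dots> = (\<Sum>m\<in>(\<lambda>m. m - p) ` ?S. ?c m (int k) * x powi m)"
      by (subst sum.reindex) (auto simp: inj_on_def)
    also have "\<dots> = fps_nth (laurent_eval ?c x) k"
      by (rule laurent_eval_nth[symmetric]) (use fin in force)+
    finally show "fps_nth (fps_const (x powi (-p)) * F x) k = fps_nth (laurent_eval ?c x) k" .
  qed
  then show ?thesis unfolding theta_like_def using lf rec by blast
qed

text \<open>Coefficients of Jacobi's theta series, the sum of (-x)^m T^(m (m - 1) / 2) over all
  integers m. The condition on k is doubled to avoid a division.\<close>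

definition theta_coeff :: "int \<Rightarrow> int \<Rightarrow> complex" where
  "theta_coeff m k = (if 2 * k = m * (m - 1) then if even m then 1 else -1 else 0)"

definition theta :: "complex \<Rightarrow> complex fps" where
  "theta x = laurent_eval theta_coeff x"

lemma theta_coeff_bound: "theta_coeff m k \<noteq> 0 \<Longrightarrow> m \<in> {-(2*k+1)..2*k+1}"
proof -
  assume "theta_coeff m k \<noteq> 0"
  then have "2 * k = m * (m - 1)" by (auto simp: theta_coeff_def split: if_splits)
  moreover have "\<bar>m\<bar> \<le> m * (m - 1) + 1"
  proof (cases "m \<le> 0")
    case True
    then have "m * (m - 1) = (-m) * (1 - m)" by (simp add: algebra_simps)
    moreover have "(-m) * (1 - m) \<ge> (-m) * 1" using True by (intro mult_left_mono) auto
    ultimately show ?thesis using True by linarith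
  next
    case False
    have "(m - 1) * m \<ge> (m - 1) * 1" using False by (intro mult_left_mono) auto
    then show ?thesis using False by (simp add: mult.commute)
  qed
  ultimately show ?thesis by auto
qed

lemma theta_coeff_nonneg: "k < 0 \<Longrightarrow> theta_coeff m k = 0"
  using theta_coeff_bound[of m k] by force

lemma theta_coeff_finite: "finite {m. theta_coeff m k \<noteq> 0}"
  by (rule finite_subset[of _ "{-(2*k+1)..2*k+1}"]) (use theta_coeff_bound in blast)+

lemma theta_nth: "fps_nth (theta x) k = (\<Sum>m | theta_coeff m (int k) \<noteq> 0. theta_coeff m (int k) * x powi m)"
  unfolding theta_def by (rule laurent_eval_nth) (auto simp: theta_coeff_finite)

text \<open>The functional equation theta x = - x theta (T x), read off coefficientwise.\<close>

lemma theta_coeff_Suc: "theta_coeff (m + 1) k = - theta_coeff m (k - m)"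
proof -
  have "2 * k = (m + 1) * (m + 1 - 1) \<longleftrightarrow> 2 * (k - m) = m * (m - 1)" by (auto simp: algebra_simps)
  then show ?thesis by (simp add: theta_coeff_def)
qed

lemma theta_like_theta:
  assumes y: "y \<noteq> 0"
  shows "theta_like 1 0 (-y) (\<lambda>x. theta (x * y))"
  unfolding theta_like_def
proof (intro exI[of _ "\<lambda>m k. theta_coeff m k * y powi m"] conjI allI impI)
  show "locfin (\<lambda>m k. theta_coeff m k * y powi m)"
    using y by (auto simp: locfin_def theta_coeff_nonneg theta_coeff_finite)
  show "theta_coeff (m + 1) k * y powi (m + 1) = - y * (theta_coeff m (k - m - 0) * y powi m)" for m k
    using y by (simp add: theta_coeff_Suc power_int_add)
  show "theta (x * y) = laurent_eval (\<lambda>m k. theta_coeff m k * y powi m) x" for x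
    by (simp add: theta_def laurent_eval_def power_int_mult_distrib mult_ac)
qed

text \<open>Passing from x to T x multiplies x^2 by T^2, so the recurrence of theta is applied
  twice: (-x^2) (-T x^2) = T x^4.\<close>

lemma theta_like_theta_square: "theta_like 4 1 1 (\<lambda>x. theta (x\<^sup>2))"
  unfolding theta_like_def
proof (intro exI[of _ "\<lambda>m k. if even m then theta_coeff (m div 2) k else 0"] conjI allI impI)
  let ?c = "\<lambda>m k. if even m then theta_coeff (m div 2) k else 0 :: complex"
  have supp: "{m. ?c m k \<noteq> 0} = (\<lambda>m. 2 * m) ` {m. theta_coeff m k \<noteq> 0}" for k
    by (auto elim!: evenE)
  show "locfin ?c"
    unfolding locfin_def supp by (auto simp: theta_coeff_nonneg theta_coeff_finite)
  show "?c (m + 4) k = 1 * ?c m (k - m - 1)" for m k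
  proof (cases "even m")
    case True
    then obtain a where a: "m = 2 * a" by (elim evenE)
    have "(m + 4) div 2 = (a + 1) + 1" using a by simp
    then have "theta_coeff ((m + 4) div 2) k = theta_coeff a (k - m - 1)"
      by (simp only: theta_coeff_Suc) (simp add: a algebra_simps)
    then show ?thesis using a by simp
  qed simp
  show "theta (x\<^sup>2) = laurent_eval ?c x" if "x \<noteq> 0" for x
  proof (rule fps_ext)
    fix k
    let ?S = "{m. theta_coeff m (int k) \<noteq> 0}"
    have pw: "x\<^sup>2 powi m = x powi (2 * m)" for m
      by (simp add: power_int_mult)
    have "fps_nth (theta (x\<^sup>2)) k = (\<Sum>m\<in>?S. theta_coeff m (int k) * x powi (2 * m))"
      by (simp add: theta_nth pw)
    also have "\<dots> = (\<Sum>m\<in>(\<lambda>m. 2 * m) ` ?S. ?c m (int k) * x powi m)"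
      by (subst sum.reindex) (auto simp: inj_on_def)
    also have "\<dots> = fps_nth (laurent_eval ?c x) k"
    proof (rule laurent_eval_nth[symmetric])
      show "m \<in> (\<lambda>m. 2 * m) ` ?S" if "?c m (int k) \<noteq> 0" for m
        using that unfolding supp[symmetric] by blast
    qed (simp add: theta_coeff_finite)
    finally show "fps_nth (theta (x\<^sup>2)) k = fps_nth (laurent_eval ?c x) k" .
  qed
qed

text \<open>The multipliers -y and -1/y of each pair cancel, so the quasi-period in x does not
  depend on the remaining variables.\<close>

lemma theta_like_prod_pairs:
  assumes "finite J" "\<And>j. j \<in> J \<Longrightarrow> y j \<noteq> 0"
  shows "theta_like (4 + 2 * int (card J)) 1 1 (\<lambda>x. theta (x\<^sup>2) * (\<Prod>j\<in>J. theta (x * y j) * theta (x / y j)))"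
  using assms
proof (induction J rule: finite_induct)
  case empty
  then show ?case using theta_like_theta_square by simp
next
  case (insert j J)
  have "theta_like (1 + 1) (0 + 0) ((- y j) * (- (1 / y j))) (\<lambda>x. theta (x * y j) * theta (x * (1 / y j)))"
    by (intro theta_like_mult theta_like_theta) (use insert in auto)
  then have "theta_like 2 0 1 (\<lambda>x. theta (x * y j) * theta (x / y j))"
    using insert.prems[of j] by simp
  from theta_like_mult[OF insert.IH this] show ?case
    using insert by (simp add: mult_ac)
qed

text \<open>The functions \<open>elem_theta n r\<close> for \<open>r\<close> modulo \<open>2 n + 2\<close> span the solutions of the recurrence with
  \<open>d = 2 n + 2\<close>, \<open>e = n + 1\<close>, \<open>b = 1\<close>; those that are odd under \<open>x \<mapsto> 1 / x\<close> are spanned by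
  \<open>sympl_theta n r\<close> for \<open>1 \<le> r \<le> n\<close>.\<close>

definition elem_theta :: "nat \<Rightarrow> int \<Rightarrow> complex \<Rightarrow> complex fps" where
  "elem_theta n r x = Abs_fps (\<lambda>k. Sum_any (\<lambda>l. if (int n + 1) * l\<^sup>2 + r * l = int k
     then x powi (r + (2 * int n + 2) * l) else 0))"

definition sympl_theta :: "nat \<Rightarrow> int \<Rightarrow> complex \<Rightarrow> complex fps" where
  "sympl_theta n r x = elem_theta n r x - elem_theta n (- r) x"

text \<open>The exponent is at least (n + 1) |l| (|l| - 1), so each degree of T is reached by
  finitely many l.\<close>

lemma exponent_bound:
  assumes "\<bar>r\<bar> \<le> int n + 1" 
  shows "(int n + 1) * l\<^sup>2 + r * l \<ge> \<bar>l\<bar> - 1"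
proof -
  have "- (r * l) \<le> \<bar>r\<bar> * \<bar>l\<bar>" by (metis abs_ge_minus_self abs_mult)
  also have "\<dots> \<le> (int n + 1) * \<bar>l\<bar>" using assms by (rule mult_right_mono) simp
  finally have 1: "(int n + 1) * l\<^sup>2 + r * l \<ge> (int n + 1) * (\<bar>l\<bar> * (\<bar>l\<bar> - 1))"
    by (simp add: power2_eq_square algebra_simps abs_mult_self_eq)
  show ?thesis
  proof (cases "l = 0")
    case False
    then have "1 * (\<bar>l\<bar> - 1) \<le> \<bar>l\<bar> * (\<bar>l\<bar> - 1)" by (intro mult_right_mono) auto
    also have "1 * (\<bar>l\<bar> * (\<bar>l\<bar> - 1)) \<le> (int n + 1) * (\<bar>l\<bar> * (\<bar>l\<bar> - 1))"
      using False by (intro mult_right_mono) auto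
    then have "\<bar>l\<bar> * (\<bar>l\<bar> - 1) \<le> (int n + 1) * (\<bar>l\<bar> * (\<bar>l\<bar> - 1))" by (simp only: mult_1)
    also note 1
    finally show ?thesis by (simp only: mult_1)
  qed simp
qed

lemma exponent_nonneg:
  assumes "\<bar>r\<bar> \<le> int n + 1" 
  shows "(int n + 1) * l\<^sup>2 + r * l \<ge> 0"
  using exponent_bound[OF assms, of l] by (cases "l = 0") auto

lemma elem_theta_nth:
  assumes "\<bar>r\<bar> \<le> int n + 1" "int k + 1 \<le> B"
  shows "fps_nth (elem_theta n r x) k = (\<Sum>l\<in>{-B..B}. if (int n + 1) * l\<^sup>2 + r * l = int k
     then x powi (r + (2 * int n + 2) * l) else 0)"
  unfolding elem_theta_def fps_nth_Abs_fps
proof (rule Sum_any.expand_superset)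
  show "{l. (if (int n + 1) * l\<^sup>2 + r * l = int k then x powi (r + (2 * int n + 2) * l) else 0) \<noteq> 0} \<subseteq> {-B..B}"
  proof clarify
    fix l assume "(if (int n + 1) * l\<^sup>2 + r * l = int k then x powi (r + (2 * int n + 2) * l) else 0) \<noteq> 0"
    then have "(int n + 1) * l\<^sup>2 + r * l = int k" by (auto split: if_splits)
    then show "l \<in> {-B..B}" using exponent_bound[OF assms(1), of l] assms(2) by auto
  qed
qed simp

lemma elem_theta_inverse:
  assumes "\<bar>r\<bar> \<le> int n + 1"
  shows "elem_theta n r (1 / x) = elem_theta n (- r) x"
proof (rule fps_ext)
  fix k
  have "fps_nth (elem_theta n r (1 / x)) k = (\<Sum>l\<in>{-(int k+1)..int k+1}. if (int n + 1) * l\<^sup>2 + r * l = int k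
     then (1 / x) powi (r + (2 * int n + 2) * l) else 0)"
    by (rule elem_theta_nth[OF assms]) simp
  also have "\<dots> = (\<Sum>l\<in>{-(int k+1)..int k+1}. if (int n + 1) * l\<^sup>2 + (-r) * l = int k
     then x powi ((-r) + (2 * int n + 2) * l) else 0)"
  proof (rule sum.reindex_bij_witness[of _ uminus uminus], goal_cases)
    case (5 l)
    have "(1 / x) powi m = x powi (- m)" for m by (simp add: power_int_minus power_int_divide_distrib divide_simps)
    then have "(1 / x) powi (r + (2 * int n + 2) * l) = x powi ((-r) + (2 * int n + 2) * (- l))"
      by (simp add: algebra_simps)
    then show ?case by auto
  qed auto
  also have "\<dots> = fps_nth (elem_theta n (- r) x) k"
    by (rule elem_theta_nth[symmetric]) (use assms in auto)
  finally show "fps_nth (elem_theta n r (1 / x)) k = fps_nth (elem_theta n (- r) x) k" .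
qed

text \<open>n + 1 and -(n + 1) are congruent modulo 2 n + 2, and l -> l - 1 matches the two series.
  Hence \<open>sympl_theta\<close> vanishes at n + 1.\<close>

lemma elem_theta_top: "elem_theta n (- (int n + 1)) x = elem_theta n (int n + 1) x"
proof (rule fps_ext)
  fix k
  have *: "Sum_any (\<lambda>l. if (int n + 1) * l\<^sup>2 + (int n + 1) * l = int k then x powi ((int n + 1) + (2 * int n + 2) * l) else 0)
    = Sum_any (\<lambda>l. if (int n + 1) * l\<^sup>2 + (-(int n + 1)) * l = int k then x powi (-(int n + 1) + (2 * int n + 2) * l) else 0)"
  proof (rule Sum_any.reindex_cong[of "\<lambda>l. l - 1"])
    show "bij (\<lambda>l::int. l - 1)" by (rule bij_betw_byWitness[where f' = "\<lambda>l. l + 1"]) auto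
    have "(int n + 1) * (l - 1)\<^sup>2 + (int n + 1) * (l - 1) = (int n + 1) * l\<^sup>2 + (-(int n + 1)) * l"
      and "(int n + 1) + (2 * int n + 2) * (l - 1) = -(int n + 1) + (2 * int n + 2) * l" for l
      by (simp_all add: power2_eq_square algebra_simps)
    then show "(\<lambda>l. if (int n + 1) * l\<^sup>2 + (int n + 1) * l = int k then x powi ((int n + 1) + (2 * int n + 2) * l) else 0) \<circ> (\<lambda>l. l - 1)
      = (\<lambda>l. if (int n + 1) * l\<^sup>2 + (-(int n + 1)) * l = int k then x powi (-(int n + 1) + (2 * int n + 2) * l) else 0)"
      by (simp only: comp_def)
  qed
  show "fps_nth (elem_theta n (- (int n + 1)) x) k = fps_nth (elem_theta n (int n + 1) x) k"
    unfolding elem_theta_def fps_nth_Abs_fps using * by simp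
qed

lemma theta_like_expand:
  assumes "theta_like (2 * int n + 2) (int n + 1) 1 F"
  obtains c where "\<And>x. x \<noteq> 0 \<Longrightarrow> F x = (\<Sum>r\<in>{- int n..int n + 1}. c r * elem_theta n r x)"
proof -
  let ?N = "2 * int n + 2"
  obtain c where c: "locfin c" "\<And>m k. c (m + ?N) k = c m (k - m - (int n + 1))" "\<And>x. x \<noteq> 0 \<Longrightarrow> F x = laurent_eval c x"
    using assms unfolding theta_like_def mult_1 by blast
  \<comment> \<open>Iterating the recurrence l times sums an arithmetic progression of T-exponents.
    So \<open>c\<close> is determined by its values on one residue system modulo 2 n + 2.\<close>
  have rec: "c (r + ?N * l) k = c r (k - ((int n + 1) * l\<^sup>2 + r * l))" for r l k
  proof (induction l arbitrary: k rule: int_induct[of _ 0])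
    case (step1 i)
    have "c (r + ?N * (i + 1)) k = c ((r + ?N * i) + ?N) k" by (simp add: algebra_simps)
    also have "\<dots> = c (r + ?N * i) (k - (r + ?N * i) - (int n + 1))" by (rule c(2))
    also have "\<dots> = c r (k - ((int n + 1) * (i + 1)\<^sup>2 + r * (i + 1)))"
      unfolding step1.IH by (rule arg_cong[of _ _ "c r"]) (simp add: power2_eq_square algebra_simps)
    finally show ?case .
  next
    case (step2 i)
    let ?k = "k + (r + ?N * (i - 1)) + (int n + 1)"
    have "c (r + ?N * (i - 1)) k = c (r + ?N * (i - 1) + ?N) ?k"
      unfolding c(2) by (simp add: algebra_simps)
    also have "\<dots> = c (r + ?N * i) ?k" by (simp add: algebra_simps)
    also have "\<dots> = c r (k - ((int n + 1) * (i - 1)\<^sup>2 + r * (i - 1)))"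
      unfolding step2.IH by (rule arg_cong[of _ _ "c r"]) (simp add: power2_eq_square algebra_simps)
    finally show ?case .
  qed simp
  define C where "C = (\<lambda>r. Abs_fps (\<lambda>k. c r (int k)))"
  show ?thesis
  proof (rule that[of C], rule fps_ext)
    fix x :: complex and k assume x: "x \<noteq> 0"
    obtain L where L: "L \<ge> 0" "\<forall>m i. i \<le> int k \<longrightarrow> c m i \<noteq> 0 \<longrightarrow> m \<in> {-L..L}" using locfin_bound[OF c(1), of k] by blast
    define B where "B = L + int k + 2"
    let ?R = "{- int n..int n + 1}"
    have "fps_nth (F x) k = (\<Sum>m\<in>(\<lambda>(r, l). r + ?N * l) ` (?R \<times> {-B..B}). c m (int k) * x powi m)"
      unfolding c(3)[OF x]
    proof (rule laurent_eval_nth)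
      fix m assume "c m (int k) \<noteq> 0"
      then have m: "m \<in> {-L..L}" using L(2) by blast
      \<comment> \<open>Euclidean division, shifted by n so that the remainder falls into -n..n +
        1.\<close>
      define l where "l = (m + int n) div ?N"
      define r where "r = (m + int n) mod ?N - int n"
      have mrl: "m = r + ?N * l" unfolding l_def r_def
        by (metis add_diff_cancel_right' diff_add_eq mod_mult_div_eq)
      have "0 \<le> (m + int n) mod ?N" "(m + int n) mod ?N < ?N" by simp_all
      then have r: "r \<in> ?R" unfolding r_def atLeastAtMost_iff by linarith
      have "\<bar>?N * l\<bar> \<le> ?N * (L + 1)"
      proof -
        have "\<bar>?N * l\<bar> \<le> \<bar>m\<bar> + \<bar>r\<bar>" using mrl by linarith
        also have "\<dots> \<le> L + ?N" using m r by auto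
        also have "\<dots> \<le> ?N * L + ?N" using L(1) by (simp add: algebra_simps)
        finally show ?thesis by (simp add: algebra_simps)
      qed
      then have "?N * \<bar>l\<bar> \<le> ?N * (L + 1)" by (simp add: abs_mult)
      then have "\<bar>l\<bar> \<le> L + 1" by (rule mult_left_le_imp_le) simp
      then have "l \<in> {-B..B}" using L(1) by (auto simp: B_def)
      then show "m \<in> (\<lambda>(r, l). r + ?N * l) ` (?R \<times> {-B..B})" using mrl r by force
    qed simp
    also have "\<dots> = (\<Sum>(r, l)\<in>?R \<times> {-B..B}. c (r + ?N * l) (int k) * x powi (r + ?N * l))"
    proof (subst sum.reindex)
      show "inj_on (\<lambda>(r, l). r + ?N * l) (?R \<times> {-B..B})"
      proof (rule inj_onI, clarify)
        fix r l r' l' assume *: "r \<in> ?R" "r' \<in> ?R" "r + ?N * l = r' + ?N * l'"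
        have "(r + int n) + ?N * l = (r' + int n) + ?N * l'" using *(3) by linarith
        then have "((r + int n) + ?N * l) mod ?N = ((r' + int n) + ?N * l') mod ?N" by (rule arg_cong)
        then have "(r + int n) mod ?N = (r' + int n) mod ?N" by (simp only: mod_mult_self2)
        then have "r = r'" using *(1,2) by simp
        then show "r = r' \<and> l = l'" using * by simp
      qed
    qed (simp add: case_prod_unfold comp_def)
    also have "\<dots> = (\<Sum>r\<in>?R. \<Sum>l\<in>{-B..B}. c r (int k - ((int n + 1) * l\<^sup>2 + r * l)) * x powi (r + ?N * l))"
      by (simp only: rec sum.cartesian_product)
    also have "\<dots> = (\<Sum>r\<in>?R. fps_nth (C r * elem_theta n r x) k)"
    proof (rule sum.cong[OF refl])
      fix r assume "r \<in> ?R"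
      then have r: "\<bar>r\<bar> \<le> int n + 1" by auto
      let ?e = "\<lambda>l. (int n + 1) * l\<^sup>2 + r * l"
      have "fps_nth (C r * elem_theta n r x) k
          = (\<Sum>i=0..k. c r (int i) * (\<Sum>l\<in>{-B..B}. if ?e l = int (k - i) then x powi (r + ?N * l) else 0))"
        unfolding fps_mult_nth C_def fps_nth_Abs_fps
        by (intro sum.cong refl arg_cong2[of _ _ _ _ "(*)"] elem_theta_nth[OF r]) (use L(1) in \<open>auto simp: B_def\<close>)
      also have "\<dots> = (\<Sum>l\<in>{-B..B}. \<Sum>i=0..k. c r (int i) * (if ?e l = int (k - i) then x powi (r + ?N * l) else 0))"
        unfolding sum_distrib_left by (rule sum.swap)
      also have "\<dots> = (\<Sum>l\<in>{-B..B}. c r (int k - ?e l) * x powi (r + ?N * l))"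
      proof (rule sum.cong[OF refl])
        fix l
        have e0: "?e l \<ge> 0" using exponent_nonneg[OF r] .
        show "(\<Sum>i=0..k. c r (int i) * (if ?e l = int (k - i) then x powi (r + ?N * l) else 0)) = c r (int k - ?e l) * x powi (r + ?N * l)"
        \<comment> \<open>The Cauchy product selects the single index i = k minus the exponent. When
          the exponent exceeds k there is no such i, and on the other side \<open>c\<close> vanishes
          at a negative power of T.\<close>
        proof (cases "?e l \<le> int k")
          case True
          define i where "i = nat (int k - ?e l)"
          have i: "int i = int k - ?e l" "i \<le> k" using True e0 by (auto simp: i_def)
          have "?e l = int (k - j) \<longleftrightarrow> j = i" if "j \<in> {0..k}" for j using that i by (auto simp: of_nat_diff)
          then have "(\<Sum>j=0..k. c r (int j) * (if ?e l = int (k - j) then x powi (r + ?N * l) else 0))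
             = (\<Sum>j=0..k. if j = i then c r (int j) * x powi (r + ?N * l) else 0)"
            by (intro sum.cong) auto
          also have "\<dots> = c r (int i) * x powi (r + ?N * l)" using i(2) by simp
          finally show ?thesis unfolding i(1) .
        next
          case False
          then have "(\<Sum>j=0..k. c r (int j) * (if ?e l = int (k - j) then x powi (r + ?N * l) else 0)) = 0"
            by (intro sum.neutral) auto
          moreover have "c r (int k - ?e l) = 0" using False c(1) by (auto simp: locfin_def)
          ultimately show ?thesis by simp
        qed
      qed
      finally show "(\<Sum>l\<in>{-B..B}. c r (int k - ((int n + 1) * l\<^sup>2 + r * l)) * x powi (r + ?N * l)) = fps_nth (C r * elem_theta n r x) k" ..
    qed
    finally show "fps_nth (F x) k = fps_nth (\<Sum>r\<in>?R. C r * elem_theta n r x) k"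
      by (simp add: fps_sum_nth)
  qed
qed

lemma theta_like_odd_expand:
  assumes "theta_like (2 * int n + 2) (int n + 1) 1 F"
    and odd: "\<And>x. x \<noteq> 0 \<Longrightarrow> F (1 / x) = - F x"
  shows "\<exists>c. \<forall>x. x \<noteq> 0 \<longrightarrow> F x = (\<Sum>r=1..n. c r * sympl_theta n (int r) x)"
proof -
  obtain C where C: "\<And>x. x \<noteq> 0 \<Longrightarrow> F x = (\<Sum>r\<in>{- int n..int n + 1}. C r * elem_theta n r x)"
    using theta_like_expand[OF assms(1)] by blast
  show ?thesis
  proof (intro exI[of _ "\<lambda>r. fps_const (1/2) * (C (int r) - C (- int r))"] allI impI)
    fix x :: complex assume x: "x \<noteq> 0"
    let ?t = "\<lambda>r. C r * sympl_theta n r x"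
    have "2 * F x = F x - F (1 / x)" using odd[OF x] by (simp )
    also have "\<dots> = (\<Sum>r\<in>{- int n..int n + 1}. C r * elem_theta n r x) - (\<Sum>r\<in>{- int n..int n + 1}. C r * elem_theta n r (1 / x))"
      using C[of x] C[of "1 / x"] x by simp
    also have "\<dots> = (\<Sum>r\<in>{- int n..int n + 1}. ?t r)"
      unfolding sum_subtractf[symmetric]
    proof (rule sum.cong[OF refl])
      fix r assume "r \<in> {- int n..int n + 1}"
      then have "elem_theta n r (1 / x) = elem_theta n (- r) x" by (intro elem_theta_inverse) auto
      then show "C r * elem_theta n r x - C r * elem_theta n r (1 / x) = ?t r"
        by (simp add: sympl_theta_def algebra_simps)
    qed
    \<comment> \<open>0 and n + 1 are the residues fixed by r -> -r modulo 2 n + 2 and contribute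
      nothing to an odd function; the others form pairs r, -r.\<close>
    also have "{- int n..int n + 1} = insert 0 (insert (int n + 1) ({1..int n} \<union> uminus ` {1..int n}))"
    proof (rule set_eqI)
      fix x
      have "x \<in> uminus ` {1..int n} \<longleftrightarrow> - x \<in> {1..int n}" by force
      then show "x \<in> {- int n..int n + 1} \<longleftrightarrow> x \<in> insert 0 (insert (int n + 1) ({1..int n} \<union> uminus ` {1..int n}))"
        by auto
    qed
    also have "(\<Sum>r\<in>\<dots>. ?t r) = (\<Sum>r\<in>{1..int n} \<union> uminus ` {1..int n}. ?t r)"
    proof (rule sum.mono_neutral_right)
      have "?t 0 = 0" "?t (int n + 1) = 0" using elem_theta_top[of n x] by (simp_all add: sympl_theta_def)
      then show "\<forall>r\<in>insert 0 (insert (int n + 1) ({1..int n} \<union> uminus ` {1..int n})) - ({1..int n} \<union> uminus ` {1..int n}). ?t r = 0"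
        by blast
    qed auto
    also have "\<dots> = (\<Sum>r\<in>{1..int n}. ?t r) + (\<Sum>r\<in>uminus ` {1..int n}. ?t r)"
      by (rule sum.union_disjoint) auto
    also have "(\<Sum>r\<in>uminus ` {1..int n}. ?t r) = (\<Sum>r\<in>{1..int n}. ?t (- r))"
      by (subst sum.reindex) (auto simp: inj_on_def)
    also have "(\<Sum>r\<in>{1..int n}. ?t r) + (\<Sum>r\<in>{1..int n}. ?t (- r)) = (\<Sum>r\<in>{1..int n}. (C r - C (- r)) * sympl_theta n r x)"
      unfolding sum.distrib[symmetric] by (intro sum.cong refl) (simp add: sympl_theta_def algebra_simps)
    also have "\<dots> = (\<Sum>r=1..n. (C (int r) - C (- int r)) * sympl_theta n (int r) x)"
      by (rule sum.reindex_bij_witness[of _ int nat]) auto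
    finally have "fps_const (1/2) * (2 * F x) = fps_const (1/2) * (\<Sum>r=1..n. (C (int r) - C (- int r)) * sympl_theta n (int r) x)"
      by simp
    moreover have "fps_const (1/2) * 2 = (1 :: complex fps)"
      by (simp add: numeral_fps_const)
    ultimately show "F x = (\<Sum>r=1..n. fps_const (1/2) * (C (int r) - C (- int r)) * sympl_theta n (int r) x)"
      by (simp add: mult.assoc[symmetric] sum_distrib_left)
  qed
qed

subsection \<open>The Jacobi triple product modulo a power of the variable\<close>

definition fps_cong :: "nat \<Rightarrow> complex fps \<Rightarrow> complex fps \<Rightarrow> bool" where
  "fps_cong n f g \<longleftrightarrow> (\<forall>k\<le>n. fps_nth f k = fps_nth g k)"

lemma fps_cong_refl [simp]: "fps_cong n f f"
  and fps_cong_sym: "fps_cong n f g \<Longrightarrow> fps_cong n g f"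
  and fps_cong_trans [trans]: "fps_cong n f g \<Longrightarrow> fps_cong n g h \<Longrightarrow> fps_cong n f h"
  by (simp_all add: fps_cong_def)

lemma fps_cong_diff: "fps_cong n f f' \<Longrightarrow> fps_cong n g g' \<Longrightarrow> fps_cong n (f - g) (f' - g')"
  by (simp add: fps_cong_def)

lemma fps_cong_add: "fps_cong n f f' \<Longrightarrow> fps_cong n g g' \<Longrightarrow> fps_cong n (f + g) (f' + g')"
  by (simp add: fps_cong_def)

lemma fps_cong_mult: "fps_cong n f f' \<Longrightarrow> fps_cong n g g' \<Longrightarrow> fps_cong n (f * g) (f' * g')"
  by (simp add: fps_cong_def fps_mult_nth)

lemma fps_cong_sum: "(\<And>i. i \<in> A \<Longrightarrow> fps_cong n (f i) (g i)) \<Longrightarrow> fps_cong n (\<Sum>i\<in>A. f i) (\<Sum>i\<in>A. g i)"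
  by (simp add: fps_cong_def fps_sum_nth)

lemma fps_cong_prod: "(\<And>i. i \<in> A \<Longrightarrow> fps_cong n (f i) (g i)) \<Longrightarrow> fps_cong n (\<Prod>i\<in>A. f i) (\<Prod>i\<in>A. g i)"
  by (induction A rule: infinite_finite_induct) (auto intro: fps_cong_mult)

lemma fps_cong_cancel:
  assumes "fps_cong n (h * f) (h * g)" "fps_nth h 0 \<noteq> 0"
  shows "fps_cong n f g"
proof -
  have "fps_cong n (inverse h * (h * f)) (inverse h * (h * g))"
    by (rule fps_cong_mult[OF fps_cong_refl assms(1)])
  moreover have cancel: "inverse h * (h * u) = u" for u
    using inverse_mult_eq_1[OF assms(2)] by (simp add: mult.assoc[symmetric])
  ultimately show ?thesis unfolding cancel by blast
qed

lemma fps_cong_one_minus_X_power: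
  assumes "n < k"
  shows "fps_cong n (1 - fps_X ^ k * f) 1"
  using assms by (auto simp: fps_cong_def fps_X_power_mult_nth)

section \<open>Gaussian binomials and the finite triple product\<close>

definition qfact :: "nat \<Rightarrow> complex fps" where
  "qfact n = (\<Prod>k=1..n. 1 - fps_X ^ k)"

lemma qfact_Suc: "qfact (Suc n) = (1 - fps_X ^ Suc n) * qfact n"
  by (simp add: qfact_def mult.commute)

lemma qfact_nth_0: "fps_nth (qfact n) 0 = 1"
  by (induction n) (simp_all add: qfact_def)

lemma qfact_cong: "n \<le> m \<Longrightarrow> fps_cong n (qfact m) (qfact n)"
proof (induction m rule: dec_induct)
  case (step m)
  have "fps_cong n ((1 - fps_X ^ Suc m * 1) * qfact m) (1 * qfact n)"
    using step by (intro fps_cong_mult fps_cong_one_minus_X_power) auto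
  then show ?case by (simp add: qfact_Suc)
qed simp

text \<open>The value \<open>0\<close> at negative arguments extends \<open>iqfact_pred\<close> to \<open>p = 0\<close>.\<close>

definition iqfact :: "int \<Rightarrow> complex fps" where
  "iqfact p = (if p < 0 then 0 else inverse (qfact (nat p)))"

lemma iqfact_pred: "p \<ge> 0 \<Longrightarrow> iqfact (p - 1) = (1 - fps_X ^ nat p) * iqfact p"
proof (cases "p = 0")
  case False
  assume "p \<ge> 0"
  define q where "q = nat (p - 1)"
  have p: "nat p = Suc q" using False \<open>p \<ge> 0\<close> by (simp add: q_def)
  have "(1 - fps_X ^ Suc q) * (inverse (1 - fps_X ^ Suc q) * inverse (qfact q)) = inverse (qfact q)"
    using inverse_mult_eq_1'[of "1 - fps_X ^ Suc q :: complex fps"] by (simp add: mult.assoc[symmetric] del: power_Suc)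
  then show ?thesis using False \<open>p \<ge> 0\<close>
    by (simp add: iqfact_def p q_def[symmetric] qfact_Suc fps_inverse_mult del: power_Suc)
qed (simp add: iqfact_def)

definition tri :: "int \<Rightarrow> nat" where
  "tri m = nat (m * (m - 1) div 2)"

lemma tri_double: "2 * int (tri m) = m * (m - 1)"
proof -
  have "even (m * (m - 1))" by simp
  moreover have "m * (m - 1) \<ge> 0"
    by (cases "m \<le> 0") (auto intro: mult_nonpos_nonpos)
  ultimately show ?thesis by (simp add: tri_def)
qed

lemma tri_ge: "\<bar>m\<bar> \<le> int (tri m) + 1"
proof -
  have "0 \<le> (\<bar>m\<bar> - 1) * (\<bar>m\<bar> - 2)"
    by (cases "\<bar>m\<bar> \<le> 1") (auto intro: mult_nonpos_nonpos)
  then have "3 * \<bar>m\<bar> \<le> m * m + 2" by (simp add: algebra_simps)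
  moreover have "m * m - m \<ge> m * m - \<bar>m\<bar>" by simp
  ultimately show ?thesis using tri_double[of m] by (simp add: algebra_simps)
qed

lemma tri_step: "int (tri (m + 1)) = int (tri m) + m"
  using tri_double[of m] tri_double[of "m + 1"] by (simp add: algebra_simps)

text \<open>(-x)^m T^(m (m - 1) / 2) times the Gaussian binomial of a + b over b + m, which vanishes
  for m outside -b..a through the zeros of \<open>iqfact\<close>.\<close>

definition jtp_term :: "complex \<Rightarrow> nat \<Rightarrow> nat \<Rightarrow> int \<Rightarrow> complex fps" where
  "jtp_term x a b m = fps_const ((-x) powi m) * fps_X ^ tri m * (qfact (a + b) * iqfact (int b + m) * iqfact (int a - m))"

text \<open>The q-Pascal rule: with p = b + m and r = a + 1 - m it comes down to 1 - T^(p + r) = (1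
  - T^r) + T^r (1 - T^p).\<close>

lemma jtp_term_step_a:
  assumes x: "x \<noteq> 0" and m: "m \<in> {- int b..int a + 1}"
  shows "jtp_term x (Suc a) b m = jtp_term x a b m - fps_X ^ a * fps_const x * jtp_term x a b (m - 1)"
proof -
  define p where "p = nat (int b + m)"
  define r where "r = nat (int a + 1 - m)"
  have pr: "int p = int b + m" "int r = int a + 1 - m" using m by (auto simp: p_def r_def)
  then have sum: "p + r = Suc (a + b)" by linarith
  have 1: "iqfact (int p - 1) = (1 - fps_X ^ p) * iqfact (int p)" "iqfact (int r - 1) = (1 - fps_X ^ r) * iqfact (int r)"
    using iqfact_pred[of "int p"] iqfact_pred[of "int r"] by simp_all
  have 2: "x * (-x) powi (m - 1) = - ((-x) powi m)"
    using x by (simp add: power_int_diff)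
  have "int (tri (m - 1)) + int a = int (tri m) + int r" using tri_step[of "m - 1"] pr by simp
  then have 3: "fps_X ^ a * fps_X ^ tri (m - 1) = (fps_X ^ tri m * fps_X ^ r :: complex fps)"
    unfolding power_add[symmetric] by (simp only: of_nat_add[symmetric] of_nat_eq_iff add.commute)
  have "fps_X ^ a * fps_const x * jtp_term x a b (m - 1)
     = (fps_X ^ a * fps_X ^ tri (m - 1)) * fps_const (x * (-x) powi (m - 1)) * (qfact (a + b) * iqfact (int p - 1) * iqfact (int r))"
    unfolding jtp_term_def pr by (simp add: algebra_simps fps_const_mult[symmetric] del: fps_const_mult)
  also have "\<dots> = - (fps_const ((-x) powi m) * fps_X ^ tri m * (fps_X ^ r * (1 - fps_X ^ p)) * (qfact (a + b) * iqfact (int p) * iqfact (int r)))"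
    unfolding 1 2 3 by (simp add: fps_const_neg[symmetric] algebra_simps del: fps_const_neg)
  finally have A: "fps_X ^ a * fps_const x * jtp_term x a b (m - 1) = \<dots>" .
  have B: "jtp_term x a b m = fps_const ((-x) powi m) * fps_X ^ tri m * (1 - fps_X ^ r) * (qfact (a + b) * iqfact (int p) * iqfact (int r))"
  proof -
    have "int a - m = int r - 1" using pr by simp
    then have "iqfact (int a - m) = (1 - fps_X ^ r) * iqfact (int r)" using 1(2) by (simp only:)
    then show ?thesis unfolding jtp_term_def pr(1)[symmetric] by (simp only: mult_ac)
  qed
  have "jtp_term x (Suc a) b m = fps_const ((-x) powi m) * fps_X ^ tri m * (1 - fps_X ^ (p + r)) * (qfact (a + b) * iqfact (int p) * iqfact (int r))"
    unfolding jtp_term_def sum pr by (simp add: qfact_Suc algebra_simps del: power_Suc)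
  then show ?thesis unfolding A B by (simp add: algebra_simps power_add)
qed

text \<open>The other q-Pascal rule: with p = b + m + 1 and r = a - m it comes down to 1 - T^(p + r)
  = (1 - T^p) + T^p (1 - T^r).\<close>

lemma jtp_term_step_b:
  assumes x: "x \<noteq> 0" and m: "m \<in> {- int b - 1..int a}"
  shows "jtp_term x a (Suc b) m = jtp_term x a b m - fps_X ^ Suc b * fps_const (1 / x) * jtp_term x a b (m + 1)"
proof -
  define p where "p = nat (int b + m + 1)"
  define r where "r = nat (int a - m)"
  have pr: "int p = int b + m + 1" "int r = int a - m" using m by (auto simp: p_def r_def)
  then have sum: "p + r = Suc (a + b)" by linarith
  have 1: "iqfact (int p - 1) = (1 - fps_X ^ p) * iqfact (int p)" "iqfact (int r - 1) = (1 - fps_X ^ r) * iqfact (int r)"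
    using iqfact_pred[of "int p"] iqfact_pred[of "int r"] by simp_all
  have 2: "(1 / x) * (-x) powi (m + 1) = - ((-x) powi m)"
    using x by (simp add: power_int_add)
  have "int (tri (m + 1)) + int (Suc b) = int (tri m) + int p" using tri_step[of m] pr by simp
  then have 3: "fps_X ^ Suc b * fps_X ^ tri (m + 1) = (fps_X ^ tri m * fps_X ^ p :: complex fps)"
    unfolding power_add[symmetric] by (simp only: of_nat_add[symmetric] of_nat_eq_iff add.commute)
  have e: "int b + (m + 1) = int p" "int a - (m + 1) = int r - 1" "int b + m = int p - 1" "int (Suc b) + m = int p" using pr by auto
  have "fps_X ^ Suc b * fps_const (1 / x) * jtp_term x a b (m + 1)
     = (fps_X ^ Suc b * fps_X ^ tri (m + 1)) * fps_const ((1 / x) * (-x) powi (m + 1)) * (qfact (a + b) * iqfact (int p) * iqfact (int r - 1))"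
    unfolding jtp_term_def e by (simp add: algebra_simps fps_const_mult[symmetric] del: fps_const_mult power_Suc)
  also have "\<dots> = - (fps_const ((-x) powi m) * fps_X ^ tri m * (fps_X ^ p * (1 - fps_X ^ r)) * (qfact (a + b) * iqfact (int p) * iqfact (int r)))"
    unfolding 1 2 3 by (simp add: fps_const_neg[symmetric] algebra_simps del: fps_const_neg)
  finally have A: "fps_X ^ Suc b * fps_const (1 / x) * jtp_term x a b (m + 1) = \<dots>" .
  have B: "jtp_term x a b m = fps_const ((-x) powi m) * fps_X ^ tri m * (1 - fps_X ^ p) * (qfact (a + b) * iqfact (int p) * iqfact (int r))"
    unfolding jtp_term_def e pr(2)[symmetric] 1 by (simp add: algebra_simps)
  have "jtp_term x a (Suc b) m = fps_const ((-x) powi m) * fps_X ^ tri m * (1 - fps_X ^ (p + r)) * (qfact (a + b) * iqfact (int p) * iqfact (int r))"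
    unfolding jtp_term_def sum e pr(2)[symmetric] by (simp add: qfact_Suc algebra_simps del: power_Suc)
  then show ?thesis unfolding A B by (simp add: algebra_simps power_add)
qed

lemma jtp_term_eq_0: "m < - int b \<or> m > int a \<Longrightarrow> jtp_term x a b m = 0"
  by (auto simp: jtp_term_def iqfact_def)

text \<open>The finite form of the Jacobi triple product. Each new linear factor is absorbed by one
  of the q-Pascal rules; the boundary terms vanish.\<close>

lemma finite_jtp:
  assumes x: "x \<noteq> 0"
  shows "(\<Prod>k<a. 1 - fps_X ^ k * fps_const x) * (\<Prod>k<b. 1 - fps_X ^ Suc k * fps_const (1 / x))
    = (\<Sum>m\<in>{- int b..int a}. jtp_term x a b m)"
proof (induction b)
  case 0
  show ?case
  proof (induction a)
    case 0
    show ?case by (simp add: jtp_term_def iqfact_def qfact_def tri_def)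
  next
    case (Suc a)
    let ?t = "jtp_term x a 0" and ?c = "fps_X ^ a * fps_const x :: complex fps"
    have "(\<Sum>m\<in>{0..int (Suc a)}. jtp_term x (Suc a) 0 m) = (\<Sum>m\<in>{0..int (Suc a)}. ?t m - ?c * ?t (m - 1))"
      by (intro sum.cong refl jtp_term_step_a x) auto
    also have "\<dots> = (\<Sum>m\<in>{0..int (Suc a)}. ?t m) - ?c * (\<Sum>m\<in>{0..int (Suc a)}. ?t (m - 1))"
      by (simp only: sum_subtractf sum_distrib_left)
    also have "(\<Sum>m\<in>{0..int (Suc a)}. ?t m) = (\<Sum>m\<in>{0..int a}. ?t m)"
      by (rule sum.mono_neutral_right) (auto intro: jtp_term_eq_0)
    also have "(\<Sum>m\<in>{0..int (Suc a)}. ?t (m - 1)) = (\<Sum>m\<in>{-1..int a}. ?t m)"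
      by (rule sum.reindex_bij_witness[of _ "\<lambda>m. m + 1" "\<lambda>m. m - 1"]) auto
    also have "\<dots> = (\<Sum>m\<in>{0..int a}. ?t m)"
      by (rule sum.mono_neutral_right) (auto intro: jtp_term_eq_0)
    finally show ?case using Suc by (simp add: algebra_simps)
  qed
next
  case (Suc b)
  let ?t = "jtp_term x a b" and ?c = "fps_X ^ Suc b * fps_const (1 / x) :: complex fps"
  have "(\<Sum>m\<in>{- int (Suc b)..int a}. jtp_term x a (Suc b) m) = (\<Sum>m\<in>{- int (Suc b)..int a}. ?t m - ?c * ?t (m + 1))"
    by (intro sum.cong refl jtp_term_step_b x) auto
  also have "\<dots> = (\<Sum>m\<in>{- int (Suc b)..int a}. ?t m) - ?c * (\<Sum>m\<in>{- int (Suc b)..int a}. ?t (m + 1))"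
    by (simp only: sum_subtractf sum_distrib_left)
  also have "(\<Sum>m\<in>{- int (Suc b)..int a}. ?t m) = (\<Sum>m\<in>{- int b..int a}. ?t m)"
    by (rule sum.mono_neutral_right) (auto intro: jtp_term_eq_0)
  also have "(\<Sum>m\<in>{- int (Suc b)..int a}. ?t (m + 1)) = (\<Sum>m\<in>{- int b..int a + 1}. ?t m)"
    by (rule sum.reindex_bij_witness[of _ "\<lambda>m. m - 1" "\<lambda>m. m + 1"]) auto
  also have "\<dots> = (\<Sum>m\<in>{- int b..int a}. ?t m)"
    by (rule sum.mono_neutral_right) (auto intro: jtp_term_eq_0)
  finally show ?case unfolding prod.lessThan_Suc mult.assoc[symmetric] Suc
    by (simp add: algebra_simps del: power_Suc)
qed

lemma theta_coeff_tri: "theta_coeff m (int k) * x powi m = (if tri m = k then (- x) powi m else 0)"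
proof -
  have "2 * int k = m * (m - 1) \<longleftrightarrow> tri m = k" using tri_double[of m] by auto
  then show ?thesis by (simp add: theta_coeff_def power_int_minus_left)
qed

lemma theta_cong_finite_jtp:
  assumes x: "x \<noteq> 0"
  shows "fps_cong n (theta x) (qfact (Suc n) * (\<Sum>m\<in>{- int (Suc n)..int (Suc n)}. jtp_term x (Suc n) (Suc n) m))"
proof -
  let ?M = "{- int (Suc n)..int (Suc n)}"
  have "fps_nth (theta x) k = (\<Sum>m\<in>?M. fps_nth (qfact (Suc n) * jtp_term x (Suc n) (Suc n) m) k)" if k: "k \<le> n" for k
  proof -
    have "fps_nth (theta x) k = (\<Sum>m\<in>?M. theta_coeff m (int k) * x powi m)"
      unfolding theta_def
    proof (rule laurent_eval_nth)
      fix m assume "theta_coeff m (int k) \<noteq> 0"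
      then have "tri m = k" using theta_coeff_tri[of m k 1] by (auto split: if_splits)
      then show "m \<in> ?M" using tri_ge[of m] k by auto
    qed simp
    also have "\<dots> = (\<Sum>m\<in>?M. fps_nth (qfact (Suc n) * jtp_term x (Suc n) (Suc n) m) k)"
    proof (rule sum.cong[OF refl])
      fix m assume m: "m \<in> ?M"
      define p where "p = nat (int (Suc n) + m)"
      define r where "r = nat (int (Suc n) - m)"
      \<comment> \<open>Here q = n + 1 - |m|. All q-factorials of index at least q agree up to T^q,
        so \<open>?u\<close> is 1 to that order. The factor T^(tri m) with tri m >= |m| - 1 raises
        the accuracy to T^n.\<close>
      define q where "q = min p r"
      have pr: "int p = int (Suc n) + m" "int r = int (Suc n) - m" using m by (auto simp: p_def r_def)
      then have q: "int q = int (Suc n) - \<bar>m\<bar>" by (auto simp: q_def)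
      let ?u = "qfact (Suc n) * (qfact (Suc n + Suc n) * inverse (qfact p) * inverse (qfact r))"
      have qq: "q \<le> p" "q \<le> r" "q \<le> Suc n" using q pr by (auto simp: q_def)
      have "fps_cong q (qfact p * qfact r * ?u) (qfact p * qfact r * 1)"
      proof -
        have inv: "inverse (qfact p) * qfact p = 1" "inverse (qfact r) * qfact r = 1"
          by (simp_all add: inverse_mult_eq_1 qfact_nth_0)
        have "qfact p * qfact r * ?u = qfact (Suc n) * qfact (Suc n + Suc n) * ((inverse (qfact p) * qfact p) * (inverse (qfact r) * qfact r))"
          by (simp only: mult_ac)
        then have e: "qfact p * qfact r * ?u = qfact (Suc n) * qfact (Suc n + Suc n)"
          unfolding inv by simp
        have "fps_cong q (qfact (Suc n) * qfact (Suc n + Suc n)) (qfact q * qfact q)"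
          using qq by (intro fps_cong_mult qfact_cong) auto
        moreover have "fps_cong q (qfact q * qfact q) (qfact p * qfact r)"
          using qq by (intro fps_cong_mult fps_cong_sym[OF qfact_cong]) auto
        ultimately show ?thesis unfolding e mult_1_right by (rule fps_cong_trans)
      qed
      then have u: "fps_cong q ?u 1" by (rule fps_cong_cancel) (simp add: qfact_nth_0)
      have "qfact (Suc n) * jtp_term x (Suc n) (Suc n) m = fps_const ((-x) powi m) * (fps_X ^ tri m * ?u)"
        unfolding jtp_term_def pr[symmetric] by (simp add: iqfact_def mult_ac)
      then have "fps_nth (qfact (Suc n) * jtp_term x (Suc n) (Suc n) m) k = (-x) powi m * (if k < tri m then 0 else fps_nth ?u (k - tri m))"
        by (simp only: fps_mult_left_const_nth fps_X_power_mult_nth)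
      moreover have "fps_nth ?u (k - tri m) = (if tri m = k then 1 else 0)" if "\<not> k < tri m"
      proof -
        have "k - tri m \<le> q" using that k tri_ge[of m] q by linarith
        then have "fps_nth ?u (k - tri m) = fps_nth 1 (k - tri m)" using u by (simp only: fps_cong_def)
        then show ?thesis using that by auto
      qed
      ultimately show "theta_coeff m (int k) * x powi m = fps_nth (qfact (Suc n) * jtp_term x (Suc n) (Suc n) m) k"
        unfolding theta_coeff_tri by auto
    qed
    finally show ?thesis .
  qed
  then show ?thesis by (simp add: fps_cong_def sum_distrib_left fps_sum_nth)
qed

lemma theta_cong_prod:
  assumes x: "x \<noteq> 0"
  shows "fps_cong n (theta x) (fps_const (1 - x) * (\<Prod>k=1..n. (1 - fps_X ^ k) * (1 - fps_X ^ k * fps_const x) * (1 - fps_X ^ k * fps_const (1 / x))))"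
proof -
  have "fps_cong n (theta x) (qfact (Suc n) * ((\<Prod>k<Suc n. 1 - fps_X ^ k * fps_const x) * (\<Prod>k<Suc n. 1 - fps_X ^ Suc k * fps_const (1 / x))))"
    using theta_cong_finite_jtp[OF x, of n] unfolding finite_jtp[OF x] .
  also have "fps_cong n \<dots> (qfact n * ((fps_const (1 - x) * (\<Prod>k=1..n. 1 - fps_X ^ k * fps_const x)) * (\<Prod>k=1..n. 1 - fps_X ^ k * fps_const (1 / x))))"
  proof (intro fps_cong_mult)
    show "fps_cong n (qfact (Suc n)) (qfact n)" by (rule qfact_cong) simp
    have "(\<Prod>k<Suc n. 1 - fps_X ^ k * fps_const x) = fps_const (1 - x) * (\<Prod>k<n. 1 - fps_X ^ Suc k * fps_const x)"
      unfolding prod.lessThan_Suc_shift by (simp add: fps_const_sub[symmetric] del: fps_const_sub)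
    also have "(\<Prod>k<n. 1 - fps_X ^ Suc k * fps_const x) = (\<Prod>k=1..n. 1 - fps_X ^ k * fps_const x)"
      by (rule prod.reindex_bij_witness[of _ "\<lambda>k. k - 1" Suc]) auto
    finally show "fps_cong n (\<Prod>k<Suc n. 1 - fps_X ^ k * fps_const x) (fps_const (1 - x) * (\<Prod>k=1..n. 1 - fps_X ^ k * fps_const x))"
      by simp
    have "fps_cong n (\<Prod>k<Suc n. 1 - fps_X ^ Suc k * fps_const (1 / x)) ((\<Prod>k<n. 1 - fps_X ^ Suc k * fps_const (1 / x)) * 1)"
      unfolding prod.lessThan_Suc by (intro fps_cong_mult fps_cong_one_minus_X_power) auto
    also have "(\<Prod>k<n. 1 - fps_X ^ Suc k * fps_const (1 / x)) = (\<Prod>k=1..n. 1 - fps_X ^ k * fps_const (1 / x))"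
      by (rule prod.reindex_bij_witness[of _ "\<lambda>k. k - 1" Suc]) auto
    finally show "fps_cong n (\<Prod>k<Suc n. 1 - fps_X ^ Suc k * fps_const (1 / x)) (\<Prod>k=1..n. 1 - fps_X ^ k * fps_const (1 / x))"
      by simp
  qed
  finally show ?thesis by (simp add: qfact_def prod.distrib mult_ac)
qed

text \<open>m -> 1 - m preserves m (m - 1) / 2 and changes the parity of m.\<close>

lemma theta_inverse:
  assumes x: "x \<noteq> 0"
  shows "theta (1 / x) = - fps_const (1 / x) * theta x"
proof (rule fps_ext)
  fix k
  let ?S = "{m. theta_coeff m (int k) \<noteq> 0}"
  have sym: "theta_coeff (1 - m) (int k) = - theta_coeff m (int k)" for m
    by (auto simp: theta_coeff_def algebra_simps)
  have "fps_nth (theta (1 / x)) k = (\<Sum>m\<in>?S. theta_coeff m (int k) * (1 / x) powi m)"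
    by (rule theta_nth)
  also have "\<dots> = (\<Sum>m\<in>?S. - (1 / x) * (theta_coeff m (int k) * x powi m))"
  proof (rule sum.reindex_bij_witness[of _ "\<lambda>m. 1 - m" "\<lambda>m. 1 - m"])
    fix m assume "m \<in> ?S"
    have "(1 / x) powi m = (1 / x) * x powi (1 - m)"
      using x by (simp add: power_int_diff power_int_divide_distrib)
    then show "- (1 / x) * (theta_coeff (1 - m) (int k) * x powi (1 - m)) = theta_coeff m (int k) * (1 / x) powi m"
      by (simp add: sym)
  qed (auto simp: sym)
  also have "\<dots> = fps_nth (- fps_const (1 / x) * theta x) k"
    by (simp add: theta_nth sum_distrib_left sum_negf)
  finally show "fps_nth (theta (1 / x)) k = fps_nth (- fps_const (1 / x) * theta x) k" .
qed

text \<open>The reason for truncating at n: the summands l = 0 and l = -1 have T-degrees 0 and n + 1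
  - r, and every other l gives a degree above n.\<close>

lemma elem_theta_cong:
  assumes r: "1 \<le> r" "r \<le> n"
  shows "fps_cong n (elem_theta n (int r) x)
     (fps_const (x powi int r) + fps_const (x powi (int r - (2 * int n + 2))) * fps_X ^ (n + 1 - r))"
  unfolding fps_cong_def
proof (intro allI impI)
  fix k assume k: "k \<le> n"
  let ?e = "\<lambda>l. (int n + 1) * l\<^sup>2 + int r * l" and ?B = "int n + 1"
  have e: "?e l > int n" if "l \<noteq> 0" "l \<noteq> -1" for l
  proof (cases "l > 0")
    case True
    then have "(int n + 1) * l\<^sup>2 \<ge> (int n + 1) * 1" by (intro mult_left_mono) (simp_all add: int_one_le_iff_zero_less)
    moreover have "int r * l \<ge> 0" using True by simp
    ultimately have "(int n + 1) * 1 + 0 \<le> ?e l" by (rule add_mono)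
    then show ?thesis by simp
  next
    case False
    then have l: "- l \<ge> 2" using that by auto
    have "?e l = (- l) * ((int n + 1) * (- l) - int r)" by (simp add: power2_eq_square algebra_simps)
    also have "\<dots> \<ge> 2 * ((int n + 1) * 2 - int r)"
    proof (rule mult_mono)
      have "(int n + 1) * (-l) \<ge> (int n + 1) * 2" using l by (intro mult_left_mono) auto
      then show "(int n + 1) * 2 - int r \<le> (int n + 1) * (-l) - int r" by simp
    qed (use l r in auto)
    finally have "2 * ((int n + 1) * 2 - int r) \<le> ?e l" .
    moreover have "int n < 2 * ((int n + 1) * 2 - int r)" using r by simp
    ultimately show ?thesis by (rule less_le_trans[rotated])
  qed
  have "fps_nth (elem_theta n (int r) x) k = (\<Sum>l\<in>{-?B..?B}. if ?e l = int k then x powi (int r + (2 * int n + 2) * l) else 0)"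
    by (rule elem_theta_nth) (use r k in auto)
  also have "\<dots> = (\<Sum>l\<in>{0,-1}. if ?e l = int k then x powi (int r + (2 * int n + 2) * l) else 0)"
  proof (rule sum.mono_neutral_right)
    show "\<forall>l\<in>{-?B..?B} - {0,-1}. (if ?e l = int k then x powi (int r + (2 * int n + 2) * l) else 0) = 0"
      using e k by force
  qed auto
  also have "\<dots> = (if k = 0 then x powi int r else 0) + (if k = n + 1 - r then x powi (int r - (2 * int n + 2)) else 0)"
  proof -
    have A: "int r + (2 * int n + 2) * (- 1) = int r - (2 * int n + 2)" by simp
    have "?e (- 1) = int k \<longleftrightarrow> k = n + 1 - r" using r by (auto simp: of_nat_diff)
    then have "(if ?e (-1) = int k then x powi (int r + (2 * int n + 2) * (-1)) else 0)
       = (if k = n + 1 - r then x powi (int r - (2 * int n + 2)) else 0)" by (simp only: A)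
    moreover have "(if ?e 0 = int k then x powi (int r + (2 * int n + 2) * 0) else 0) = (if k = 0 then x powi int r else 0)"
      by simp
    moreover have "(\<Sum>l\<in>{0,-1}. g l) = g 0 + g (-1)" for g :: "int \<Rightarrow> complex" by simp
    ultimately show ?thesis by (simp only:)
  qed
  also have "\<dots> = fps_nth (fps_const (x powi int r) + fps_const (x powi (int r - (2 * int n + 2))) * fps_X ^ (n + 1 - r)) k"
    by (simp add: fps_X_power_nth)
  finally show "fps_nth (elem_theta n (int r) x) k = fps_nth (fps_const (x powi int r) + fps_const (x powi (int r - (2 * int n + 2))) * fps_X ^ (n + 1 - r)) k" .
qed

text \<open>The entries of the determinants in Weyl's character formula for Sp(2 n); on the unit
  circle this is 2 i times a sine.\<close>

definition sympl_diff :: "nat \<Rightarrow> complex \<Rightarrow> complex" where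
  "sympl_diff a x = x ^ a - (1 / x) ^ a"

lemma sympl_theta_cong:
  assumes r: "1 \<le> r" "r \<le> n" and x: "x \<noteq> 0"
  shows "fps_cong n (sympl_theta n (int r) x)
     (fps_const (sympl_diff r x) - fps_const (sympl_diff (2 * n + 2 - r) x) * fps_X ^ (n + 1 - r))"
proof -
  have 1: "elem_theta n (- int r) x = elem_theta n (int r) (1 / x)"
    using r by (intro elem_theta_inverse[symmetric]) auto
  have 2: "y powi (int r - (2 * int n + 2)) = (1 / y) ^ (2 * n + 2 - r)" for y :: complex
  proof -
    have "int r - (2 * int n + 2) = - int (2 * n + 2 - r)" using r by (simp add: of_nat_diff)
    then show ?thesis by (simp only: power_int_minus power_int_of_nat power_one_over inverse_eq_divide)
  qed
  have "fps_cong n (sympl_theta n (int r) x)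
     ((fps_const (x powi int r) + fps_const (x powi (int r - (2 * int n + 2))) * fps_X ^ (n + 1 - r))
      - (fps_const ((1/x) powi int r) + fps_const ((1/x) powi (int r - (2 * int n + 2))) * fps_X ^ (n + 1 - r)))"
    unfolding sympl_theta_def 1 by (intro fps_cong_diff elem_theta_cong r)
  also have "\<dots> = (fps_const (sympl_diff r x) - fps_const (sympl_diff (2 * n + 2 - r) x) * fps_X ^ (n + 1 - r))"
    unfolding 2 sympl_diff_def
    by (simp add: fps_const_sub[symmetric] algebra_simps del: fps_const_sub)
  finally show ?thesis .
qed

text \<open>At such x the power of x no longer depends on l, so x and T separate. The dependence on
  x is then that of a finite sine.\<close>

lemma sympl_theta_root_of_unity:
  assumes r: "1 \<le> r" "r \<le> n" and x: "x ^ (2 * n + 2) = 1"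
  shows "sympl_theta n (int r) x = fps_const (sympl_diff r x) * elem_theta n (int r) 1"
proof -
  have *: "elem_theta n (int r) x = fps_const (x ^ r) * elem_theta n (int r) 1" if x: "x ^ (2 * n + 2) = 1" for x
  proof (rule fps_ext)
    fix k
    have x0: "x \<noteq> 0" using x by auto
    have "x powi (2 * int n + 2) = 1" using x by (metis of_nat_add of_nat_mult of_nat_numeral power_int_of_nat)
    then have p: "x powi (int r + (2 * int n + 2) * l) = x ^ r" for l
      using x0 by (simp add: power_int_add power_int_mult)
    have B: "int k + 1 \<le> int k + 1" by simp
    have "\<bar>int r\<bar> \<le> int n + 1" using r by auto
    note nth = elem_theta_nth[OF this B]
    show "fps_nth (elem_theta n (int r) x) k = fps_nth (fps_const (x ^ r) * elem_theta n (int r) 1) k"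
      unfolding fps_mult_left_const_nth nth p sum_distrib_left by (intro sum.cong) auto
  qed
  have "elem_theta n (- int r) x = elem_theta n (int r) (1 / x)"
    using r by (intro elem_theta_inverse[symmetric]) auto
  also have "\<dots> = fps_const ((1 / x) ^ r) * elem_theta n (int r) 1"
    using x by (intro *) (simp add: power_one_over)
  finally show ?thesis using *[OF x]
    by (simp add: sympl_theta_def sympl_diff_def fps_const_sub[symmetric] algebra_simps del: fps_const_sub)
qed

lemma elem_theta_1_cong:
  assumes r: "1 \<le> r" "r \<le> n"
  shows "fps_cong n (elem_theta n (int r) 1) (1 + fps_X ^ (n + 1 - r))"
  using elem_theta_cong[OF r, of 1] by simp

subsection \<open>Alternating functions that are linear combinations in every slot\<close>

lemma sum_PiE_insert:
  assumes "a \<notin> A" 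
  shows "(\<Sum>g\<in>PiE (insert a A) B. f g) = (\<Sum>b\<in>B a. \<Sum>g\<in>PiE A B. f (g(a := b)))"
proof -
  have "(\<Sum>g\<in>PiE (insert a A) B. f g) = (\<Sum>(b, g)\<in>B a \<times> PiE A B. f (g(a := b)))"
    unfolding PiE_insert_eq by (subst sum.reindex[OF inj_combinator[OF assms]]) (simp add: case_prod_unfold comp_def)
  then show ?thesis by (simp add: sum.cartesian_product)
qed

text \<open>Multivariate interpolation. M inverts the matrix of the values phi q (y k), so in each
  slot the coefficients of F are recovered from its values on the grid y. The set A holds the slots
  already expanded.\<close>

lemma slotwise_expansion:
  fixes F :: "(nat \<Rightarrow> complex) \<Rightarrow> 'k :: comm_ring_1"
  assumes fin: "finite I"
    and slot: "\<And>i x. i \<in> I \<Longrightarrow> (\<And>j. x j \<noteq> 0) \<Longrightarrow> \<exists>c. \<forall>t. t \<noteq> 0 \<longrightarrow> F (x(i := t)) = (\<Sum>r\<in>I. c r * \<phi> r t)"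
    and y: "\<And>k. k \<in> I \<Longrightarrow> y k \<noteq> 0"
    and dual: "\<And>r q. r \<in> I \<Longrightarrow> q \<in> I \<Longrightarrow> (\<Sum>k\<in>I. M r k * \<phi> q (y k)) = (if r = q then 1 else 0)"
    and x: "\<And>j. x j \<noteq> 0"
    and A: "A \<subseteq> I"
  shows "F x = (\<Sum>\<rho>\<in>PiE A (\<lambda>_. I). \<Sum>\<kappa>\<in>PiE A (\<lambda>_. I). (\<Prod>i\<in>A. M (\<rho> i) (\<kappa> i)) *
            F (\<lambda>i. if i \<in> A then y (\<kappa> i) else x i) * (\<Prod>i\<in>A. \<phi> (\<rho> i) (x i)))"
proof -
  have step: "F x = (\<Sum>r\<in>I. \<Sum>k\<in>I. M r k * F (x(i := y k)) * \<phi> r (x i))" if i: "i \<in> I" and x: "\<And>j. x j \<noteq> 0" for i x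
  proof -
    obtain c where "\<forall>t. t \<noteq> 0 \<longrightarrow> F (x(i := t)) = (\<Sum>r\<in>I. c r * \<phi> r t)" using slot[OF i x] ..
    then have c: "F (x(i := t)) = (\<Sum>r\<in>I. c r * \<phi> r t)" if "t \<noteq> 0" for t using that by simp
    have "(\<Sum>k\<in>I. M r k * F (x(i := y k))) = c r" if r: "r \<in> I" for r
    proof -
      have "(\<Sum>k\<in>I. M r k * F (x(i := y k))) = (\<Sum>k\<in>I. \<Sum>q\<in>I. c q * (M r k * \<phi> q (y k)))"
        by (intro sum.cong refl) (simp add: c y sum_distrib_left mult_ac)
      also have "\<dots> = (\<Sum>q\<in>I. c q * (\<Sum>k\<in>I. M r k * \<phi> q (y k)))"
        by (subst sum.swap) (simp add: sum_distrib_left)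
      also have "\<dots> = (\<Sum>q\<in>I. if q = r then c q else 0)"
        by (intro sum.cong refl) (use dual r in auto)
      also have "\<dots> = c r" using r fin by simp
      finally show ?thesis .
    qed
    then have "(\<Sum>r\<in>I. (\<Sum>k\<in>I. M r k * F (x(i := y k))) * \<phi> r (x i)) = (\<Sum>r\<in>I. c r * \<phi> r (x i))" by simp
    also have "\<dots> = F (x(i := x i))" using c[of "x i"] x by simp
    finally show ?thesis by (simp add: sum_distrib_right)
  qed
  have "finite A" using A fin by (rule finite_subset)
  then show ?thesis using A x
  proof (induction A arbitrary: x rule: finite_induct)
    case empty
    then show ?case by simp
  next
    case (insert a A)
    have aI: "a \<in> I" "A \<subseteq> I" using insert by auto
    let ?P = "PiE A (\<lambda>_. I)"
    let ?x = "\<lambda>k. x(a := y k)"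
    let ?G = "\<lambda>\<kappa> k. F (\<lambda>i. if i \<in> insert a A then y ((\<kappa>(a := k)) i) else x i)"
    have upd: "(\<lambda>i. if i \<in> A then y (\<kappa> i) else (?x k) i) = (\<lambda>i. if i \<in> insert a A then y ((\<kappa>(a := k)) i) else x i)" for \<kappa> k
      using insert.hyps by auto
    have pr: "(\<Prod>i\<in>A. g i ((h(a := b)) i)) = (\<Prod>i\<in>A. g i (h i))" for g :: "nat \<Rightarrow> nat \<Rightarrow> 'k" and h b
      using insert.hyps by (intro prod.cong) auto
    have "F x = (\<Sum>r\<in>I. \<Sum>k\<in>I. M r k * F (?x k) * \<phi> r (x a))" by (rule step) (use aI insert.prems in auto)
    also have "\<dots> = (\<Sum>r\<in>I. \<Sum>k\<in>I. \<Sum>\<rho>\<in>?P. \<Sum>\<kappa>\<in>?P. (M r k * (\<Prod>i\<in>A. M (\<rho> i) (\<kappa> i))) *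
            ?G \<kappa> k * (\<phi> r (x a) * (\<Prod>i\<in>A. \<phi> (\<rho> i) (x i))))"
    proof (intro sum.cong refl)
      fix r k assume "r \<in> I" "k \<in> I"
      have "F (?x k) = (\<Sum>\<rho>\<in>?P. \<Sum>\<kappa>\<in>?P. (\<Prod>i\<in>A. M (\<rho> i) (\<kappa> i)) *
            ?G \<kappa> k * (\<Prod>i\<in>A. \<phi> (\<rho> i) ((?x k) i)))"
        unfolding upd[symmetric] by (rule insert.IH) (use aI insert.prems y \<open>k \<in> I\<close> in auto)
      moreover have "(\<Prod>i\<in>A. \<phi> (\<rho> i) ((?x k) i)) = (\<Prod>i\<in>A. \<phi> (\<rho> i) (x i))" for \<rho>
        using insert.hyps by (intro prod.cong) auto
      ultimately show "M r k * F (?x k) * \<phi> r (x a) = (\<Sum>\<rho>\<in>?P. \<Sum>\<kappa>\<in>?P. (M r k * (\<Prod>i\<in>A. M (\<rho> i) (\<kappa> i))) *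
            ?G \<kappa> k * (\<phi> r (x a) * (\<Prod>i\<in>A. \<phi> (\<rho> i) (x i))))"
        by (simp add: sum_distrib_left sum_distrib_right mult_ac)
    qed
    also have "\<dots> = (\<Sum>r\<in>I. \<Sum>\<rho>\<in>?P. \<Sum>k\<in>I. \<Sum>\<kappa>\<in>?P. (M r k * (\<Prod>i\<in>A. M (\<rho> i) (\<kappa> i))) *
            ?G \<kappa> k * (\<phi> r (x a) * (\<Prod>i\<in>A. \<phi> (\<rho> i) (x i))))"
      by (rule sum.cong[OF refl], rule sum.swap)
    also have "\<dots> = (\<Sum>\<rho>\<in>PiE (insert a A) (\<lambda>_. I). \<Sum>\<kappa>\<in>PiE (insert a A) (\<lambda>_. I). (\<Prod>i\<in>insert a A. M (\<rho> i) (\<kappa> i)) *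
            F (\<lambda>i. if i \<in> insert a A then y (\<kappa> i) else x i) * (\<Prod>i\<in>insert a A. \<phi> (\<rho> i) (x i)))"
    proof -
      have p1: "(\<Prod>i\<in>insert a A. M ((\<rho>(a := r)) i) ((\<kappa>(a := k)) i)) = M r k * (\<Prod>i\<in>A. M (\<rho> i) (\<kappa> i))" for \<rho> \<kappa> r k
      proof -
        have "(\<Prod>i\<in>A. M ((\<rho>(a := r)) i) ((\<kappa>(a := k)) i)) = (\<Prod>i\<in>A. M (\<rho> i) (\<kappa> i))"
          using insert.hyps by (intro prod.cong) auto
        then show ?thesis using insert.hyps by simp
      qed
      have p2: "(\<Prod>i\<in>insert a A. \<phi> ((\<rho>(a := r)) i) (x i)) = \<phi> r (x a) * (\<Prod>i\<in>A. \<phi> (\<rho> i) (x i))" for \<rho> r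
      proof -
        have "(\<Prod>i\<in>A. \<phi> ((\<rho>(a := r)) i) (x i)) = (\<Prod>i\<in>A. \<phi> (\<rho> i) (x i))"
          using insert.hyps by (intro prod.cong) auto
        then show ?thesis using insert.hyps by simp
      qed
      show ?thesis unfolding sum_PiE_insert[OF insert.hyps(2)] p1 p2 ..
    qed
    finally show ?case .
  qed
qed

text \<open>Functions in \<open>PiE\<close> are undefined outside I while permutations are the
  identity there. The hypothesis \<open>cong\<close> lets f ignore this difference.\<close>

lemma sum_permutes_PiE:
  assumes fin: "finite I"
    and zero: "\<And>\<rho>. \<rho> \<in> PiE I (\<lambda>_. I) \<Longrightarrow> \<not> inj_on \<rho> I \<Longrightarrow> f \<rho> = 0"
    and cong: "\<And>\<rho> \<rho>'. (\<And>i. i \<in> I \<Longrightarrow> \<rho> i = \<rho>' i) \<Longrightarrow> f \<rho> = f \<rho>'"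
  shows "(\<Sum>\<rho>\<in>PiE I (\<lambda>_. I). f \<rho>) = (\<Sum>p | p permutes I. f p)"
proof -
  have "(\<Sum>\<rho>\<in>PiE I (\<lambda>_. I). f \<rho>) = (\<Sum>\<rho>\<in>{\<rho>\<in>PiE I (\<lambda>_. I). inj_on \<rho> I}. f \<rho>)"
    by (rule sum.mono_neutral_right) (use fin zero in \<open>auto intro!: finite_PiE\<close>)
  also have "\<dots> = (\<Sum>p | p permutes I. f p)"
  proof (rule sum.reindex_bij_witness[of _ "\<lambda>p. restrict p I" "\<lambda>\<rho> i. if i \<in> I then \<rho> i else i"])
    fix \<rho> assume \<rho>: "\<rho> \<in> {\<rho>\<in>PiE I (\<lambda>_. I). inj_on \<rho> I}"
    show "restrict (\<lambda>i. if i \<in> I then \<rho> i else i) I = \<rho>"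
      using \<rho> by (auto simp: restrict_def PiE_def extensional_def fun_eq_iff)
    have "bij_betw \<rho> I I"
      unfolding bij_betw_def using \<rho> fin endo_inj_surj[of I \<rho>] by auto
    then have "bij_betw (\<lambda>i. if i \<in> I then \<rho> i else i) I I" by (rule bij_betw_cong[THEN iffD1, rotated]) simp
    then show "(\<lambda>i. if i \<in> I then \<rho> i else i) \<in> {p. p permutes I}"
      by (auto intro: bij_imp_permutes)
    show "f (\<lambda>i. if i \<in> I then \<rho> i else i) = f \<rho>" by (rule cong) simp
  next
    fix p assume p: "p \<in> {p. p permutes I}"
    then show "(\<lambda>i. if i \<in> I then restrict p I i else i) = p" by (auto simp: permutes_def fun_eq_iff)
    show "restrict p I \<in> {\<rho>\<in>PiE I (\<lambda>_. I). inj_on \<rho> I}"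
      using p by (auto simp: permutes_in_image permutes_inj_on inj_on_def dest: permutes_inj_on)
  qed
  finally show ?thesis .
qed

text \<open>The determinant of m with rows and columns indexed by I.\<close>

definition alt_sum :: "nat set \<Rightarrow> (nat \<Rightarrow> nat \<Rightarrow> 'k) \<Rightarrow> 'k :: comm_ring_1" where
  "alt_sum I m = (\<Sum>p | p permutes I. of_int (sign p) * (\<Prod>i\<in>I. m (p i) i))"

text \<open>The interpolation coefficient c of the product of the phi (rho i) (x i) is alternating
  in rho. It vanishes when rho repeats a value, since then c = -c, and on a permutation it is the
  sign times its value at the identity, so the expansion is a multiple of the determinant.\<close>

lemma alternating_slotwise:
  fixes F :: "(nat \<Rightarrow> complex) \<Rightarrow> 'k :: {idom, semiring_char_0}"
  assumes fin: "finite I"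
    and slot: "\<And>i x. i \<in> I \<Longrightarrow> (\<And>j. x j \<noteq> 0) \<Longrightarrow> \<exists>c. \<forall>t. t \<noteq> 0 \<longrightarrow> F (x(i := t)) = (\<Sum>r\<in>I. c r * \<phi> r t)"
    and y: "\<And>k. k \<in> I \<Longrightarrow> y k \<noteq> 0"
    and dual: "\<And>r q. r \<in> I \<Longrightarrow> q \<in> I \<Longrightarrow> (\<Sum>k\<in>I. M r k * \<phi> q (y k)) = (if r = q then 1 else 0)"
    and cong: "\<And>x x'. (\<And>i. i \<in> I \<Longrightarrow> x i = x' i) \<Longrightarrow> F x = F x'"
    and alt: "\<And>x a b. a \<in> I \<Longrightarrow> b \<in> I \<Longrightarrow> a \<noteq> b \<Longrightarrow> (\<And>i. i \<in> I \<Longrightarrow> x i \<noteq> 0) \<Longrightarrow> F (x \<circ> Transposition.transpose a b) = - F x"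
  shows "\<exists>C. \<forall>x. (\<forall>j. x j \<noteq> 0) \<longrightarrow> F x = C * alt_sum I (\<lambda>r i. \<phi> r (x i))"
proof -
  let ?P = "PiE I (\<lambda>_. I)"
  define c where "c = (\<lambda>\<rho>. \<Sum>\<kappa>\<in>?P. (\<Prod>i\<in>I. M (\<rho> i) (\<kappa> i)) * F (\<lambda>i. y (\<kappa> i)))"
  have exp: "F x = (\<Sum>\<rho>\<in>?P. c \<rho> * (\<Prod>i\<in>I. \<phi> (\<rho> i) (x i)))" if x: "\<And>j. x j \<noteq> 0" for x
  proof -
    have "F (\<lambda>i. if i \<in> I then y (\<kappa> i) else x i) = F (\<lambda>i. y (\<kappa> i))" for \<kappa> by (rule cong) simp
    then show ?thesis using slotwise_expansion[OF fin slot y dual x subset_refl]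
      by (simp add: c_def sum_distrib_right)
  qed
  have c_cong: "c \<rho> = c \<rho>'" if "\<And>i. i \<in> I \<Longrightarrow> \<rho> i = \<rho>' i" for \<rho> \<rho>'
    unfolding c_def using that by (intro sum.cong arg_cong2[of _ _ _ _ "(*)"] prod.cong refl) auto
  have c_swap: "c (\<rho> \<circ> Transposition.transpose a b) = - c \<rho>" if ab: "a \<in> I" "b \<in> I" "a \<noteq> b" for \<rho> a b
  proof -
    let ?\<tau> = "Transposition.transpose a b"
    have \<tau>: "?\<tau> permutes I" using ab by (simp add: permutes_swap_id)
    have inI: "?\<tau> i \<in> I \<longleftrightarrow> i \<in> I" for i using \<tau> by (simp add: permutes_in_image)
    have ext: "\<kappa> \<circ> ?\<tau> \<in> ?P" if "\<kappa> \<in> ?P" for \<kappa>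
      using that inI by (auto simp: PiE_def extensional_def)
    have "c (\<rho> \<circ> ?\<tau>) = (\<Sum>\<kappa>\<in>?P. (\<Prod>i\<in>I. M (\<rho> (?\<tau> i)) ((\<kappa> \<circ> ?\<tau>) i)) * F (\<lambda>i. y ((\<kappa> \<circ> ?\<tau>) i)))"
      unfolding c_def
      by (rule sum.reindex_bij_witness[of _ "\<lambda>\<kappa>. \<kappa> \<circ> ?\<tau>" "\<lambda>\<kappa>. \<kappa> \<circ> ?\<tau>"]) (use ext in \<open>auto simp: comp_assoc\<close>)
    also have "\<dots> = (\<Sum>\<kappa>\<in>?P. - ((\<Prod>i\<in>I. M (\<rho> i) (\<kappa> i)) * F (\<lambda>i. y (\<kappa> i))))"
    proof (rule sum.cong[OF refl])
      fix \<kappa> assume \<kappa>: "\<kappa> \<in> ?P"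
      have "(\<Prod>i\<in>I. M (\<rho> (?\<tau> i)) ((\<kappa> \<circ> ?\<tau>) i)) = (\<Prod>i\<in>I. M (\<rho> i) (\<kappa> i))"
        using prod.permute[OF \<tau>, of "\<lambda>i. M (\<rho> i) (\<kappa> i)"] by (simp add: comp_def)
      moreover have "F (\<lambda>i. y ((\<kappa> \<circ> ?\<tau>) i)) = - F (\<lambda>i. y (\<kappa> i))"
        using alt[OF ab, of "\<lambda>i. y (\<kappa> i)"] y \<kappa> by (force simp: comp_def)
      ultimately show "(\<Prod>i\<in>I. M (\<rho> (?\<tau> i)) ((\<kappa> \<circ> ?\<tau>) i)) * F (\<lambda>i. y ((\<kappa> \<circ> ?\<tau>) i)) = - ((\<Prod>i\<in>I. M (\<rho> i) (\<kappa> i)) * F (\<lambda>i. y (\<kappa> i)))"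
        by simp
    qed
    finally show ?thesis by (simp add: c_def sum_negf)
  qed
  have c_zero: "c \<rho> = 0" if not_inj: "\<not> inj_on \<rho> I" for \<rho>
  proof -
    from not_inj obtain a b where ab: "a \<in> I" "b \<in> I" "a \<noteq> b" "\<rho> a = \<rho> b" by (auto simp: inj_on_def)
    then have "\<rho> \<circ> Transposition.transpose a b = \<rho>" unfolding fun_eq_iff comp_def Transposition.transpose_def by simp
    then have "c \<rho> = - c \<rho>" using c_swap[OF ab(1-3), of \<rho>] by simp
    then have "2 * c \<rho> = 0" by (metis mult_2 add.right_inverse)
    then show ?thesis by simp
  qed
  have c_sign: "c p = of_int (sign p) * c id" if "p permutes I" for p
    using fin that
  proof (induction rule: permutes_rev_induct)
    case (swap a b p)
    have "permutation p" using swap fin by (auto simp: permutation_permutes)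
    then have "sign (p \<circ> Transposition.transpose a b) = - sign p"
      using swap by (subst sign_compose) (auto simp: permutation_swap_id sign_swap_id)
    moreover have "c (p \<circ> Transposition.transpose a b) = - c p" using swap by (intro c_swap) auto
    ultimately show ?case using swap.IH by (simp only: of_int_minus mult_minus_left)
  qed simp
  show ?thesis
  proof (intro exI[of _ "c id"] allI impI)
    fix x :: "nat \<Rightarrow> complex" assume x: "\<forall>j. x j \<noteq> 0"
    have "F x = (\<Sum>\<rho>\<in>?P. c \<rho> * (\<Prod>i\<in>I. \<phi> (\<rho> i) (x i)))" by (rule exp) (use x in blast)
    also have "\<dots> = (\<Sum>p | p permutes I. c p * (\<Prod>i\<in>I. \<phi> (p i) (x i)))"
    proof (rule sum_permutes_PiE[OF fin])
      fix \<rho> \<rho>' :: "nat \<Rightarrow> nat" assume *: "\<And>i. i \<in> I \<Longrightarrow> \<rho> i = \<rho>' i"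
      show "c \<rho> * (\<Prod>i\<in>I. \<phi> (\<rho> i) (x i)) = c \<rho>' * (\<Prod>i\<in>I. \<phi> (\<rho>' i) (x i))"
        using c_cong[OF *] * by simp
    qed (simp add: c_zero)
    also have "\<dots> = c id * alt_sum I (\<lambda>r i. \<phi> r (x i))"
      unfolding alt_sum_def sum_distrib_left
    proof (intro sum.cong refl)
      fix p assume "p \<in> {p. p permutes I}"
      then have "c p = of_int (sign p) * c id" using c_sign by blast
      then show "c p * (\<Prod>i\<in>I. \<phi> (p i) (x i)) = c id * (of_int (sign p) * (\<Prod>i\<in>I. \<phi> (p i) (x i)))"
        by (simp only: mult_ac)
    qed
    finally show "F x = c id * alt_sum I (\<lambda>r i. \<phi> r (x i))" .
  qed
qed

subsection \<open>Products over pairs\<close>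

definition pairs :: "nat set \<Rightarrow> (nat \<times> nat) set" where
  "pairs I = {(i, j). i \<in> I \<and> j \<in> I \<and> i < j}"

lemma finite_pairs [simp]: "finite I \<Longrightarrow> finite (pairs I)"
  by (rule finite_subset[of _ "I \<times> I"]) (auto simp: pairs_def)

lemma prod_pairs_insert:
  fixes h :: "nat \<Rightarrow> nat \<Rightarrow> 'k :: comm_monoid_mult"
  assumes "finite I" "a \<notin> I"
  shows "(\<Prod>(i, j)\<in>pairs (insert a I). h i j) = (\<Prod>(i, j)\<in>pairs I. h i j) * (\<Prod>k\<in>I. if a < k then h a k else h k a)"
proof -
  let ?g = "\<lambda>k. if a < k then (a, k) else (k, a)"
  have "pairs (insert a I) = pairs I \<union> ?g ` I"
    using assms(2) by (auto simp: pairs_def image_iff) (metis linorder_neqE_nat)+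
  moreover have "pairs I \<inter> ?g ` I = {}" using assms(2) by (auto simp: pairs_def)
  moreover have "inj_on ?g I" using assms(2) by (auto simp: inj_on_def split: if_splits)
  ultimately have "(\<Prod>(i, j)\<in>pairs (insert a I). h i j) = (\<Prod>(i, j)\<in>pairs I. h i j) * (\<Prod>(i, j)\<in>?g ` I. h i j)"
    using assms(1) by (simp only: prod.union_disjoint finite_pairs finite_imageI)
  also have "(\<Prod>(i, j)\<in>?g ` I. h i j) = (\<Prod>k\<in>I. case ?g k of (i, j) \<Rightarrow> h i j)"
    by (subst prod.reindex[OF \<open>inj_on ?g I\<close>]) (simp only: comp_def)
  also have "(\<Prod>k\<in>I. case ?g k of (i, j) \<Rightarrow> h i j) = (\<Prod>k\<in>I. if a < k then h a k else h k a)"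
    by (intro prod.cong) auto
  finally show ?thesis .
qed

text \<open>Antisymmetry moves a to the first argument everywhere. The sign produced depends on the
  indices alone, so the variable at a occurs only in the last product.\<close>

lemma prod_pairs_isolate:
  fixes h :: "nat \<Rightarrow> nat \<Rightarrow> 'k :: comm_ring_1"
  assumes "finite I" "a \<notin> I" and anti: "\<And>i j. i \<noteq> j \<Longrightarrow> h j i = - h i j"
  shows "(\<Prod>(i, j)\<in>pairs (insert a I). h i j) = (\<Prod>k\<in>I. if a < k then 1 else - 1) * (\<Prod>(i, j)\<in>pairs I. h i j) * (\<Prod>k\<in>I. h a k)"
proof -
  have "(\<Prod>k\<in>I. if a < k then h a k else h k a) = (\<Prod>k\<in>I. (if a < k then 1 else - 1) * h a k)"
  proof (intro prod.cong refl)
    fix k assume "k \<in> I"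
    then show "(if a < k then h a k else h k a) = (if a < k then 1 else - 1) * h a k"
      using anti[of a k] assms(2) by (cases "a = k") auto
  qed
  then show ?thesis unfolding prod_pairs_insert[OF assms(1,2)] by (simp add: prod.distrib mult_ac)
qed

text \<open>For k outside {a, b} the factors of a with k and of b with k trade places, and their
  orientation signs cancel. Only the factor of the pair {a, b} changes sign.\<close>

lemma prod_pairs_transpose:
  fixes h :: "'b \<Rightarrow> 'b \<Rightarrow> 'k :: comm_ring_1"
  assumes fin: "finite I" and ab: "a \<in> I" "b \<in> I" "a \<noteq> b" and anti: "\<And>i j. i \<in> I \<Longrightarrow> j \<in> I \<Longrightarrow> i \<noteq> j \<Longrightarrow> h (x j) (x i) = - h (x i) (x j)"
  shows "(\<Prod>(i, j)\<in>pairs I. h ((x \<circ> Transposition.transpose a b) i) ((x \<circ> Transposition.transpose a b) j)) = - (\<Prod>(i, j)\<in>pairs I. h (x i) (x j))"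
proof -
  define J where "J = I - {a, b}"
  have J: "finite J" "a \<notin> J" "b \<notin> insert a J" "I = insert b (insert a J)" using fin ab by (auto simp: J_def)
  have anti': "h (x j) (x i) = - h (x i) (x j)" if "i \<in> insert b (insert a J)" "j \<in> insert b (insert a J)" "i \<noteq> j" for i j
    using anti[of i j] that unfolding J(4)[symmetric] by blast
  let ?o = "\<lambda>x i j. if i < j then h (x i) (x j) else h (x j) (x i)"
  have split: "(\<Prod>(i, j)\<in>pairs I. h (z i) (z j)) = (\<Prod>(i, j)\<in>pairs J. h (z i) (z j)) * (\<Prod>k\<in>J. ?o z a k * ?o z b k) * ?o z b a" for z
    unfolding J(4) prod_pairs_insert[OF finite.insertI[OF J(1)] J(3)] prod_pairs_insert[OF J(1,2)]
    using J(1,2) by (simp add: prod.distrib mult_ac)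
  let ?z = "x \<circ> Transposition.transpose a b"
  have "(\<Prod>(i, j)\<in>pairs J. h (?z i) (?z j)) = (\<Prod>(i, j)\<in>pairs J. h (x i) (x j))"
    using J(2,3) by (intro prod.cong refl) (auto simp: pairs_def Transposition.transpose_def)
  moreover have "(\<Prod>k\<in>J. ?o ?z a k * ?o ?z b k) = (\<Prod>k\<in>J. ?o x a k * ?o x b k)"
  proof (intro prod.cong refl)
    fix k assume k: "k \<in> J"
    then have ne: "k \<noteq> a" "k \<noteq> b" using J by auto
    have "?z a = x b" "?z b = x a" "?z k = x k" using ne by (simp_all add: Transposition.transpose_def)
    moreover have "h (x k) (x a) = - h (x a) (x k)" "h (x k) (x b) = - h (x b) (x k)"
      using anti'[of a k] anti'[of b k] k ne by auto
    ultimately show "?o ?z a k * ?o ?z b k = ?o x a k * ?o x b k" by (simp add: mult.commute)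
  qed
  moreover have "?o ?z b a = - ?o x b a"
  proof -
    have "?z a = x b" "?z b = x a" by (simp_all add: Transposition.transpose_def)
    moreover have "h (x b) (x a) = - h (x a) (x b)" using anti'[of a b] ab by auto
    ultimately show ?thesis by simp
  qed
  ultimately show ?thesis unfolding split by simp
qed

subsection \<open>The theta product of type C\<close>

text \<open>The theta analogue of (1 - x y) (1 - x / y) / x = x + 1/x - y - 1/y. The prefactor makes
  it antisymmetric in x and y and invariant under x -> 1/x.\<close>

definition theta_pair :: "complex \<Rightarrow> complex \<Rightarrow> complex fps" where
  "theta_pair x y = fps_const (1 / x) * (theta (x * y) * theta (x / y))"

definition theta_long :: "complex \<Rightarrow> complex fps" where
  "theta_long x = fps_const (1 / x) * theta (x\<^sup>2)"

lemma theta_long_inverse: "x \<noteq> 0 \<Longrightarrow> theta_long (1 / x) = - theta_long x"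
  using theta_inverse[of "x\<^sup>2"] 
  by (simp add: theta_long_def power_one_over power2_eq_square mult.assoc[symmetric]
    fps_const_neg[symmetric] del: fps_const_neg)

lemma theta_pair_anti: "x \<noteq> 0 \<Longrightarrow> y \<noteq> 0 \<Longrightarrow> theta_pair y x = - theta_pair x y"
  using theta_inverse[of "x / y"] 
  by (simp add: theta_pair_def mult_ac fps_const_neg[symmetric] del: fps_const_neg)

lemma theta_pair_inverse: "x \<noteq> 0 \<Longrightarrow> y \<noteq> 0 \<Longrightarrow> theta_pair (1 / x) y = theta_pair x y"
proof -
  assume xy: "x \<noteq> 0" "y \<noteq> 0"
  have "theta (1 / x * y) = - fps_const (y / x) * theta (x / y)"
    using theta_inverse[of "x / y"] xy by simp
  moreover have "theta (1 / x / y) = - fps_const (1 / (x * y)) * theta (x * y)"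
    using theta_inverse[of "x * y"] xy by simp
  moreover have "x * (y / x) * (1 / (x * y)) = 1 / x" using xy by (simp add: field_simps)
  ultimately have "theta_pair (1 / x) y = fps_const (x * (y / x) * (1 / (x * y))) * (theta (x * y) * theta (x / y))"
    unfolding theta_pair_def fps_const_mult[symmetric] by (simp add: mult_ac del: fps_const_mult)
  then show ?thesis unfolding theta_pair_def \<open>x * (y / x) * (1 / (x * y)) = 1 / x\<close> .
qed

text \<open>The affine denominator of type C, up to a power of the Euler product.\<close>

definition theta_prod :: "nat \<Rightarrow> (nat \<Rightarrow> complex) \<Rightarrow> complex fps" where
  "theta_prod n x = (\<Prod>i=1..n. theta_long (x i)) * (\<Prod>(i, j)\<in>pairs {1..n}. theta_pair (x i) (x j))"

text \<open>In one variable the long root contributes 4 to the quasi-period and each of the other n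
  - 1 variables contributes 2, which gives d = 2 n + 2. The prefactor t^(-n) raises e from 1 to n +
  1. Oddness under inversion comes from the long root alone.\<close>

lemma theta_prod_slot:
  assumes i: "i \<in> {1..n}" and x: "\<And>j. x j \<noteq> 0"
  shows "\<exists>c. \<forall>t. t \<noteq> 0 \<longrightarrow> theta_prod n (x(i := t)) = (\<Sum>r\<in>{1..n}. c r * sympl_theta n (int r) t)"
proof -
  let ?J = "{1..n} - {i}"
  define f where "f = (\<lambda>t. theta_long t * (\<Prod>j\<in>?J. theta_pair t (x j)))"
  have card: "card ?J = n - 1" "n \<ge> 1" using i by auto
  have "theta_like (4 + 2 * int (card ?J)) (1 + int n) 1 (\<lambda>t. fps_const (t powi (- int n)) * (theta (t\<^sup>2) * (\<Prod>j\<in>?J. theta (t * x j) * theta (t / x j))))"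
    by (intro theta_like_shift theta_like_prod_pairs) (use x in auto)
  also have "(\<lambda>t. fps_const (t powi (- int n)) * (theta (t\<^sup>2) * (\<Prod>j\<in>?J. theta (t * x j) * theta (t / x j)))) = f"
  proof
    fix t
    have "f t = (fps_const (1 / t) * (\<Prod>j\<in>?J. fps_const (1 / t))) * (theta (t\<^sup>2) * (\<Prod>j\<in>?J. theta (t * x j) * theta (t / x j)))"
      by (simp add: f_def theta_long_def theta_pair_def prod.distrib mult_ac)
    also have "fps_const (1 / t) * (\<Prod>j\<in>?J. fps_const (1 / t)) = fps_const (1 / t) ^ Suc (n - 1)"
      by (simp only: card(1) prod_constant power_Suc)
    also have "\<dots> = fps_const (t powi (- int n))" using card(2)
      by (simp add: power_int_minus power_inverse divide_inverse del: power_Suc)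
    finally show "fps_const (t powi (- int n)) * (theta (t\<^sup>2) * (\<Prod>j\<in>?J. theta (t * x j) * theta (t / x j))) = f t" ..
  qed
  also have "4 + 2 * int (card ?J) = 2 * int n + 2" using card by (simp add: of_nat_diff)
  finally have "theta_like (2 * int n + 2) (int n + 1) 1 f" by (simp add: add.commute)
  moreover have "f (1 / t) = - f t" if "t \<noteq> 0" for t
    using that x by (simp add: f_def theta_long_inverse theta_pair_inverse)
  ultimately obtain c where "\<forall>t. t \<noteq> 0 \<longrightarrow> f t = (\<Sum>r=1..n. c r * sympl_theta n (int r) t)"
    using theta_like_odd_expand by blast
  then have c: "f t = (\<Sum>r=1..n. c r * sympl_theta n (int r) t)" if "t \<noteq> 0" for t using that by simp
  define R where "R = (\<Prod>j\<in>?J. theta_long (x j)) * ((\<Prod>k\<in>?J. if i < k then 1 else - 1) * (\<Prod>(i, j)\<in>pairs ?J. theta_pair (x i) (x j)))"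
  have "theta_prod n (x(i := t)) = R * f t" if t: "t \<noteq> 0" for t
  proof -
    let ?x = "x(i := t)"
    have ins: "{1..n} = insert i ?J" using i by auto
    have "(\<Prod>j\<in>{1..n}. theta_long (?x j)) = theta_long t * (\<Prod>j\<in>?J. theta_long (x j))"
      by (subst ins, subst prod.insert) (auto intro!: prod.cong)
    moreover have "(\<Prod>(i, j)\<in>pairs {1..n}. theta_pair (?x i) (?x j)) =
      (\<Prod>k\<in>?J. if i < k then 1 else - 1) * (\<Prod>(i, j)\<in>pairs ?J. theta_pair (?x i) (?x j)) * (\<Prod>k\<in>?J. theta_pair (?x i) (?x k))"
      by (subst ins, rule prod_pairs_isolate) (use x t in \<open>auto intro!: theta_pair_anti\<close>)
    moreover have "(\<Prod>(i, j)\<in>pairs ?J. theta_pair (?x i) (?x j)) = (\<Prod>(i, j)\<in>pairs ?J. theta_pair (x i) (x j))"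
      by (intro prod.cong refl) (auto simp: pairs_def)
    moreover have "(\<Prod>k\<in>?J. theta_pair (?x i) (?x k)) = (\<Prod>k\<in>?J. theta_pair t (x k))"
      by (intro prod.cong refl) auto
    ultimately show ?thesis by (simp add: theta_prod_def R_def f_def mult_ac)
  qed
  then show ?thesis using c by (intro exI[of _ "\<lambda>r. R * c r"]) (simp add: sum_distrib_left mult.assoc)
qed

lemma theta_prod_alternating:
  assumes ab: "a \<in> {1..n}" "b \<in> {1..n}" "a \<noteq> b" and x: "\<And>i. i \<in> {1..n} \<Longrightarrow> x i \<noteq> 0"
  shows "theta_prod n (x \<circ> Transposition.transpose a b) = - theta_prod n x"
proof -
  have "(\<Prod>i=1..n. theta_long ((x \<circ> Transposition.transpose a b) i)) = (\<Prod>i=1..n. theta_long (x i))"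
    using prod.permute[OF permutes_swap_id[OF ab(1,2)], of "\<lambda>i. theta_long (x i)"] by (simp add: comp_def)
  moreover have "(\<Prod>(i, j)\<in>pairs {1..n}. theta_pair ((x \<circ> Transposition.transpose a b) i) ((x \<circ> Transposition.transpose a b) j))
      = - (\<Prod>(i, j)\<in>pairs {1..n}. theta_pair (x i) (x j))"
    by (rule prod_pairs_transpose) (use ab x in \<open>auto intro: theta_pair_anti\<close>)
  ultimately show ?thesis by (simp add: theta_prod_def)
qed

lemma theta_prod_cong: "(\<And>i. i \<in> {1..n} \<Longrightarrow> x i = x' i) \<Longrightarrow> theta_prod n x = theta_prod n x'"
  unfolding theta_prod_def by (intro arg_cong2[of _ _ _ _ "(*)"] prod.cong refl) (auto simp: pairs_def)

subsection \<open>Roots of unity\<close>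

text \<open>X^N - c splits into the N distinct linear factors X - a k, by counting the roots of the
  difference; then X = 1. It is applied over the domain of power series, with a k a multiple of
  t.\<close>

lemma prod_one_minus_roots:
  fixes a :: "'i \<Rightarrow> 'a :: idom"
  assumes fin: "finite A" and inj: "inj_on a A" and card: "card A = N" "N > 0"
    and root: "\<And>k. k \<in> A \<Longrightarrow> a k ^ N = c"
  shows "(\<Prod>k\<in>A. 1 - a k) = 1 - c"
proof -
  define p where "p = monom 1 N - [:c:]"
  define q where "q = (\<Prod>k\<in>A. [:- a k, 1:])"
  have monic: "degree (\<Prod>k\<in>B. [:- a k, 1:]) = card B \<and> lead_coeff (\<Prod>k\<in>B. [:- a k, 1:]) = 1" if "finite B" for B
    using that
  proof (induction B rule: finite_induct)
    case (insert b B)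
    then have ih: "degree (\<Prod>k\<in>B. [:- a k, 1:]) = card B" "lead_coeff (\<Prod>k\<in>B. [:- a k, 1:]) = 1" by auto
    then have "(\<Prod>k\<in>B. [:- a k, 1:]) \<noteq> 0" by auto
    then have "degree ([:- a b, 1:] * (\<Prod>k\<in>B. [:- a k, 1:])) = 1 + card B"
      using insert by (subst degree_mult_eq) auto
    moreover have "lead_coeff ([:- a b, 1:] * (\<Prod>k\<in>B. [:- a k, 1:])) = 1"
      unfolding lead_coeff_mult ih(2) by simp
    ultimately show ?case using insert.hyps by (simp del: mult_pCons_left)
  qed simp
  have degp: "degree p = N" "coeff p N = 1" using card(2)
    by (auto simp: p_def degree_monom_eq coeff_pCons split: nat.splits intro!: antisym degree_le le_degree)
  have degq: "degree q = N" "coeff q N = 1" using monic[OF fin] card by (auto simp: q_def)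
  have "p = q"
  proof (rule ccontr)
    assume "p \<noteq> q"
    then have nz: "p - q \<noteq> 0" by simp
    have "degree (p - q) \<le> N" using degp degq by (metis degree_diff_le le_refl)
    moreover have "degree (p - q) \<noteq> N" using degp degq nz by (metis cancel_comm_monoid_add_class.diff_cancel coeff_diff leading_coeff_0_iff)
    ultimately have "degree (p - q) < N" by simp
    have "a ` A \<subseteq> {x. poly (p - q) x = 0}"
      using root fin by (auto simp: p_def q_def poly_monom poly_prod)
    then have "card (a ` A) \<le> card {x. poly (p - q) x = 0}" by (rule card_mono[OF poly_roots_finite[OF nz]])
    also have "\<dots> \<le> degree (p - q)" by (rule card_poly_roots_bound[OF nz])
    finally show False using \<open>degree (p - q) < N\<close> card inj by (simp add: card_image)
  qed
  then have "poly p 1 = poly q 1" by simp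
  then show ?thesis by (simp add: p_def q_def poly_monom poly_prod)
qed

text \<open>w is a primitive root of unity of order 2 n + 2. Its powers 1..n represent the pairs of
  inverse roots other than 1 and -1, so they are n independent symplectic coordinates.\<close>

locale even_root =
  fixes n :: nat and w :: complex
  assumes primitive: "\<And>m. w ^ m = 1 \<longleftrightarrow> (2 * n + 2) dvd m"
begin

definition "N = 2 * n + 2"

lemma w_N: "w ^ N = 1" unfolding primitive N_def by (rule dvd_refl)

lemma w_nz: "w \<noteq> 0" using w_N by (auto simp: N_def)

lemma w_half: "w ^ (n + 1) = -1"
proof -
  have "(n + 1) * 2 = N" by (simp add: N_def)
  then have "(w ^ (n + 1))\<^sup>2 = 1" using w_N by (simp only: power_mult[symmetric])
  moreover have "w ^ (n + 1) \<noteq> 1" unfolding primitive by (auto dest!: dvd_imp_le)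
  ultimately show ?thesis by (auto simp: power2_eq_1_iff)
qed

lemma w_inj: "inj_on (\<lambda>k. w ^ k) {..<N}"
proof -
  have *: "a = b" if "a \<le> b" "b < N" "w ^ a = w ^ b" for a b
  proof -
    have "w ^ (b - a) = 1" using that w_nz by (simp add: power_diff)
    then have "N dvd b - a" unfolding primitive N_def .
    then show ?thesis using that by (auto dest: dvd_imp_le)
  qed
  show ?thesis
    by (rule inj_onI) (metis * lessThan_iff nat_le_linear)
qed

text \<open>The exponents k and N - k give inverse roots; 0 and n + 1 are self-paired and belong to
  1 and -1.\<close>

lemma index_split: "{..<N} = insert 0 (insert (n + 1) ({1..n} \<union> (\<lambda>j. N - j) ` {1..n}))"
proof (rule set_eqI)
  fix k
  have "k \<in> (\<lambda>j. N - j) ` {1..n} \<longleftrightarrow> N - k \<in> {1..n} \<and> k < N"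
    by (auto simp: image_iff N_def intro!: bexI[of _ "N - k"])
  then show "k \<in> {..<N} \<longleftrightarrow> k \<in> insert 0 (insert (n + 1) ({1..n} \<union> (\<lambda>j. N - j) ` {1..n}))"
    by (auto simp: N_def)
qed

lemma pow_reflect: "u ^ N = 1 \<Longrightarrow> j \<in> {1..n} \<Longrightarrow> u ^ (N - j) = (1 / u) ^ j" for u :: complex
proof -
  assume u: "u ^ N = 1" and j: "j \<in> {1..n}"
  then have "u \<noteq> 0" by (auto simp: N_def)
  then have "u ^ (N - j) = u ^ N / u ^ j" using j by (intro power_diff) (auto simp: N_def)
  then show ?thesis unfolding u by (simp add: power_one_over)
qed

lemma sum_reflect:
  fixes u :: complex
  assumes u: "u ^ N = 1"
  shows "(\<Sum>k<N. u ^ k) = 1 + u ^ (n + 1) + (\<Sum>k=1..n. u ^ k + (1 / u) ^ k)"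
proof -
  have "inj_on (\<lambda>j. N - j) {1..n}" by (auto simp: inj_on_def N_def)
  then have "(\<Sum>k\<in>(\<lambda>j. N - j) ` {1..n}. u ^ k) = (\<Sum>k=1..n. u ^ (N - k))"
    by (simp add: sum.reindex)
  also have "\<dots> = (\<Sum>k=1..n. (1 / u) ^ k)" by (rule sum.cong[OF refl]) (rule pow_reflect[OF u])
  finally have 1: "(\<Sum>k\<in>(\<lambda>j. N - j) ` {1..n}. u ^ k) = (\<Sum>k=1..n. (1 / u) ^ k)" .
  have "(\<Sum>k<N. u ^ k) = 1 + (u ^ (n + 1) + (\<Sum>k\<in>{1..n} \<union> (\<lambda>j. N - j) ` {1..n}. u ^ k))"
    unfolding index_split by (subst sum.insert; (force simp: N_def)?)+
  also have "(\<Sum>k\<in>{1..n} \<union> (\<lambda>j. N - j) ` {1..n}. u ^ k) = (\<Sum>k=1..n. u ^ k) + (\<Sum>k=1..n. (1 / u) ^ k)"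
    unfolding 1[symmetric] by (rule sum.union_disjoint) (auto simp: N_def)
  finally show ?thesis by (simp add: sum.distrib)
qed

lemma prod_reflect:
  fixes g :: "complex \<Rightarrow> 'b :: comm_monoid_mult"
  shows "(\<Prod>k<N. g (w ^ k)) = g 1 * g (-1) * (\<Prod>k=1..n. g (w ^ k) * g ((1 / w) ^ k))"
proof -
  have "inj_on (\<lambda>j. N - j) {1..n}" by (auto simp: inj_on_def N_def)
  then have "(\<Prod>k\<in>(\<lambda>j. N - j) ` {1..n}. g (w ^ k)) = (\<Prod>k=1..n. g (w ^ (N - k)))"
    by (simp add: prod.reindex)
  also have "\<dots> = (\<Prod>k=1..n. g ((1 / w) ^ k))"
    by (rule prod.cong[OF refl]) (simp only: pow_reflect[OF w_N])
  finally have 1: "(\<Prod>k\<in>(\<lambda>j. N - j) ` {1..n}. g (w ^ k)) = (\<Prod>k=1..n. g ((1 / w) ^ k))" .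
  have "(\<Prod>k<N. g (w ^ k)) = g (w ^ 0) * (g (w ^ (n + 1)) * (\<Prod>k\<in>{1..n} \<union> (\<lambda>j. N - j) ` {1..n}. g (w ^ k)))"
    unfolding index_split by (subst prod.insert; (force simp: N_def)?)+
  also have "(\<Prod>k\<in>{1..n} \<union> (\<lambda>j. N - j) ` {1..n}. g (w ^ k)) = (\<Prod>k=1..n. g (w ^ k)) * (\<Prod>k=1..n. g ((1 / w) ^ k))"
    unfolding 1[symmetric] by (rule prod.union_disjoint) (auto simp: N_def)
  finally show ?thesis by (simp only: w_half prod.distrib mult.assoc power_0)
qed

lemma sum_unity:
  fixes u :: complex
  assumes u: "u ^ N = 1"
  shows "(\<Sum>k=1..n. u ^ k + (1 / u) ^ k) = (if u = 1 then of_nat N else 0) - 1 - u ^ (n + 1)"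
proof -
  have "(\<Sum>k<N. u ^ k) = (if u = 1 then of_nat N else 0)"
  proof (cases "u = 1")
    case False
    have "(u - 1) * (\<Sum>k<N. u ^ k) = u ^ N - 1" by (rule power_diff_1_eq[symmetric])
    then show ?thesis using u False by simp
  qed simp
  then have e: "(if u = 1 then of_nat N else 0) = 1 + u ^ (n + 1) + (\<Sum>k=1..n. u ^ k + (1 / u) ^ k)"
    using sum_reflect[OF u] by (simp only:)
  show ?thesis unfolding e by (simp only: add_diff_cancel_left' diff_diff_add)
qed

text \<open>The product of two sines is a difference of cosines with frequencies r + q and r - q.
  The boundary terms from the roots 1 and -1 agree for both, since r + q and r - q have equal
  parity, and only the full sum for r = q survives.\<close>

lemma sine_orthogonality:
  assumes r: "r \<in> {1..n}" and q: "q \<in> {1..n}"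
  shows "(\<Sum>k=1..n. sympl_diff r (w ^ k) * sympl_diff q (w ^ k)) = (if r = q then - of_nat N else 0)"
proof -
  define u v where "u = w ^ (r + q)" and "v = w ^ r / w ^ q"
  have pw: "(w ^ m) ^ N = 1" for m
    by (metis power_commutes power_mult power_one w_N mult.commute)
  have uN: "u ^ N = 1" and vN: "v ^ N = 1"
    by (simp_all add: u_def v_def pw power_divide del: power_Suc)
  have "u \<noteq> 1" unfolding u_def primitive using r q by (auto dest!: dvd_imp_le)
  have "v = 1 \<longleftrightarrow> r = q"
  proof -
    have "v = 1 \<longleftrightarrow> w ^ r = w ^ q" using w_nz by (auto simp: v_def)
    also have "\<dots> \<longleftrightarrow> r = q" using inj_onD[OF w_inj, of r q] r q by (auto simp: N_def)
    finally show ?thesis .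
  qed
  have pm: "(w ^ m) ^ (n + 1) = (-1) ^ m" for m
    by (metis power_mult mult.commute w_half)
  have "u ^ (n + 1) = (-1) ^ r * (-1) ^ q" unfolding u_def power_add[of w] power_mult_distrib pm ..
  moreover have "v ^ (n + 1) = (-1) ^ r / (-1) ^ q" unfolding v_def power_divide pm ..
  moreover have "(-1 :: complex) ^ r / (-1) ^ q = (-1) ^ r * (-1) ^ q" by (cases "even q") auto
  ultimately have uv: "u ^ (n + 1) = v ^ (n + 1)" by simp
  have "sympl_diff r (w ^ k) * sympl_diff q (w ^ k) = (u ^ k + (1 / u) ^ k) - (v ^ k + (1 / v) ^ k)" for k
  proof -
    have "(w ^ k) ^ m = (w ^ m) ^ k" for m by (metis power_mult mult.commute)
    then have e: "sympl_diff m (w ^ k) = (w ^ m) ^ k - (1 / w ^ m) ^ k" for m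
      by (simp add: sympl_diff_def power_one_over)
    show ?thesis unfolding e u_def v_def using w_nz
      by (simp add: power_add power_mult_distrib power_divide field_simps)
  qed
  then have "(\<Sum>k=1..n. sympl_diff r (w ^ k) * sympl_diff q (w ^ k)) = (\<Sum>k=1..n. u ^ k + (1 / u) ^ k) - (\<Sum>k=1..n. v ^ k + (1 / v) ^ k)"
    by (simp only: sum_subtractf)
  also have "\<dots> = (if r = q then - of_nat N else 0)"
    unfolding sum_unity[OF uN] sum_unity[OF vN] uv using \<open>u \<noteq> 1\<close> \<open>v = 1 \<longleftrightarrow> r = q\<close> by simp
  finally show ?thesis .
qed

end

section \<open>The product over the roots at roots of unity\<close>

definition theta_factor :: "complex fps \<Rightarrow> complex \<Rightarrow> complex fps" where
  "theta_factor t x = (1 - t * fps_const x) * (1 - t * fps_const (1 / x))"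

text \<open>The product of \<open>1 - t x\<^sup>\<alpha>\<close> over the roots \<open>\<alpha>\<close> of type \<open>C\<close>.\<close>

definition root_factors :: "nat \<Rightarrow> complex fps \<Rightarrow> (nat \<Rightarrow> complex) \<Rightarrow> complex fps" where
  "root_factors n t x = (\<Prod>i=1..n. theta_factor t ((x i)\<^sup>2)) *
     (\<Prod>(i, j)\<in>pairs {1..n}. theta_factor t (x i * x j) * theta_factor t (x i / x j))"

lemma prod_pairs_square:
  fixes S :: "nat \<Rightarrow> nat \<Rightarrow> 'k :: comm_monoid_mult"
  assumes "finite I" and sym: "\<And>i j. S i j = S j i"
  shows "(\<Prod>i\<in>I. \<Prod>j\<in>I. S i j) = (\<Prod>i\<in>I. S i i) * (\<Prod>(i, j)\<in>pairs I. S i j)\<^sup>2"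
  using assms(1)
proof (induction I rule: finite_induct)
  case (insert a I)
  have "(\<Prod>k\<in>I. if a < k then S a k else S k a) = (\<Prod>k\<in>I. S a k)" using sym by (intro prod.cong) auto
  then have "(\<Prod>(i, j)\<in>pairs (insert a I). S i j) = (\<Prod>(i, j)\<in>pairs I. S i j) * (\<Prod>k\<in>I. S a k)"
    using prod_pairs_insert[OF insert.hyps, of S] by simp
  moreover have "(\<Prod>i\<in>I. S i a) = (\<Prod>i\<in>I. S a i)" using sym by (intro prod.cong) auto
  ultimately show ?case using insert
    by (simp add: prod.distrib power2_eq_square mult_ac)
qed (simp add: pairs_def)

context even_root
begin

text \<open>The a w^k run through all N-th roots of unity. The two terms with w^k = 1 and w^k = -1
  combine to 1 - t^2 a^2.\<close>

lemma prod_all_roots: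
  assumes t: "t \<noteq> 0" and a: "a ^ N = 1"
  shows "(\<Prod>j=1..n. (1 - t * fps_const (a * w ^ j)) * (1 - t * fps_const (a * (1 / w) ^ j))) * (1 - t\<^sup>2 * fps_const (a\<^sup>2)) = 1 - t ^ N"
proof -
  have "a \<noteq> 0" using a by (auto simp: N_def)
  have "(\<Prod>k<N. 1 - t * fps_const (a * w ^ k)) = 1 - t ^ N"
  proof (rule prod_one_minus_roots)
    show "inj_on (\<lambda>k. t * fps_const (a * w ^ k)) {..<N}"
      using w_inj t \<open>a \<noteq> 0\<close> by (auto simp: inj_on_def)
    show "(t * fps_const (a * w ^ k)) ^ N = t ^ N" for k
    proof -
      have "(w ^ k) ^ N = 1" by (metis power_commutes power_mult power_one w_N mult.commute)
      then show ?thesis unfolding power_mult_distrib fps_const_power a by simp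
    qed
  qed (auto simp: N_def)
  also have "(\<Prod>k<N. 1 - t * fps_const (a * w ^ k)) = (1 - t * fps_const a) * (1 - t * fps_const (- a)) *
      (\<Prod>j=1..n. (1 - t * fps_const (a * w ^ j)) * (1 - t * fps_const (a * (1 / w) ^ j)))"
    using prod_reflect[of "\<lambda>u. 1 - t * fps_const (a * u)"] by simp
  also have "(1 - t * fps_const a) * (1 - t * fps_const (- a)) = 1 - t\<^sup>2 * fps_const (a\<^sup>2)"
    by (simp add: power2_eq_square algebra_simps fps_const_neg[symmetric] fps_const_mult[symmetric] del: fps_const_neg fps_const_mult)
  finally show ?thesis by (simp only: mult.commute)
qed

text \<open>The squares of w^0, .., w^n are all the roots of unity of order n + 1. The factors (1 -
  t)^2 restore the missing index 0, once for the squares and once for their inverses.\<close>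

lemma prod_long_roots:
  assumes t: "t \<noteq> 0"
  shows "(\<Prod>i=1..n. theta_factor t ((w ^ i)\<^sup>2)) * (1 - t)\<^sup>2 = (1 - t ^ (n + 1))\<^sup>2"
proof -
  have w2: "(w ^ k)\<^sup>2 = w ^ (2 * k)" for k by (simp add: power_mult[symmetric] mult.commute)
  have inj: "inj_on (\<lambda>k. (w ^ k)\<^sup>2) {0..n}"
    unfolding w2 by (rule inj_onI, drule inj_onD[OF w_inj]) (auto simp: N_def)
  have pw: "((w ^ k)\<^sup>2) ^ (n + 1) = 1" for k
  proof -
    have "((w ^ k)\<^sup>2) ^ (n + 1) = (w ^ N) ^ k" by (simp only: power_mult[symmetric]) (simp add: N_def algebra_simps)
    then show ?thesis unfolding w_N by simp
  qed
  have 1: "(1 - t) * (\<Prod>k=1..n. 1 - t * fps_const ((w ^ k)\<^sup>2)) = 1 - t ^ (n + 1)"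
  proof -
    have "(\<Prod>k=0..n. 1 - t * fps_const ((w ^ k)\<^sup>2)) = 1 - t ^ (n + 1)"
    proof (rule prod_one_minus_roots)
      show "inj_on (\<lambda>k. t * fps_const ((w ^ k)\<^sup>2)) {0..n}"
        using inj t by (auto simp: inj_on_def)
      show "(t * fps_const ((w ^ k)\<^sup>2)) ^ (n + 1) = t ^ (n + 1)" for k
        unfolding power_mult_distrib fps_const_power pw by simp
    qed auto
    then show ?thesis by (simp add: prod.atLeast_Suc_atMost)
  qed
  have 2: "(1 - t) * (\<Prod>k=1..n. 1 - t * fps_const (1 / (w ^ k)\<^sup>2)) = 1 - t ^ (n + 1)"
  proof -
    have "(\<Prod>k=0..n. 1 - t * fps_const (1 / (w ^ k)\<^sup>2)) = 1 - t ^ (n + 1)"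
    proof (rule prod_one_minus_roots)
      show "inj_on (\<lambda>k. t * fps_const (1 / (w ^ k)\<^sup>2)) {0..n}"
        using inj t w_nz by (auto simp: inj_on_def)
      show "(t * fps_const (1 / (w ^ k)\<^sup>2)) ^ (n + 1) = t ^ (n + 1)" for k
        unfolding power_mult_distrib fps_const_power power_one_over pw by simp
    qed auto
    then show ?thesis by (simp add: prod.atLeast_Suc_atMost)
  qed
  have "(\<Prod>i=1..n. theta_factor t ((w ^ i)\<^sup>2)) * (1 - t)\<^sup>2
     = ((1 - t) * (\<Prod>k=1..n. 1 - t * fps_const ((w ^ k)\<^sup>2))) * ((1 - t) * (\<Prod>k=1..n. 1 - t * fps_const (1 / (w ^ k)\<^sup>2)))"
    by (simp add: theta_factor_def prod.distrib power2_eq_square mult_ac)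
  then show ?thesis unfolding 1 2 by (simp add: power2_eq_square)
qed

text \<open>The weights of the natural representation at \<open>x i = w ^ i\<close> are all \<open>N\<close>-th roots of unity except
  \<open>1\<close> and \<open>-1\<close>, so the product over all ordered pairs of weights is computable; it is essentially
  the square of the product over the roots.\<close>

lemma root_factors_root_of_unity:
  assumes t: "t \<noteq> 0" "fps_nth t 0 = 0"
  shows "(1 - t) ^ n * root_factors n t (\<lambda>i. w ^ i) * (1 + t ^ (n + 1)) = (1 + t) * (1 - t ^ N) ^ n"
proof -
  let ?x = "\<lambda>i. w ^ i"
  let ?S = "\<lambda>i j. theta_factor t (?x i * ?x j) * theta_factor t (?x i / ?x j)"
  define A where "A = (\<lambda>t. \<Prod>i=1..n. theta_factor t ((?x i)\<^sup>2))"
  define B where "B = (\<Prod>(i, j)\<in>pairs {1..n}. ?S i j)"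
  have sym: "?S i j = ?S j i" for i j by (simp add: theta_factor_def mult_ac)
  have diag: "?S i i = theta_factor t ((?x i)\<^sup>2) * (1 - t)\<^sup>2" for i
    using w_nz by (simp add: theta_factor_def power2_eq_square)
  \<comment> \<open>The range of j misses the roots 1 and -1; their four factors multiply to
    \<open>theta_factor\<close> at t^2, which completes the product over all weights.\<close>
  have rows: "(\<Prod>j=1..n. ?S i j) * theta_factor (t\<^sup>2) ((?x i)\<^sup>2) = (1 - t ^ N)\<^sup>2" for i
  proof -
    have aN: "(?x i) ^ N = 1" by (metis power_commutes power_mult power_one w_N mult.commute)
    then have bN: "(1 / ?x i) ^ N = 1" by (simp add: power_one_over del: power_Suc)
    have "?S i j = ((1 - t * fps_const (?x i * w ^ j)) * (1 - t * fps_const (?x i * (1 / w) ^ j))) *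
        ((1 - t * fps_const (1 / ?x i * w ^ j)) * (1 - t * fps_const (1 / ?x i * (1 / w) ^ j)))" for j
      by (simp add: theta_factor_def power_one_over mult_ac)
    then have "(\<Prod>j=1..n. ?S i j) * theta_factor (t\<^sup>2) ((?x i)\<^sup>2) =
      ((\<Prod>j=1..n. (1 - t * fps_const (?x i * w ^ j)) * (1 - t * fps_const (?x i * (1 / w) ^ j))) * (1 - t\<^sup>2 * fps_const ((?x i)\<^sup>2))) *
      ((\<Prod>j=1..n. (1 - t * fps_const (1 / ?x i * w ^ j)) * (1 - t * fps_const (1 / ?x i * (1 / w) ^ j))) * (1 - t\<^sup>2 * fps_const ((1 / ?x i)\<^sup>2)))"
      by (simp only: prod.distrib theta_factor_def power_one_over mult_ac)
    then show ?thesis unfolding prod_all_roots[OF t(1) aN] prod_all_roots[OF t(1) bN] by (simp only: power2_eq_square)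
  qed
  have "(\<Prod>i=1..n. \<Prod>j=1..n. ?S i j) * A (t\<^sup>2) = (\<Prod>i=1..n. (1 - t ^ N)\<^sup>2)"
    unfolding A_def prod.distrib[symmetric] by (simp only: rows)
  moreover have "(\<Prod>i=1..n. \<Prod>j=1..n. ?S i j) = A t * (1 - t) ^ (2 * n) * B\<^sup>2"
  proof -
    have "(\<Prod>i=1..n. \<Prod>j=1..n. ?S i j) = (\<Prod>i=1..n. ?S i i) * B\<^sup>2"
      unfolding B_def by (rule prod_pairs_square) (simp, rule sym)
    also have "(\<Prod>i=1..n. ?S i i) = A t * (\<Prod>i=1..n. (1 - t)\<^sup>2)"
      unfolding diag prod.distrib A_def ..
    finally show ?thesis by (simp add: power_mult)
  qed
  ultimately have main: "A t * (1 - t) ^ (2 * n) * B\<^sup>2 * A (t\<^sup>2) = (1 - t ^ N) ^ (2 * n)"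
    by (simp add: power_mult del: power_Suc)
  define Q where "Q = (1 - t) ^ n * root_factors n t ?x"
  have Q: "Q = (1 - t) ^ n * (A t * B)" by (simp add: Q_def root_factors_def A_def B_def)
  have At: "A t * (1 - t)\<^sup>2 = (1 - t ^ (n + 1))\<^sup>2" unfolding A_def by (rule prod_long_roots[OF t(1)])
  have At2: "A (t\<^sup>2) * (1 - t\<^sup>2)\<^sup>2 = (1 - t ^ N)\<^sup>2"
  proof -
    have "2 * (n + 1) = N" by (simp add: N_def)
    then have "(t\<^sup>2) ^ (n + 1) = t ^ N" by (simp only: power_mult[symmetric])
    then show ?thesis using prod_long_roots[of "t\<^sup>2"] t(1) by (simp only: A_def power_eq_0_iff simp_thms not_False_eq_True)
  qed
  have nz: "1 - t ^ m \<noteq> 0" if "m > 0" for m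
  proof
    assume "1 - t ^ m = 0"
    then have "fps_nth (1 - t ^ m) 0 = 0" by (metis fps_zero_nth)
    then show False using t(2) that by (auto simp: fps_power_zeroth power_0_left)
  qed
  have tN: "1 - t ^ N = (1 - t ^ (n + 1)) * (1 + t ^ (n + 1))" and t2: "1 - t\<^sup>2 = (1 - t) * (1 + t)"
  proof -
    have "N = (n + 1) + (n + 1)" by (simp add: N_def)
    then have "t ^ N = t ^ (n + 1) * t ^ (n + 1)" by (simp only: power_add)
    then show "1 - t ^ N = (1 - t ^ (n + 1)) * (1 + t ^ (n + 1))" by (simp add: algebra_simps)
  qed (simp add: algebra_simps power2_eq_square)
  have "Q\<^sup>2 * A (t\<^sup>2) = A t * (A t * (1 - t) ^ (2 * n) * B\<^sup>2 * A (t\<^sup>2))"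
    unfolding Q by (simp add: power2_eq_square power_mult mult_2 power_add mult_ac)
  then have "Q\<^sup>2 * A (t\<^sup>2) * ((1 - t)\<^sup>2 * (1 - t\<^sup>2)\<^sup>2) = A t * (1 - t ^ N) ^ (2 * n) * ((1 - t)\<^sup>2 * (1 - t\<^sup>2)\<^sup>2)"
    unfolding main by simp
  then have "Q\<^sup>2 * (1 - t)\<^sup>2 * (A (t\<^sup>2) * (1 - t\<^sup>2)\<^sup>2) = (A t * (1 - t)\<^sup>2) * (1 - t ^ N) ^ (2 * n) * (1 - t\<^sup>2)\<^sup>2"
    by (simp only: mult_ac)
  then have "Q\<^sup>2 * (1 - t)\<^sup>2 * ((1 - t ^ (n + 1)) * (1 + t ^ (n + 1)))\<^sup>2 = (1 - t ^ (n + 1))\<^sup>2 * (1 - t ^ N) ^ (2 * n) * ((1 - t) * (1 + t))\<^sup>2"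
    unfolding At At2 by (simp only: tN t2)
  then have "((1 - t)\<^sup>2 * (1 - t ^ (n + 1))\<^sup>2) * (Q * (1 + t ^ (n + 1)))\<^sup>2 = ((1 - t)\<^sup>2 * (1 - t ^ (n + 1))\<^sup>2) * ((1 + t) * (1 - t ^ N) ^ n)\<^sup>2"
    by (simp only: power_mult_distrib power_mult[symmetric] mult_ac)
  moreover have "(1 - t)\<^sup>2 * (1 - t ^ (n + 1))\<^sup>2 \<noteq> 0" using nz[of 1] nz[of "n + 1"] by simp
  ultimately have "(Q * (1 + t ^ (n + 1)))\<^sup>2 = ((1 + t) * (1 - t ^ N) ^ n)\<^sup>2" by (simp only: mult_cancel_left) blast
  \<comment> \<open>Equality of squares leaves a sign, which the constant terms 1 and -1
    decide.\<close>
  then have "Q * (1 + t ^ (n + 1)) = (1 + t) * (1 - t ^ N) ^ n \<or> Q * (1 + t ^ (n + 1)) = - ((1 + t) * (1 - t ^ N) ^ n)"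
    by (simp only: power2_eq_iff)
  moreover have "fps_nth (Q * (1 + t ^ (n + 1))) 0 = 1" "fps_nth (- ((1 + t) * (1 - t ^ N) ^ n)) 0 = -1"
  proof -
    have tf: "fps_nth (theta_factor t u) 0 = 1" for u using t(2) by (simp add: theta_factor_def)
    have p1: "fps_nth (\<Prod>i\<in>I. f i) 0 = 1" if "\<And>i. i \<in> I \<Longrightarrow> fps_nth (f i) 0 = 1" for I :: "'z set" and f :: "'z \<Rightarrow> complex fps"
      using that by (induction I rule: infinite_finite_induct) auto
    have "fps_nth (A t) 0 = 1" unfolding A_def by (rule p1) (rule tf)
    moreover have "fps_nth B 0 = 1" unfolding B_def by (rule p1) (auto simp: tf)
    ultimately show "fps_nth (Q * (1 + t ^ (n + 1))) 0 = 1" "fps_nth (- ((1 + t) * (1 - t ^ N) ^ n)) 0 = -1"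
      using t(2) by (simp_all add: Q fps_power_zeroth power_0_left N_def)
  qed
  moreover have "(1 :: complex) \<noteq> -1" by simp
  ultimately have "Q * (1 + t ^ (n + 1)) = (1 + t) * (1 - t ^ N) ^ n" by metis
  then show ?thesis unfolding Q_def .
qed

end

subsection \<open>The Macdonald identity of type C up to order n\<close>

text \<open>The Weyl denominator of Sp(2 n), up to the sign (-1)^n.\<close>

definition weyl_denom :: "nat \<Rightarrow> (nat \<Rightarrow> complex) \<Rightarrow> complex" where
  "weyl_denom n x = (\<Prod>i=1..n. (1 - (x i)\<^sup>2) / x i) *
     (\<Prod>(i, j)\<in>pairs {1..n}. (1 - x i * x j) * (1 - x i / x j) / x i)"

lemma fps_const_prod: "fps_const (\<Prod>i\<in>A. f i) = (\<Prod>i\<in>A. fps_const (f i :: complex))"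
  by (induction A rule: infinite_finite_induct) (simp_all add: fps_const_mult[symmetric] del: fps_const_mult)

lemma theta_cong:
  assumes "x \<noteq> 0"
  shows "fps_cong n (theta x) (fps_const (1 - x) * (qfact n * (\<Prod>k=1..n. theta_factor (fps_X ^ k) x)))"
  using theta_cong_prod[OF assms, of n]
  by (simp add: qfact_def theta_factor_def prod.distrib mult.assoc)

lemma theta_prod_cong_prod:
  assumes x: "\<And>j. x j \<noteq> 0"
  shows "fps_cong n (theta_prod n x) (fps_const (weyl_denom n x) *
      (qfact n ^ (n + 2 * card (pairs {1..n})) * (\<Prod>k=1..n. root_factors n (fps_X ^ k) x)))"
proof -
  let ?P = "\<lambda>y. \<Prod>k=1..n. theta_factor (fps_X ^ k) y"
  have 1: "fps_cong n (theta_long (x i)) (fps_const ((1 - (x i)\<^sup>2) / x i) * (qfact n * ?P ((x i)\<^sup>2)))" for i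
  proof -
    have "fps_cong n (theta_long (x i)) (fps_const (1 / x i) * (fps_const (1 - (x i)\<^sup>2) * (qfact n * ?P ((x i)\<^sup>2))))"
      unfolding theta_long_def by (intro fps_cong_mult theta_cong) (use x in auto)
    then show ?thesis by (simp add: mult.assoc[symmetric])
  qed
  have 2: "fps_cong n (theta_pair (x i) (x j)) (fps_const ((1 - x i * x j) * (1 - x i / x j) / x i) * (qfact n ^ 2 * (?P (x i * x j) * ?P (x i / x j))))" for i j
  proof -
    have "fps_cong n (theta_pair (x i) (x j)) (fps_const (1 / x i) *
       ((fps_const (1 - x i * x j) * (qfact n * ?P (x i * x j))) * (fps_const (1 - x i / x j) * (qfact n * ?P (x i / x j)))))"
      unfolding theta_pair_def by (intro fps_cong_mult theta_cong fps_cong_refl) (use x in auto)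
    also have "\<dots> = fps_const (1 / x i) * fps_const (1 - x i * x j) * fps_const (1 - x i / x j) * (qfact n ^ 2 * (?P (x i * x j) * ?P (x i / x j)))"
      by (simp only: power2_eq_square mult_ac)
    also have "fps_const (1 / x i) * fps_const (1 - x i * x j) * fps_const (1 - x i / x j) = fps_const ((1 - x i * x j) * (1 - x i / x j) / x i)"
      by simp
    finally show ?thesis .
  qed
  have "fps_cong n (theta_prod n x)
     ((\<Prod>i=1..n. fps_const ((1 - (x i)\<^sup>2) / x i) * (qfact n * ?P ((x i)\<^sup>2))) *
      (\<Prod>(i, j)\<in>pairs {1..n}. fps_const ((1 - x i * x j) * (1 - x i / x j) / x i) * (qfact n ^ 2 * (?P (x i * x j) * ?P (x i / x j)))))"
    unfolding theta_prod_def case_prod_unfold by (intro fps_cong_mult fps_cong_prod 1 2)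
  also have "\<dots> = fps_const (weyl_denom n x) * (qfact n ^ (n + 2 * card (pairs {1..n})) *
     ((\<Prod>i=1..n. ?P ((x i)\<^sup>2)) * (\<Prod>(i, j)\<in>pairs {1..n}. ?P (x i * x j) * ?P (x i / x j))))"
    unfolding weyl_denom_def fps_const_mult[symmetric] fps_const_prod case_prod_unfold prod.distrib prod_constant
    by (simp only: power_add power_mult card_atLeastAtMost diff_Suc_1 mult_ac add_diff_cancel_right')
  also have "(\<Prod>i=1..n. ?P ((x i)\<^sup>2)) * (\<Prod>(i, j)\<in>pairs {1..n}. ?P (x i * x j) * ?P (x i / x j))
     = (\<Prod>k=1..n. root_factors n (fps_X ^ k) x)"
    unfolding root_factors_def case_prod_unfold prod.distrib
    by (intro arg_cong2[of _ _ _ _ "(*)"] prod.swap)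
  finally show ?thesis .
qed

lemma alt_sum_scale:
  assumes "finite I"
  shows "alt_sum I (\<lambda>r i. m r i * g r) = alt_sum I m * (\<Prod>i\<in>I. g i)"
proof -
  have "(\<Prod>i\<in>I. m (p i) i * g (p i)) = (\<Prod>i\<in>I. m (p i) i) * (\<Prod>i\<in>I. g i)" if "p permutes I" for p
    using prod.permute[OF that, of g] by (simp add: prod.distrib comp_def)
  then show ?thesis by (simp add: alt_sum_def sum_distrib_right mult.assoc)
qed

lemma alt_sum_const: "alt_sum I (\<lambda>r i. fps_const (m r i :: complex)) = fps_const (alt_sum I m)"
proof -
  have "fps_const (sum f A) = (\<Sum>a\<in>A. fps_const (f a :: complex))" for f and A :: "(nat \<Rightarrow> nat) set"
    by (induction A rule: infinite_finite_induct) (simp_all add: fps_const_add[symmetric] del: fps_const_add)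
  moreover have "of_int k = fps_const (of_int k :: complex)" for k by (simp add: fps_of_int)
  ultimately show ?thesis
    by (simp add: alt_sum_def fps_const_prod fps_const_mult[symmetric] del: fps_const_mult)
qed

lemma alt_sum_cong: "(\<And>r i. r \<in> I \<Longrightarrow> i \<in> I \<Longrightarrow> m r i = m' r i) \<Longrightarrow> alt_sum I m = alt_sum I m'"
  unfolding alt_sum_def
  by (intro sum.cong refl arg_cong2[of _ _ _ _ "(*)"] prod.cong) (auto simp: permutes_in_image)

lemma fps_cong_alt_sum:
  assumes "\<And>r i. r \<in> I \<Longrightarrow> i \<in> I \<Longrightarrow> fps_cong n (m r i) (m' r i)"
  shows "fps_cong n (alt_sum I m) (alt_sum I m')"
  unfolding alt_sum_def
  by (intro fps_cong_sum fps_cong_mult fps_cong_refl fps_cong_prod assms) (auto simp: permutes_in_image)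

text \<open>The theta product is alternating and in every variable a combination of the \<open>sympl_theta n r\<close>,
  hence a multiple of their alternating sum. The factor is found at the roots of unity, where the
  matrix of values is diagonalised by the discrete sine transform.\<close>

theorem macdonald_C_truncated:
  shows "\<exists>c. c \<noteq> 0 \<and> (\<forall>x. (\<forall>j. x j \<noteq> 0) \<longrightarrow> fps_cong n
      (fps_const (weyl_denom n x) * (\<Prod>k=1..n. (1 - fps_X ^ k) ^ n * root_factors n (fps_X ^ k) x))
      (fps_const c * alt_sum {1..n} (\<lambda>r i. fps_const (sympl_diff r (x i)) - fps_const (sympl_diff (2 * n + 2 - r) (x i)) * fps_X ^ (n + 1 - r))))"
proof -
  define w where "w = exp (2 * of_real pi * \<i> * of_nat 1 / of_nat (2 * n + 2))"
  interpret even_root n w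
  proof
    fix m
    have "w ^ m = exp (2 * of_real pi * \<i> * of_nat m / of_nat (2 * n + 2))"
      unfolding w_def exp_of_nat_mult[symmetric] by (simp add: mult_ac)
    also have "\<dots> = 1 \<longleftrightarrow> (2 * n + 2) dvd m" by (rule complex_root_unity_eq_1) simp
    finally show "w ^ m = 1 \<longleftrightarrow> (2 * n + 2) dvd m" .
  qed
  let ?I = "{1..n}"
  define y where "y = (\<lambda>k. w ^ k)"
  define g where "g = (\<lambda>r. elem_theta n (int r) 1)"
  define \<phi> where "\<phi> = (\<lambda>r. sympl_theta n (int r))"
  define e where "e = card (pairs ?I)"
  have y: "y k \<noteq> 0" for k using w_nz by (simp add: y_def)
  have yN: "y k ^ (2 * n + 2) = 1" for k
    by (metis N_def power_commutes power_mult power_one w_N mult.commute y_def)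
  have g0: "fps_nth (g r) 0 = 1" if "r \<in> ?I" for r
    using elem_theta_1_cong[of r n] that by (auto simp: g_def fps_cong_def)
  have \<phi>y: "\<phi> r (y k) = fps_const (sympl_diff r (y k)) * g r" if "r \<in> ?I" for r k
    unfolding \<phi>_def g_def by (rule sympl_theta_root_of_unity) (use that yN in auto)
  \<comment> \<open>By \<open>sine_orthogonality\<close> the rows of sine values are orthogonal with
    square sum -N; dividing by -N and by g r inverts the matrix of the phi r (y k).\<close>
  define M where "M = (\<lambda>r k. fps_const (- sympl_diff r (y k) / of_nat N) * inverse (g r))"
  have dual: "(\<Sum>k\<in>?I. M r k * \<phi> q (y k)) = (if r = q then 1 else 0)" if rq: "r \<in> ?I" "q \<in> ?I" for r q
  proof -
    have "(\<Sum>k\<in>?I. M r k * \<phi> q (y k)) = (\<Sum>k\<in>?I. fps_const (- (sympl_diff r (y k) * sympl_diff q (y k)) / of_nat N) * (inverse (g r) * g q))"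
    proof (rule sum.cong[OF refl])
      fix k
      have "M r k * \<phi> q (y k) = fps_const (- sympl_diff r (y k) / of_nat N) * fps_const (sympl_diff q (y k)) * (inverse (g r) * g q)"
        unfolding M_def \<phi>y[OF rq(2)] by (simp only: mult_ac)
      then show "M r k * \<phi> q (y k) = fps_const (- (sympl_diff r (y k) * sympl_diff q (y k)) / of_nat N) * (inverse (g r) * g q)"
        by simp
    qed
    also have "\<dots> = fps_const (- (\<Sum>k\<in>?I. sympl_diff r (y k) * sympl_diff q (y k)) / of_nat N) * (inverse (g r) * g q)"
    proof -
      have "fps_const (sum f ?I) = (\<Sum>a\<in>?I. fps_const (f a :: complex))" for f
        by (induction n) (simp_all add: fps_const_add[symmetric] del: fps_const_add)
      then show ?thesis by (simp only: sum_distrib_right[symmetric] sum_divide_distrib sum_negf[symmetric])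
    qed
    also have "\<dots> = (if r = q then 1 else 0)"
    proof (cases "r = q")
      case True
      have "inverse (g r) * g r = 1" by (rule inverse_mult_eq_1) (simp add: g0[OF rq(1)])
      moreover have "of_nat N \<noteq> (0 :: complex)" unfolding N_def of_nat_eq_0_iff by simp
      ultimately show ?thesis using True sine_orthogonality[OF rq] by (simp add: y_def)
    qed (use sine_orthogonality[OF rq] in \<open>simp add: y_def\<close>)
    finally show ?thesis .
  qed
  have "\<exists>C. \<forall>x. (\<forall>j. x j \<noteq> 0) \<longrightarrow> theta_prod n x = C * alt_sum ?I (\<lambda>r i. \<phi> r (x i))"
  proof (rule alternating_slotwise[where y = y and M = M])
    show "\<exists>c. \<forall>t. t \<noteq> 0 \<longrightarrow> theta_prod n (x(i := t)) = (\<Sum>r\<in>?I. c r * \<phi> r t)" if "i \<in> ?I" "\<And>j. x j \<noteq> 0" for i x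
      unfolding \<phi>_def by (rule theta_prod_slot[OF that])
    show "theta_prod n x = theta_prod n x'" if "\<And>i. i \<in> ?I \<Longrightarrow> x i = x' i" for x x'
      by (rule theta_prod_cong[OF that])
    show "theta_prod n (x \<circ> Transposition.transpose a b) = - theta_prod n x"
      if "a \<in> ?I" "b \<in> ?I" "a \<noteq> b" "\<And>i. i \<in> ?I \<Longrightarrow> x i \<noteq> 0" for x a b
      by (rule theta_prod_alternating[OF that])
    show "(\<Sum>k\<in>?I. M r k * \<phi> q (y k)) = (if r = q then 1 else 0)" if "r \<in> ?I" "q \<in> ?I" for r q
      by (rule dual[OF that])
  qed (simp_all add: y)
  then obtain C where C: "theta_prod n x = C * alt_sum ?I (\<lambda>r i. \<phi> r (x i))" if "\<And>j. x j \<noteq> 0" for x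
    by blast
  define Q where "Q = (\<lambda>x. \<Prod>k=1..n. root_factors n (fps_X ^ k) x)"
  define A0 where "A0 = alt_sum ?I (\<lambda>r i. sympl_diff r (y i))"
  define U where "U = (\<Prod>k=1..n. 1 + fps_X ^ k :: complex fps)"
  have U0: "fps_nth U 0 = 1" unfolding U_def by (induction n) simp_all
  have gU: "fps_cong n (\<Prod>r\<in>?I. g r) U"
  proof -
    have "fps_cong n (\<Prod>r\<in>?I. g r) (\<Prod>r\<in>?I. 1 + fps_X ^ (n + 1 - r))"
      unfolding g_def by (intro fps_cong_prod elem_theta_1_cong) auto
    also have "(\<Prod>r\<in>?I. 1 + fps_X ^ (n + 1 - r)) = U" unfolding U_def
      by (rule prod.reindex_bij_witness[of _ "\<lambda>r. n + 1 - r" "\<lambda>r. n + 1 - r"]) auto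
    finally show ?thesis .
  qed
  \<comment> \<open>Because k >= 1, the powers t^(n + 1) and t^N of t = T^k lie beyond T^n, so the
    evaluation at roots of unity shrinks to 1 + T^k.\<close>
  have QU: "fps_cong n (qfact n ^ n * Q y) U"
  proof -
    have "fps_cong n ((1 - fps_X ^ k) ^ n * root_factors n (fps_X ^ k) y) (1 + fps_X ^ k)" if k: "k \<in> ?I" for k
    proof -
      let ?t = "fps_X ^ k :: complex fps"
      have small: "fps_cong n (?t ^ m) 0" if "m > n" for m
      proof -
        have "n < k * m" using k that by (metis Suc_le_eq atLeastAtMost_iff less_le_trans mult.commute mult_le_mono1 nat_mult_1_right One_nat_def mult.left_neutral)
        then show ?thesis by (simp add: fps_cong_def power_mult[symmetric])
      qed
      have "fps_cong n ((1 - ?t) ^ n * root_factors n ?t y * (1 + 0)) ((1 - ?t) ^ n * root_factors n ?t y * (1 + ?t ^ (n + 1)))"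
        by (intro fps_cong_mult fps_cong_add fps_cong_refl fps_cong_sym[OF small]) simp
      also have "\<dots> = (1 + ?t) * (1 - ?t ^ N) ^ n"
        unfolding y_def by (rule root_factors_root_of_unity) (use k in auto)
      also have "\<dots> = (1 + ?t) * (\<Prod>i=1..n. 1 - ?t ^ N)" by simp
      also have "fps_cong n \<dots> ((1 + ?t) * (\<Prod>i=1..n. 1 - 0))"
        by (intro fps_cong_mult fps_cong_prod fps_cong_diff fps_cong_refl small) (simp add: N_def)
      finally show ?thesis by simp
    qed
    then have "fps_cong n (\<Prod>k=1..n. (1 - fps_X ^ k) ^ n * root_factors n (fps_X ^ k) y) U"
      unfolding U_def by (rule fps_cong_prod)
    then show ?thesis by (simp add: prod.distrib Q_def qfact_def prod_power_distrib)
  qed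
  \<comment> \<open>At \<open>y\<close> the determinant and the product both contain the unit
    \<open>U\<close>. Cancelling it shows that up to T^n the factor C is a scalar times a power of
    \<open>qfact\<close>, and the scalar is nonzero because the Weyl denominator does not vanish at
    \<open>y\<close>.\<close>
  have "fps_cong n (U * (C * fps_const A0)) (U * (fps_const (weyl_denom n y) * qfact n ^ (2 * e)))"
  proof -
    have "theta_prod n y = C * alt_sum ?I (\<lambda>r i. fps_const (sympl_diff r (y i)) * g r)"
      unfolding C[OF y] by (intro arg_cong2[of _ _ _ _ "(*)"] alt_sum_cong refl \<phi>y)
    also have "\<dots> = (\<Prod>r\<in>?I. g r) * (C * fps_const A0)"
      unfolding alt_sum_scale[OF finite_atLeastAtMost] alt_sum_const A0_def by (simp only: mult_ac)
    finally have 1: "theta_prod n y = (\<Prod>r\<in>?I. g r) * (C * fps_const A0)" .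
    have "fps_cong n (U * (C * fps_const A0)) (theta_prod n y)"
      unfolding 1 by (intro fps_cong_mult fps_cong_sym[OF gU] fps_cong_refl)
    also have "fps_cong n (theta_prod n y) (fps_const (weyl_denom n y) * (qfact n ^ (n + 2 * e) * Q y))"
      unfolding e_def Q_def by (rule theta_prod_cong_prod[OF y])
    also have "\<dots> = (qfact n ^ n * Q y) * (fps_const (weyl_denom n y) * qfact n ^ (2 * e))"
      by (simp only: power_add mult_ac)
    also have "fps_cong n \<dots> (U * (fps_const (weyl_denom n y) * qfact n ^ (2 * e)))"
      by (intro fps_cong_mult QU fps_cong_refl)
    finally show ?thesis .
  qed
  then have CA: "fps_cong n (C * fps_const A0) (fps_const (weyl_denom n y) * qfact n ^ (2 * e))"
    by (rule fps_cong_cancel) (simp add: U0)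
  have W0: "weyl_denom n y \<noteq> 0"
  proof -
    have ne1: "w ^ m \<noteq> 1" if "0 < m" "m < 2 * n + 2" for m
      unfolding primitive using that by (auto dest: dvd_imp_le)
    have 1: "(y i)\<^sup>2 \<noteq> 1" if "i \<in> ?I" for i
      using ne1[of "i * 2"] that by (simp add: y_def power_mult)
    have 2: "y i * y j \<noteq> 1" "y i / y j \<noteq> 1" if "(i, j) \<in> pairs ?I" for i j
    proof -
      show "y i * y j \<noteq> 1" using ne1[of "i + j"] that by (auto simp: y_def power_add pairs_def)
      have "w ^ i = w ^ j \<Longrightarrow> i = j" using that by (intro inj_onD[OF w_inj]) (auto simp: pairs_def N_def)
      then show "y i / y j \<noteq> 1" using that w_nz by (auto simp: y_def pairs_def)
    qed
    have "(\<Prod>i=1..n. (1 - (y i)\<^sup>2) / y i) \<noteq> 0" using 1 y by (auto simp: prod_zero_iff)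
    moreover have "(\<Prod>(i, j)\<in>pairs {1..n}. (1 - y i * y j) * (1 - y i / y j) / y i) \<noteq> 0"
      using 2 y by (auto simp: prod_zero_iff)
    ultimately show ?thesis by (simp add: weyl_denom_def)
  qed
  have q0: "fps_nth (qfact n ^ m) 0 = 1" for m by (simp add: fps_power_zeroth qfact_nth_0)
  have "fps_nth (C * fps_const A0) 0 = weyl_denom n y" using CA q0 by (simp add: fps_cong_def)
  then have A0: "A0 \<noteq> 0" using W0 by auto
  define c where "c = weyl_denom n y / A0"
  have Cc: "fps_cong n C (fps_const c * qfact n ^ (2 * e))"
  proof -
    have "fps_cong n (fps_const (1 / A0) * (C * fps_const A0)) (fps_const (1 / A0) * (fps_const (weyl_denom n y) * qfact n ^ (2 * e)))"
      by (intro fps_cong_mult CA fps_cong_refl)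
    moreover have "fps_const (1 / A0) * (C * fps_const A0) = C * (fps_const (1 / A0) * fps_const A0)" by (simp only: mult_ac)
    moreover have "fps_const (1 / A0) * (fps_const (weyl_denom n y) * qfact n ^ (2 * e)) = fps_const c * qfact n ^ (2 * e)"
      by (simp add: c_def mult.assoc[symmetric])
    ultimately show ?thesis using A0 by simp
  qed
  show ?thesis
  proof (intro exI[of _ c] conjI allI impI)
    show "c \<noteq> 0" using A0 W0 by (simp add: c_def)
    fix x :: "nat \<Rightarrow> complex" assume "\<forall>j. x j \<noteq> 0"
    then have x: "x j \<noteq> 0" for j by blast
    let ?A = "alt_sum ?I (\<lambda>r i. fps_const (sympl_diff r (x i)) - fps_const (sympl_diff (2 * n + 2 - r) (x i)) * fps_X ^ (n + 1 - r))"
    have "fps_cong n (qfact n ^ (2 * e) * (fps_const (weyl_denom n x) * (qfact n ^ n * Q x))) (theta_prod n x)"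
    proof -
      have "fps_cong n (fps_const (weyl_denom n x) * (qfact n ^ (n + 2 * e) * Q x)) (theta_prod n x)"
        unfolding e_def Q_def by (rule fps_cong_sym[OF theta_prod_cong_prod[OF x]])
      then show ?thesis by (simp only: power_add mult_ac)
    qed
    also have "theta_prod n x = C * alt_sum ?I (\<lambda>r i. \<phi> r (x i))" by (rule C[OF x])
    also have "fps_cong n \<dots> ((fps_const c * qfact n ^ (2 * e)) * ?A)"
      unfolding \<phi>_def by (intro fps_cong_mult Cc fps_cong_alt_sum sympl_theta_cong) (use x in auto)
    also have "\<dots> = qfact n ^ (2 * e) * (fps_const c * ?A)" by (simp only: mult_ac)
    finally have "fps_cong n (fps_const (weyl_denom n x) * (qfact n ^ n * Q x)) (fps_const c * ?A)"
      by (rule fps_cong_cancel) (simp add: q0)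
    then show "fps_cong n (fps_const (weyl_denom n x) * (\<Prod>k=1..n. (1 - fps_X ^ k) ^ n * root_factors n (fps_X ^ k) x)) (fps_const c * ?A)"
      by (simp add: prod.distrib Q_def qfact_def prod_power_distrib)
  qed
qed

subsection \<open>Principal specialisation\<close>

lemma prod_sum_subsets:
  fixes f g :: "nat \<Rightarrow> 'k :: comm_ring_1"
  assumes "finite I"
  shows "(\<Prod>i\<in>I. f i + g i) = (\<Sum>R\<in>Pow I. \<Prod>i\<in>I. if i \<in> R then f i else g i)"
  unfolding prod_add[OF assms]
proof (rule sum.cong[OF refl])
  fix R assume "R \<in> Pow I"
  then have "I \<inter> {i. i \<in> R} = R" "I \<inter> - {i. i \<in> R} = I - R" by auto
  then show "(\<Prod>i\<in>R. f i) * (\<Prod>i\<in>I - R. g i) = (\<Prod>i\<in>I. if i \<in> R then f i else g i)"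
    by (simp only: prod.If_cases[OF assms])
qed

text \<open>Multilinearity of the determinant in its rows. Rewriting the product with the inverse
  permutation makes it a product over rows, where the choice of f or g is made.\<close>

lemma alt_sum_add:
  fixes f g :: "nat \<Rightarrow> nat \<Rightarrow> 'k :: comm_ring_1"
  assumes "finite I"
  shows "alt_sum I (\<lambda>r i. f r i + g r i) = (\<Sum>R\<in>Pow I. alt_sum I (\<lambda>r i. if r \<in> R then f r i else g r i))"
proof -
  have "(\<Prod>i\<in>I. f (p i) i + g (p i) i) = (\<Sum>R\<in>Pow I. \<Prod>i\<in>I. if p i \<in> R then f (p i) i else g (p i) i)"
    if p: "p permutes I" for p
  proof -
    have *: "(\<Prod>i\<in>I. h (p i) i) = (\<Prod>i\<in>I. h i (inv p i))" for h :: "nat \<Rightarrow> nat \<Rightarrow> 'k"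
      using prod.permute[OF p, of "\<lambda>i. h i (inv p i)"] p by (simp add: comp_def permutes_inverses)
    show ?thesis
      using *[of "\<lambda>r i. f r i + g r i"] *[of "\<lambda>r i. if r \<in> R then f r i else g r i" for R]
        prod_sum_subsets[OF assms, of "\<lambda>i. f i (inv p i)" "\<lambda>i. g i (inv p i)"] by simp
  qed
  then have "alt_sum I (\<lambda>r i. f r i + g r i) = (\<Sum>p | p permutes I. \<Sum>R\<in>Pow I. of_int (sign p) * (\<Prod>i\<in>I. if p i \<in> R then f (p i) i else g (p i) i))"
    by (simp add: alt_sum_def sum_distrib_left)
  also have "\<dots> = (\<Sum>R\<in>Pow I. alt_sum I (\<lambda>r i. if r \<in> R then f r i else g r i))"
    unfolding alt_sum_def by (rule sum.swap)
  finally show ?thesis .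
qed

lemma alt_sum_transpose:
  assumes "finite I"
  shows "alt_sum I (\<lambda>r i. m i r) = alt_sum I m"
  unfolding alt_sum_def
proof (rule sum.reindex_bij_witness[of _ inv inv])
  fix p assume "p \<in> {p. p permutes I}"
  then have p: "p permutes I" by simp
  then have "permutation p" using assms by (auto simp: permutation_permutes)
  moreover have "(\<Prod>i\<in>I. m (inv p i) i) = (\<Prod>i\<in>I. m i (p i))"
    using prod.permute[OF p, of "\<lambda>i. m (inv p i) i"] p by (simp add: comp_def permutes_inverses)
  ultimately show "of_int (sign (inv p)) * (\<Prod>i\<in>I. m (inv p i) i) = of_int (sign p) * (\<Prod>i\<in>I. m i (p i))"
    by (simp add: sign_inverse)
qed (auto simp: permutes_inv permutes_inv_inv)

lemma fps_nth_0_prod: "fps_nth (\<Prod>i\<in>A. f i) 0 = (\<Prod>i\<in>A. fps_nth (f i) 0 :: complex)"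
  by (induction A rule: infinite_finite_induct) auto

lemma fps_nth_0_alt_sum: "fps_nth (alt_sum I m) 0 = alt_sum I (\<lambda>r i. fps_nth (m r i) 0 :: complex)"
proof -
  have "fps_nth (of_int k) 0 = (of_int k :: complex)" for k by (simp add: fps_of_int[symmetric])
  then show ?thesis by (simp add: alt_sum_def fps_sum_nth fps_nth_0_prod)
qed

text \<open>r and 2 n + 2 - r are the two exponents that survive truncation. With r = n + 1 - s the
  second is n + 1 + s.\<close>

definition flip :: "nat \<Rightarrow> nat set \<Rightarrow> nat \<Rightarrow> nat" where
  "flip n R r = (if r \<in> R then 2 * n + 2 - r else r)"

lemma macdonald_C_principal:
  assumes q: "q \<noteq> 0"
  shows "fps_cong n (fps_const (weyl_denom n (\<lambda>i. q ^ i)) * (\<Prod>k=1..n. (1 - fps_X ^ k) ^ n * root_factors n (fps_X ^ k) (\<lambda>i. q ^ i)))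
     (\<Sum>R\<in>Pow {1..n}. fps_const ((-1) ^ card R * weyl_denom n (\<lambda>i. q ^ flip n R i)) * fps_X ^ (\<Sum>r\<in>R. n + 1 - r))"
proof -
  let ?I = "{1..n}"
  obtain c where c: "c \<noteq> 0"
    and main: "\<And>x. (\<And>j. x j \<noteq> 0) \<Longrightarrow> fps_cong n
      (fps_const (weyl_denom n x) * (\<Prod>k=1..n. (1 - fps_X ^ k) ^ n * root_factors n (fps_X ^ k) x))
      (fps_const c * alt_sum ?I (\<lambda>r i. fps_const (sympl_diff r (x i)) - fps_const (sympl_diff (2 * n + 2 - r) (x i)) * fps_X ^ (n + 1 - r)))"
    using macdonald_C_truncated[of n] by blast
  \<comment> \<open>The coefficient of T^0 is the Weyl denominator formula with the same scalar c,
    valid at every point x. It is used below to eliminate c.\<close>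
  have weyl: "weyl_denom n x = c * alt_sum ?I (\<lambda>r i. sympl_diff r (x i))" if x: "\<And>j. x j \<noteq> 0" for x
  proof -
    have "fps_nth (root_factors n (fps_X ^ k) x) 0 = 1" if "k \<ge> 1" for k
    proof -
      have t: "fps_nth (theta_factor (fps_X ^ k) u) 0 = 1" for u using that by (simp add: theta_factor_def)
      show ?thesis by (simp add: root_factors_def fps_nth_0_prod t case_prod_unfold)
    qed
    then have "fps_nth (\<Prod>k=1..n. (1 - fps_X ^ k) ^ n * root_factors n (fps_X ^ k) x) 0 = 1"
      unfolding fps_nth_0_prod by (intro prod.neutral) (auto simp: fps_power_zeroth power_0_left)
    then have "weyl_denom n x = c * alt_sum ?I (\<lambda>r i. fps_nth (fps_const (sympl_diff r (x i)) - fps_const (sympl_diff (2 * n + 2 - r) (x i)) * fps_X ^ (n + 1 - r)) 0)"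
      using main[of x, OF x, unfolded fps_cong_def, rule_format, of 0] by (simp add: fps_nth_0_alt_sum)
    also have "alt_sum ?I (\<lambda>r i. fps_nth (fps_const (sympl_diff r (x i)) - fps_const (sympl_diff (2 * n + 2 - r) (x i)) * fps_X ^ (n + 1 - r)) 0) = alt_sum ?I (\<lambda>r i. sympl_diff r (x i))"
      by (rule alt_sum_cong) auto
    finally show ?thesis .
  qed
  have summand: "fps_const c * alt_sum ?I (\<lambda>r i. if r \<in> R then - (fps_const (sympl_diff (2 * n + 2 - r) (q ^ i)) * fps_X ^ (n + 1 - r)) else fps_const (sympl_diff r (q ^ i)))
     = fps_const ((-1) ^ card R * weyl_denom n (\<lambda>i. q ^ flip n R i)) * fps_X ^ (\<Sum>r\<in>R. n + 1 - r)"
    if R: "R \<in> Pow ?I" for R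
  proof -
    define g where "g r = (if r \<in> R then - (fps_X ^ (n + 1 - r)) else (1 :: complex fps))" for r
    have fin: "finite R" using R finite_subset by auto
    have "fps_const c * alt_sum ?I (\<lambda>r i. if r \<in> R then - (fps_const (sympl_diff (2 * n + 2 - r) (q ^ i)) * fps_X ^ (n + 1 - r)) else fps_const (sympl_diff r (q ^ i)))
      = fps_const c * alt_sum ?I (\<lambda>r i. fps_const (sympl_diff (flip n R r) (q ^ i)) * g r)"
      by (intro arg_cong2[of _ _ _ _ "(*)"] alt_sum_cong refl) (simp add: flip_def g_def)
    also have "\<dots> = fps_const (c * alt_sum ?I (\<lambda>r i. sympl_diff (flip n R r) (q ^ i))) * (\<Prod>r\<in>?I. g r)"
      unfolding alt_sum_scale[OF finite_atLeastAtMost] alt_sum_const by simp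
    \<comment> \<open>At x i = q^i the entries depend only on the product of exponent and index.
      After transposition the flipped exponents therefore act as a new point, and the determinant is
      again a Weyl denominator.\<close>
    also have "alt_sum ?I (\<lambda>r i. sympl_diff (flip n R r) (q ^ i)) = alt_sum ?I (\<lambda>i r. sympl_diff (flip n R r) (q ^ i))"
      by (rule alt_sum_transpose[symmetric]) simp
    also have "\<dots> = alt_sum ?I (\<lambda>r i. sympl_diff r (q ^ flip n R i))"
      by (rule alt_sum_cong) (simp add: sympl_diff_def power_mult[symmetric] power_one_over mult.commute)
    also have "c * \<dots> = weyl_denom n (\<lambda>i. q ^ flip n R i)" by (rule weyl[symmetric]) (use q in simp)
    also have "(\<Prod>r\<in>?I. g r) = (\<Prod>r\<in>R. - (fps_X ^ (n + 1 - r)))"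
      unfolding g_def using R by (subst prod.mono_neutral_cong_right[of ?I R _ "\<lambda>r. - (fps_X ^ (n + 1 - r))"]) auto
    also have "\<dots> = fps_const ((-1) ^ card R) * fps_X ^ (\<Sum>r\<in>R. n + 1 - r)"
      using fin by (induction R rule: finite_induct) (simp_all add: power_add fps_const_neg[symmetric] del: fps_const_neg)
    finally show ?thesis by (simp add: mult_ac fps_const_mult[symmetric] del: fps_const_mult)
  qed
  have "fps_const c * alt_sum ?I (\<lambda>r i. fps_const (sympl_diff r (q ^ i)) - fps_const (sympl_diff (2 * n + 2 - r) (q ^ i)) * fps_X ^ (n + 1 - r))
     = fps_const c * alt_sum ?I (\<lambda>r i. - (fps_const (sympl_diff (2 * n + 2 - r) (q ^ i)) * fps_X ^ (n + 1 - r)) + fps_const (sympl_diff r (q ^ i)))"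
    by simp
  also have "\<dots> = (\<Sum>R\<in>Pow ?I. fps_const ((-1) ^ card R * weyl_denom n (\<lambda>i. q ^ flip n R i)) * fps_X ^ (\<Sum>r\<in>R. n + 1 - r))"
    unfolding alt_sum_add[OF finite_atLeastAtMost] sum_distrib_left by (rule sum.cong[OF refl]) (rule summand)
  finally show ?thesis using main[of "\<lambda>i. q ^ i"] q by simp
qed

subsection \<open>The limit\<close>

text \<open>Up to the normalisation \<open>weyl_dim n (\<lambda>i. i)\<close> this is Weyl's dimension formula for \<open>Sp(2 n)\<close>,
  with sign if \<open>a\<close> is not decreasing.\<close>

definition weyl_dim :: "nat \<Rightarrow> (nat \<Rightarrow> nat) \<Rightarrow> complex" where
  "weyl_dim n a = (\<Prod>i=1..n. of_nat (a i)) * (\<Prod>(i, j)\<in>pairs {1..n}. (of_nat (a i))\<^sup>2 - (of_nat (a j))\<^sup>2)"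

lemma tendsto_power_int_diff:
  "((\<lambda>p::complex. (p powi m - p powi (- m)) / (p - 1)) \<longlongrightarrow> 2 * of_int m) (at 1)"
proof -
  have "((\<lambda>p::complex. p powi m - p powi (- m)) has_field_derivative (2 * of_int m)) (at 1)"
    by (auto intro!: derivative_eq_intros)
  then show ?thesis by (simp add: has_field_derivative_iff)
qed

text \<open>The base p^2 provides the square roots needed for the balanced form p^m - p^(-m), in
  which every root contributes at least a simple zero at p = 1.\<close>

lemma weyl_denom_power:
  assumes p: "p \<noteq> 0"
  shows "weyl_denom n (\<lambda>i. (p\<^sup>2) ^ a i) =
    (\<Prod>i=1..n. - (p powi (2 * int (a i)) - p powi (- (2 * int (a i))))) *
    (\<Prod>(i, j)\<in>pairs {1..n}. (p powi (int (a i) + int (a j)) - p powi (- (int (a i) + int (a j)))) *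
        (p powi (int (a i) - int (a j)) - p powi (- (int (a i) - int (a j)))))"
proof -
  have z: "(p\<^sup>2) ^ m = p powi int m * p powi int m" for m
    by (simp add: power_mult[symmetric] mult_2 power_add)
  have 1: "(1 - u\<^sup>2) / u = - (u - 1 / u)" if "u \<noteq> 0" for u :: complex
    using that by (simp add: field_simps power2_eq_square)
  have "(1 - ((p\<^sup>2) ^ m)\<^sup>2) / (p\<^sup>2) ^ m = - (p powi (2 * int m) - p powi (- (2 * int m)))" for m
  proof -
    have "(p\<^sup>2) ^ m = p powi (2 * int m)" by (simp add: power_int_mult)
    then show ?thesis using p by (subst 1) (simp_all add: power_int_minus divide_inverse)
  qed
  moreover have "(1 - (p\<^sup>2) ^ k * (p\<^sup>2) ^ l) * (1 - (p\<^sup>2) ^ k / (p\<^sup>2) ^ l) / (p\<^sup>2) ^ k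
     = (p powi (int k + int l) - p powi (- (int k + int l))) * (p powi (int k - int l) - p powi (- (int k - int l)))" for k l
  proof -
    define u v where "u = p ^ k" and "v = p ^ l"
    have uv: "u \<noteq> 0" "v \<noteq> 0" using p by (auto simp: u_def v_def)
    have "p powi (- (int k + int l)) = 1 / (u * v)" "p powi (int k + int l) = u * v"
      "p powi (int k - int l) = u / v" "p powi (- (int k - int l)) = v / u"
      using p by (simp_all add: power_int_add power_int_diff power_int_minus u_def v_def divide_inverse)
    moreover have "(p\<^sup>2) ^ k = u * u" "(p\<^sup>2) ^ l = v * v"
      by (simp_all add: z u_def v_def)
    ultimately show ?thesis using uv by (simp only:) (simp add: field_simps)
  qed
  ultimately show ?thesis unfolding weyl_denom_def by simp
qed

text \<open>There are n + 2 card (pairs) positive roots, each giving one factor p - 1. The long ones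
  leave -2 (2 a i) = -4 a i, a pair of short ones leaves 2 (a i + a j) * 2 (a i - a j); hence the
  constants.\<close>

lemma tendsto_weyl_denom:
  "((\<lambda>p. weyl_denom n (\<lambda>i. (p\<^sup>2) ^ a i) / (p - 1) ^ (n + 2 * card (pairs {1..n}))) \<longlongrightarrow>
     (-4) ^ n * 4 ^ card (pairs {1..n}) * weyl_dim n a) (at 1)"
proof -
  let ?b = "\<lambda>p m. (p powi m - p powi (- m)) / (p - 1) :: complex"
  have "((\<lambda>p. (\<Prod>i=1..n. - ?b p (2 * int (a i))) *
    (\<Prod>(i, j)\<in>pairs {1..n}. ?b p (int (a i) + int (a j)) * ?b p (int (a i) - int (a j)))) \<longlongrightarrow>
    (\<Prod>i=1..n. - (2 * of_int (2 * int (a i)))) * (\<Prod>(i, j)\<in>pairs {1..n}. (2 * of_int (int (a i) + int (a j))) * (2 * of_int (int (a i) - int (a j))))) (at 1)"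
    unfolding case_prod_unfold
    by (intro tendsto_mult tendsto_prod tendsto_minus tendsto_power_int_diff)
  also have "(\<Prod>i=1..n. - (2 * of_int (2 * int (a i)))) * (\<Prod>(i, j)\<in>pairs {1..n}. (2 * of_int (int (a i) + int (a j))) * (2 * of_int (int (a i) - int (a j))))
     = (-4) ^ n * 4 ^ card (pairs {1..n}) * weyl_dim n a"
  proof -
    have "(\<Prod>i=1..n. - (2 * of_int (2 * int (a i)))) = (\<Prod>i=1..n. (-4) * of_nat (a i) :: complex)"
      by (intro prod.cong refl) simp
    moreover have "(\<Prod>(i, j)\<in>pairs {1..n}. (2 * of_int (int (a i) + int (a j))) * (2 * of_int (int (a i) - int (a j))))
       = (\<Prod>(i, j)\<in>pairs {1..n}. 4 * ((of_nat (a i))\<^sup>2 - (of_nat (a j))\<^sup>2) :: complex)"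
      by (intro prod.cong refl) (auto simp: power2_eq_square algebra_simps)
    moreover have "(\<Prod>i=1..n. (-4) * of_nat (a i) :: complex) = (-4) ^ n * (\<Prod>i=1..n. of_nat (a i))"
      by (simp only: prod.distrib prod_constant card_atLeastAtMost diff_Suc_1 add_diff_cancel_right')
    moreover have "(\<Prod>(i, j)\<in>pairs {1..n}. 4 * ((of_nat (a i))\<^sup>2 - (of_nat (a j))\<^sup>2) :: complex)
       = 4 ^ card (pairs {1..n}) * (\<Prod>(i, j)\<in>pairs {1..n}. (of_nat (a i))\<^sup>2 - (of_nat (a j))\<^sup>2)"
      by (simp only: prod.distrib prod_constant case_prod_unfold)
    ultimately show ?thesis by (simp only: weyl_dim_def mult_ac)
  qed
  finally show ?thesis
  proof (rule Lim_transform_eventually)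
    have "eventually (\<lambda>p::complex. p \<noteq> 0) (at 1)"
      by (rule eventually_at_filter[THEN iffD2], rule eventually_mono[OF t1_space_nhds[of 1 0]]) auto
    then show "eventually (\<lambda>p. (\<Prod>i=1..n. - ?b p (2 * int (a i))) *
      (\<Prod>(i, j)\<in>pairs {1..n}. ?b p (int (a i) + int (a j)) * ?b p (int (a i) - int (a j))) =
      weyl_denom n (\<lambda>i. (p\<^sup>2) ^ a i) / (p - 1) ^ (n + 2 * card (pairs {1..n}))) (at 1)"
    proof eventually_elim
      case (elim p)
      show ?case unfolding weyl_denom_power[OF elim]
        by (simp add: case_prod_unfold prod.distrib prod_dividef power_add power_mult power2_eq_square
            minus_divide_left del: minus_divide_left[symmetric] flip: power_mult_distrib)
    qed
  qed
qed

definition fps_lim :: "(complex \<Rightarrow> complex fps) \<Rightarrow> complex fps \<Rightarrow> bool" where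
  "fps_lim f g \<longleftrightarrow> (\<forall>k. ((\<lambda>p. fps_nth (f p) k) \<longlongrightarrow> fps_nth g k) (at 1))"

lemma fps_lim_const: "fps_lim (\<lambda>_. g) g"
  and fps_lim_fps_const: "(c \<longlongrightarrow> l) (at 1) \<Longrightarrow> fps_lim (\<lambda>p. fps_const (c p)) (fps_const l)"
  and fps_lim_diff: "fps_lim f g \<Longrightarrow> fps_lim f' g' \<Longrightarrow> fps_lim (\<lambda>p. f p - f' p) (g - g')"
  and fps_lim_mult: "fps_lim f g \<Longrightarrow> fps_lim f' g' \<Longrightarrow> fps_lim (\<lambda>p. f p * f' p) (g * g')"
  by (auto simp: fps_lim_def fps_mult_nth intro!: tendsto_intros)

lemma fps_lim_prod: "(\<And>i. i \<in> A \<Longrightarrow> fps_lim (f i) (g i)) \<Longrightarrow> fps_lim (\<lambda>p. \<Prod>i\<in>A. f i p) (\<Prod>i\<in>A. g i)"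
  by (induction A rule: infinite_finite_induct) (auto intro: fps_lim_const fps_lim_mult)

lemma card_pairs: "2 * card (pairs {1..n}) = n * (n - 1)"
proof (induction n)
  case (Suc n)
  have "{1..Suc n} = insert (Suc n) {1..n}" by auto
  then have "pairs {1..Suc n} = pairs {1..n} \<union> (\<lambda>k. (k, Suc n)) ` {1..n}"
    by (auto simp: pairs_def image_iff)
  moreover have "pairs {1..n} \<inter> (\<lambda>k. (k, Suc n)) ` {1..n} = {}" by (auto simp: pairs_def)
  ultimately have "card (pairs {1..Suc n}) = card (pairs {1..n}) + n"
    by (simp add: card_Un_disjoint card_image inj_on_def)
  then show ?case using Suc by (cases n) auto
qed (simp add: pairs_def)

lemma weyl_dim_id_nz: "weyl_dim n (\<lambda>i. i) \<noteq> 0"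
proof -
  have "(of_nat i)\<^sup>2 - (of_nat j)\<^sup>2 \<noteq> (0 :: complex)" if "i < j" for i j :: nat
  proof
    assume "(of_nat i)\<^sup>2 - (of_nat j)\<^sup>2 = (0 :: complex)"
    then have "of_nat (i\<^sup>2) = (of_nat (j\<^sup>2) :: complex)" by simp
    then have "i\<^sup>2 = j\<^sup>2" by (simp only: of_nat_eq_iff)
    then show False using that by simp
  qed
  then have "(\<Prod>(i, j)\<in>pairs {1..n}. (of_nat i)\<^sup>2 - (of_nat j)\<^sup>2 :: complex) \<noteq> 0"
    unfolding prod_zero_iff[OF finite_pairs[OF finite_atLeastAtMost]] by (auto simp: pairs_def)
  then show ?thesis by (simp add: weyl_dim_def prod_zero_iff)
qed

text \<open>Both sides of the principal specialisation are divided by the same power of p - 1 before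
  p tends to 1. The normalising constant is common to all terms and drops out.\<close>

theorem macdonald_C_dimensions:
  "fps_cong n (qfact n ^ (2 * n\<^sup>2 + n))
     (\<Sum>R\<in>Pow {1..n}. fps_const ((-1) ^ card R * (weyl_dim n (flip n R) / weyl_dim n (\<lambda>i. i))) * fps_X ^ (\<Sum>r\<in>R. n + 1 - r))"
proof -
  define e where "e = card (pairs {1..n})"
  define \<kappa> :: complex where "\<kappa> = (-4) ^ n * 4 ^ e"
  define G where "G = (\<lambda>p::complex. \<Prod>k=1..n. (1 - fps_X ^ k) ^ n * root_factors n (fps_X ^ k) (\<lambda>i. (p\<^sup>2) ^ i))"
  have limG: "fps_lim G (qfact n ^ (2 * n\<^sup>2 + n))"
  proof -
    have tf: "fps_lim (\<lambda>p. theta_factor t (u p)) ((1 - t) * (1 - t))" if "(u \<longlongrightarrow> 1) (at 1)" for u t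
    proof -
      have "fps_lim (\<lambda>p. theta_factor t (u p)) ((1 - t * fps_const 1) * (1 - t * fps_const (1 / 1)))"
        unfolding theta_factor_def
        by (intro fps_lim_mult fps_lim_diff fps_lim_const fps_lim_fps_const tendsto_divide tendsto_const that) simp
      then show ?thesis by simp
    qed
    have pw: "((\<lambda>p::complex. (p\<^sup>2) ^ i) \<longlongrightarrow> 1) (at 1)" for i by (auto intro!: tendsto_eq_intros)
    have "fps_lim (\<lambda>p. root_factors n t (\<lambda>i. (p\<^sup>2) ^ i))
       ((\<Prod>i=1..n. (1 - t) * (1 - t)) * (\<Prod>(i, j)\<in>pairs {1..n}. ((1 - t) * (1 - t)) * ((1 - t) * (1 - t))))" for t
      unfolding root_factors_def case_prod_unfold
      by (intro fps_lim_mult fps_lim_prod tf) (auto intro!: tendsto_eq_intros pw)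
    then have "fps_lim G (\<Prod>k=1..n. (1 - fps_X ^ k) ^ n * ((\<Prod>i=1..n. (1 - fps_X ^ k) * (1 - fps_X ^ k)) * (\<Prod>(i, j)\<in>pairs {1..n}. ((1 - fps_X ^ k) * (1 - fps_X ^ k)) * ((1 - fps_X ^ k) * (1 - fps_X ^ k)))))"
      unfolding G_def by (intro fps_lim_mult fps_lim_prod fps_lim_const)
    also have "(\<Prod>k=1..n. (1 - fps_X ^ k) ^ n * ((\<Prod>i=1..n. (1 - fps_X ^ k) * (1 - fps_X ^ k)) * (\<Prod>(i, j)\<in>pairs {1..n}. ((1 - fps_X ^ k) * (1 - fps_X ^ k)) * ((1 - fps_X ^ k) * (1 - fps_X ^ k)))))
       = (\<Prod>k=1..n. (1 - fps_X ^ k :: complex fps) ^ (2 * n\<^sup>2 + n))"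
    proof (intro prod.cong refl)
      fix k
      let ?u = "1 - fps_X ^ k :: complex fps"
      \<comment> \<open>The rank n, the 2 n long roots and the 4 e = 2 n (n - 1) short roots add up
        to the dimension of the Lie algebra.\<close>
      have "2 * n\<^sup>2 + n = n + (n + n + ((e + e) + (e + e)))"
        using card_pairs[of n] by (cases n) (simp_all add: e_def power2_eq_square algebra_simps)
      then show "?u ^ n * ((\<Prod>i=1..n. ?u * ?u) * (\<Prod>(i, j)\<in>pairs {1..n}. (?u * ?u) * (?u * ?u))) = ?u ^ (2 * n\<^sup>2 + n)"
        by (simp only: case_prod_unfold e_def[symmetric] prod_constant card_atLeastAtMost diff_Suc_1 add_diff_cancel_right'
            power_add power_mult_distrib mult_ac)
    qed
    also have "\<dots> = qfact n ^ (2 * n\<^sup>2 + n)" by (simp add: qfact_def prod_power_distrib)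
    finally show ?thesis .
  qed
  define W where "W = (\<lambda>a p. weyl_denom n (\<lambda>i. (p\<^sup>2) ^ a i) / (p - 1) ^ (n + 2 * e))"
  have limW: "(W a \<longlongrightarrow> \<kappa> * weyl_dim n a) (at 1)" for a
    unfolding W_def \<kappa>_def e_def by (rule tendsto_weyl_denom)
  let ?c = "\<lambda>R k. fps_nth (fps_X ^ (\<Sum>r\<in>R. n + 1 - r)) k :: complex"
  have "fps_nth (qfact n ^ (2 * n\<^sup>2 + n)) k = (\<Sum>R\<in>Pow {1..n}. (-1) ^ card R * (weyl_dim n (flip n R) / weyl_dim n (\<lambda>i. i)) * ?c R k)"
    if k: "k \<le> n" for k
  proof -
    have "((\<lambda>p. W (\<lambda>i. i) p * fps_nth (G p) k) \<longlongrightarrow> \<kappa> * weyl_dim n (\<lambda>i. i) * fps_nth (qfact n ^ (2 * n\<^sup>2 + n)) k) (at 1)"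
      using limG unfolding fps_lim_def by (intro tendsto_mult limW) auto
    moreover have "((\<lambda>p. W (\<lambda>i. i) p * fps_nth (G p) k) \<longlongrightarrow> (\<Sum>R\<in>Pow {1..n}. (-1) ^ card R * (\<kappa> * weyl_dim n (flip n R)) * ?c R k)) (at 1)"
    proof (rule Lim_transform_eventually)
      show "((\<lambda>p. \<Sum>R\<in>Pow {1..n}. (-1) ^ card R * W (flip n R) p * ?c R k) \<longlongrightarrow> (\<Sum>R\<in>Pow {1..n}. (-1) ^ card R * (\<kappa> * weyl_dim n (flip n R)) * ?c R k)) (at 1)"
        by (intro tendsto_sum tendsto_mult tendsto_const limW)
      have "eventually (\<lambda>p::complex. p \<noteq> 0) (at 1)"
        by (rule eventually_at_filter[THEN iffD2], rule eventually_mono[OF t1_space_nhds[of 1 0]]) auto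
      then show "eventually (\<lambda>p. (\<Sum>R\<in>Pow {1..n}. (-1) ^ card R * W (flip n R) p * ?c R k) = W (\<lambda>i. i) p * fps_nth (G p) k) (at 1)"
      proof eventually_elim
        case (elim p)
        then have "weyl_denom n (\<lambda>i. (p\<^sup>2) ^ i) * fps_nth (G p) k = (\<Sum>R\<in>Pow {1..n}. (-1) ^ card R * weyl_denom n (\<lambda>i. (p\<^sup>2) ^ flip n R i) * ?c R k)"
          using macdonald_C_principal[of "p\<^sup>2" n] k unfolding fps_cong_def G_def by (simp add: fps_sum_nth)
        then show ?case unfolding W_def by (simp add: sum_divide_distrib mult_ac)
      qed
    qed
    ultimately have "\<kappa> * weyl_dim n (\<lambda>i. i) * fps_nth (qfact n ^ (2 * n\<^sup>2 + n)) k = (\<Sum>R\<in>Pow {1..n}. (-1) ^ card R * (\<kappa> * weyl_dim n (flip n R)) * ?c R k)"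
      by (rule tendsto_unique[rotated]) simp
    also have "\<dots> = \<kappa> * weyl_dim n (\<lambda>i. i) * (\<Sum>R\<in>Pow {1..n}. (-1) ^ card R * (weyl_dim n (flip n R) / weyl_dim n (\<lambda>i. i)) * ?c R k)"
      unfolding sum_distrib_left using weyl_dim_id_nz[of n] by (intro sum.cong refl) (simp add: field_simps)
    finally show ?thesis using weyl_dim_id_nz[of n] by (simp add: \<kappa>_def)
  qed
  then show ?thesis by (simp add: fps_cong_def fps_sum_nth)
qed

subsection \<open>The dimensions as products over a finite set\<close>

text \<open>The contribution of the row and column of the \<open>s\<close>-th principal hook of \<open>dd_of S\<close> to the hook
  product, see \<open>shape_prod_dd_of\<close> below.\<close>

definition hook_weight :: "complex \<Rightarrow> nat set \<Rightarrow> nat \<Rightarrow> complex" where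
  "hook_weight z S s = (1 - z / of_nat s) * (1 - z / of_nat (2 * s)) *
     (\<Prod>t\<in>{1..<s} - S. 1 - z\<^sup>2 / (of_nat s - of_nat t)\<^sup>2) *
     (\<Prod>t\<in>S \<inter> {1..<s}. 1 - z\<^sup>2 / (of_nat s + of_nat t)\<^sup>2)"

definition set_weight :: "complex \<Rightarrow> nat set \<Rightarrow> complex" where
  "set_weight z S = (\<Prod>s\<in>S. hook_weight z S s)"

text \<open>The product runs from m - s + 1 to m + s - 1. This and the next three evaluations supply
  the factorials for \<open>hook_weight_empty\<close>.\<close>

lemma prod_symmetric_range:
  "1 \<le> s \<Longrightarrow> s \<le> m \<Longrightarrow> (\<Prod>t\<in>{1..<s}. (m - t) * (m + t)) * m * fact (m - s) = (fact (m + s - 1) :: nat)"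
proof (induction s rule: nat_induct_at_least[of 1])
  case base
  then show ?case by (cases m) auto
next
  case (Suc s)
  have "{1..<Suc s} = insert s {1..<s}" using Suc.hyps by auto
  then have "(\<Prod>t\<in>{1..<Suc s}. (m - t) * (m + t)) * m * fact (m - Suc s) = (m + s) * ((\<Prod>t\<in>{1..<s}. (m - t) * (m + t)) * m * ((m - s) * fact (m - Suc s)))"
    by (simp add: mult_ac)
  also have "(m - s) * fact (m - Suc s) = fact (m - s)" using Suc.prems
    by (metis Suc_diff_Suc Suc_le_eq fact_Suc of_nat_id)
  also have "(\<Prod>t\<in>{1..<s}. (m - t) * (m + t)) * m * fact (m - s) = fact (m + s - 1)" using Suc by simp
  also have "(m + s) * fact (m + s - 1) = fact (m + Suc s - 1)" using Suc.hyps by (cases "m + s") auto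
  finally show ?case .
qed

lemma prod_increasing_range: "s \<le> n \<Longrightarrow> (\<Prod>t\<in>{s<..n}. s + t) * fact (2 * s) = (fact (n + s) :: nat)"
proof (induction n rule: nat_induct_at_least[of s])
  case (Suc n)
  have "{s<..Suc n} = insert (Suc n) {s<..n}" using Suc.hyps by auto
  then have "(\<Prod>t\<in>{s<..Suc n}. s + t) * fact (2 * s) = (s + Suc n) * ((\<Prod>t\<in>{s<..n}. s + t) * fact (2 * s))"
    by (simp del: add_Suc_right)
  also have "\<dots> = fact (Suc n + s)" unfolding Suc.IH by (simp add: algebra_simps)
  finally show ?case .
qed (simp add: mult_2)

lemma prod_shifted_range: "s \<le> n \<Longrightarrow> (\<Prod>t\<in>{s<..n}. t - s) = (fact (n - s) :: nat)"
proof (induction n rule: nat_induct_at_least[of s])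
  case (Suc n)
  have "{s<..Suc n} = insert (Suc n) {s<..n}" using Suc.hyps by auto
  then show ?case using Suc by (simp add: Suc_diff_le)
qed simp

lemma prod_decreasing_range:
  "s \<le> n \<Longrightarrow> n < m + s \<Longrightarrow> (\<Prod>t\<in>{s<..n}. m + s - t) * fact (m + s - n - 1) = (fact (m - 1) :: nat)"
proof (induction n rule: nat_induct_at_least[of s])
  case (Suc n)
  have "{s<..Suc n} = insert (Suc n) {s<..n}" using Suc.hyps by auto
  then have "(\<Prod>t\<in>{s<..Suc n}. m + s - t) * fact (m + s - Suc n - 1) = (\<Prod>t\<in>{s<..n}. m + s - t) * ((m + s - Suc n) * fact (m + s - Suc n - 1))"
    by (simp add: mult_ac)
  also have "(m + s - Suc n) * fact (m + s - Suc n - 1) = (fact (m + s - n - 1) :: nat)"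
    using Suc.prems by (cases "m + s - Suc n") auto
  finally show ?case using Suc by simp
qed simp

text \<open>The effect of flipping a single position s: the two sides collect the factors of
  \<open>weyl_dim\<close> that contain s, with entry h + s on the left and h - s on the right. Their
  quotient must be the weight of s.\<close>

lemma hook_weight_empty:
  assumes s: "1 \<le> s" "s \<le> n"
  defines "h \<equiv> of_nat (n + 1) :: complex"
  shows "(h + of_nat s) * (\<Prod>t\<in>{1..n} - {s}. (h + of_nat s)\<^sup>2 - (h - of_nat t)\<^sup>2)
     = (h - of_nat s) * (\<Prod>t\<in>{1..n} - {s}. (h - of_nat s)\<^sup>2 - (h - of_nat t)\<^sup>2) * hook_weight (2 * h) {} s"
proof -
  define N where "N = 2 * n + 2"
  have N: "2 * h = of_nat N" by (simp add: h_def N_def)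
  let ?c = "of_nat :: nat \<Rightarrow> complex"
  have cd: "?c a - ?c b = ?c (a - b)" if "b \<le> a" for a b using that by (simp add: of_nat_diff)
  define L1 where "L1 = (\<Prod>t\<in>{1..<s}. (s - t) * (s + t))"
  define L2 where "L2 = (\<Prod>t\<in>{1..<s}. (N - s - t) * (N - s + t))"
  define G1 where "G1 = (\<Prod>t\<in>{s<..n}. s + t)"
  define G2 where "G2 = (\<Prod>t\<in>{s<..n}. N + s - t)"
  define G3 where "G3 = (\<Prod>t\<in>{s<..n}. t - s)"
  define G4 where "G4 = (\<Prod>t\<in>{s<..n}. N - s - t)"
  have l1: "L1 * s = fact (2 * s - 1)" using prod_symmetric_range[of s s] s by (simp add: L1_def mult_2)
  have l2: "L2 * (N - s) * fact (N - 2 * s) = fact (N - 1)"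
    using prod_symmetric_range[of s "N - s"] s by (simp add: L2_def N_def mult_2 algebra_simps) (simp add: numeral_2_eq_2)
  have g1: "G1 * fact (2 * s) = fact (n + s)" unfolding G1_def by (rule prod_increasing_range[OF s(2)])
  have g2: "G2 * fact (n + 1 + s) = fact (N - 1)"
  proof -
    have "N + s - n - 1 = n + 1 + s" by (simp add: N_def)
    then show ?thesis using prod_decreasing_range[OF s(2), of N] by (simp add: G2_def N_def)
  qed
  have g3: "G3 = fact (n - s)" unfolding G3_def by (rule prod_shifted_range[OF s(2)])
  have g4: "G4 * fact (n + 1 - s) = fact (N - 2 * s - 1)"
  proof -
    have "N - 2 * s + s - n - 1 = n + 1 - s" "n < N - 2 * s + s" using s by (simp_all add: N_def)
    moreover have "(\<Prod>t\<in>{s<..n}. N - 2 * s + s - t) = G4" unfolding G4_def using s by (intro prod.cong) (auto simp: N_def)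
    ultimately show ?thesis using prod_decreasing_range[OF s(2), of "N - 2 * s"] by simp
  qed
  \<comment> \<open>Multiplied by \<open>?K\<close>, both sides become the same product of the
    factorials of 2 s, n + 1 + s, n + 1 - s, N - 2 s and N - 1.\<close>
  have key: "(n + 1 + s) * (2 * s * s) * L1 * G1 * G2 = (n + 1 - s) * ((N - s) * (N - 2 * s)) * L2 * G3 * G4"
  proof -
    have e1: "fact (2 * s) = 2 * s * (fact (2 * s - 1) :: nat)" using s by (simp add: fact_reduce)
    have e2: "fact (n + 1 - s) = (n + 1 - s) * (fact (n - s) :: nat)" using s by (simp add: Suc_diff_le)
    have e3: "fact (N - 2 * s) = (N - 2 * s) * (fact (N - 2 * s - 1) :: nat)" using s fact_reduce[of "N - 2 * s", where 'a = nat] by (simp add: N_def)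
    have e4: "fact (n + 1 + s) = (n + 1 + s) * (fact (n + s) :: nat)" by simp
    let ?K = "fact (2 * s) * fact (n + 1 + s) * fact (n + 1 - s) * fact (N - 2 * s) :: nat"
    have "((n + 1 + s) * (2 * s * s) * L1 * G1 * G2) * ?K =
       (n + 1 + s) * (2 * s) * (L1 * s) * (G1 * fact (2 * s)) * (G2 * fact (n + 1 + s)) * (fact (n + 1 - s) * fact (N - 2 * s))"
      by (simp only: mult_ac)
    also have "\<dots> = (2 * s * fact (2 * s - 1)) * ((n + 1 + s) * fact (n + s)) * fact (N - 1) * (fact (n + 1 - s) * fact (N - 2 * s))"
      unfolding l1 g1 g2 by (simp only: mult_ac)
    also have "\<dots> = fact (2 * s) * fact (n + 1 + s) * fact (N - 1) * (fact (n + 1 - s) * fact (N - 2 * s))"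
      unfolding e1[symmetric] e4[symmetric] ..
    finally have A: "((n + 1 + s) * (2 * s * s) * L1 * G1 * G2) * ?K = \<dots>" .
    have "((n + 1 - s) * ((N - s) * (N - 2 * s)) * L2 * G3 * G4) * ?K =
      (L2 * (N - s) * fact (N - 2 * s)) * ((n + 1 - s) * G3) * ((N - 2 * s) * (G4 * fact (n + 1 - s))) * (fact (2 * s) * fact (n + 1 + s))"
      by (simp only: mult_ac)
    also have "\<dots> = fact (N - 1) * fact (n + 1 - s) * fact (N - 2 * s) * (fact (2 * s) * fact (n + 1 + s))"
      unfolding l2 g3 g4 e2[symmetric] e3[symmetric] ..
    finally have B: "((n + 1 - s) * ((N - s) * (N - 2 * s)) * L2 * G3 * G4) * ?K = \<dots>" .
    have "((n + 1 + s) * (2 * s * s) * L1 * G1 * G2) * ?K = ((n + 1 - s) * ((N - s) * (N - 2 * s)) * L2 * G3 * G4) * ?K"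
      unfolding A B by (simp only: mult_ac)
    then show ?thesis by (simp only: mult_cancel2) (auto simp: fact_nonzero)
  qed
  have split: "(\<Prod>t\<in>{1..n} - {s}. f t) = (\<Prod>t\<in>{1..<s}. f t) * (\<Prod>t\<in>{s<..n}. f t)" for f :: "nat \<Rightarrow> complex"
  proof -
    have "{1..n} - {s} = {1..<s} \<union> {s<..n}" using s by auto
    moreover have "(\<Prod>t\<in>{1..<s} \<union> {s<..n}. f t) = (\<Prod>t\<in>{1..<s}. f t) * (\<Prod>t\<in>{s<..n}. f t)"
      by (rule prod.union_disjoint) auto
    ultimately show ?thesis by simp
  qed
  have num: "(h + ?c s)\<^sup>2 - (h - ?c t)\<^sup>2 = (?c s + ?c t) * (?c N + ?c s - ?c t)"
    and den: "(h - ?c s)\<^sup>2 - (h - ?c t)\<^sup>2 = (?c t - ?c s) * (?c N - ?c s - ?c t)" for t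
    unfolding N[symmetric] by (simp_all add: power2_eq_square algebra_simps)
  have P1: "(\<Prod>t\<in>{s<..n}. (h + ?c s)\<^sup>2 - (h - ?c t)\<^sup>2) = ?c (G1 * G2)"
    unfolding num G1_def G2_def of_nat_mult of_nat_prod prod.distrib[symmetric]
    by (intro prod.cong refl) (use s in \<open>auto simp: of_nat_diff N_def\<close>)
  have P2: "(\<Prod>t\<in>{s<..n}. (h - ?c s)\<^sup>2 - (h - ?c t)\<^sup>2) = ?c (G3 * G4)"
    unfolding den G3_def G4_def of_nat_mult of_nat_prod prod.distrib[symmetric]
    by (intro prod.cong refl) (use s in \<open>auto simp: of_nat_diff N_def\<close>)
  have low: "(\<Prod>t\<in>{1..<s}. (h + ?c s)\<^sup>2 - (h - ?c t)\<^sup>2) * ?c L2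
     = (\<Prod>t\<in>{1..<s}. (h - ?c s)\<^sup>2 - (h - ?c t)\<^sup>2) * (\<Prod>t\<in>{1..<s}. 1 - (2 * h)\<^sup>2 / (?c s - ?c t)\<^sup>2) * ?c L1"
  proof -
    have "((h + ?c s)\<^sup>2 - (h - ?c t)\<^sup>2) * ?c ((N - s - t) * (N - s + t)) =
       ((h - ?c s)\<^sup>2 - (h - ?c t)\<^sup>2) * (1 - (2 * h)\<^sup>2 / (?c s - ?c t)\<^sup>2) * ?c ((s - t) * (s + t))" if t: "t \<in> {1..<s}" for t
    proof -
      define S T M where "S = ?c s" and "T = ?c t" and "M = ?c N"
      have "S \<noteq> T" using t by (simp add: S_def T_def)
      then have st: "S - T \<noteq> 0" by simp
      have e: "?c ((N - s - t) * (N - s + t)) = (M - S - T) * (M - S + T)" "?c ((s - t) * (s + t)) = (S - T) * (S + T)"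
        using t s by (simp_all add: of_nat_diff N_def S_def T_def M_def) (simp add: algebra_simps)
      define F where "F = 1 - M\<^sup>2 / (S - T)\<^sup>2"
      have F: "(S - T)\<^sup>2 * F = (S - T)\<^sup>2 - M\<^sup>2"
        using st by (simp add: right_diff_distrib F_def)
      have "(T - S) * (M - S - T) * F * ((S - T) * (S + T)) = (S + T) * (M - S - T) * - ((S - T)\<^sup>2 * F)"
        by (simp add: power2_eq_square algebra_simps)
      also have "\<dots> = (S + T) * (M + S - T) * ((M - S - T) * (M - S + T))"
        unfolding F by (simp add: power2_eq_square algebra_simps)
      finally have eq: "(T - S) * (M - S - T) * F * ((S - T) * (S + T)) = (S + T) * (M + S - T) * ((M - S - T) * (M - S + T))" .
      show ?thesis unfolding num den e N using eq[symmetric] unfolding F_def S_def T_def M_def by (simp only: mult_ac)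
    qed
    then show ?thesis unfolding L1_def L2_def of_nat_prod prod.distrib[symmetric] by (intro prod.cong refl)
  qed
  have L2nz: "?c L2 \<noteq> 0"
    unfolding of_nat_eq_0_iff L2_def using s by (auto simp: N_def)
  have w: "hook_weight (2 * h) {} s * ?c (2 * s * s) = ?c ((N - s) * (N - 2 * s)) * (\<Prod>t\<in>{1..<s}. 1 - (2 * h)\<^sup>2 / (?c s - ?c t)\<^sup>2)"
  proof -
    have "(1 - ?c N / ?c s) * (1 - ?c N / ?c (2 * s)) * ?c (2 * s * s) = (?c N - ?c s) * (?c N - ?c (2 * s))"
      using s by (simp add: field_simps)
    also have "\<dots> = ?c ((N - s) * (N - 2 * s))" using s by (simp add: of_nat_diff N_def)
    finally have eq: "(1 - ?c N / ?c s) * (1 - ?c N / ?c (2 * s)) * ?c (2 * s * s) = ?c ((N - s) * (N - 2 * s))" .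
    have "hook_weight (?c N) {} s = (1 - ?c N / ?c s) * (1 - ?c N / ?c (2 * s)) * (\<Prod>t\<in>{1..<s}. 1 - (?c N)\<^sup>2 / (?c s - ?c t)\<^sup>2)"
      by (simp add: hook_weight_def)
    then show ?thesis unfolding N eq[symmetric] by (simp only: mult_ac)
  qed
  define A where "A = (\<Prod>t\<in>{1..<s}. (h + ?c s)\<^sup>2 - (h - ?c t)\<^sup>2)"
  define B where "B = (\<Prod>t\<in>{1..<s}. (h - ?c s)\<^sup>2 - (h - ?c t)\<^sup>2)"
  define C where "C = (\<Prod>t\<in>{1..<s}. 1 - (2 * h)\<^sup>2 / (?c s - ?c t)\<^sup>2)"
  have hs: "h + ?c s = ?c (n + 1 + s)" "h - ?c s = ?c (n + 1 - s)" using s by (simp_all add: h_def of_nat_diff)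
  have "(?c (n + 1 + s) * (A * ?c (G1 * G2))) * (?c L2 * ?c (2 * s * s)) = B * C * ?c ((n + 1 + s) * (2 * s * s) * L1 * G1 * G2)"
  proof -
    have "(?c (n + 1 + s) * (A * ?c (G1 * G2))) * (?c L2 * ?c (2 * s * s)) = ?c (n + 1 + s) * ?c (G1 * G2) * ?c (2 * s * s) * (A * ?c L2)"
      by (simp only: mult_ac)
    also have "A * ?c L2 = B * C * ?c L1" using low unfolding A_def B_def C_def .
    finally show ?thesis by (simp only: of_nat_mult mult_ac)
  qed
  also have "\<dots> = (?c (n + 1 - s) * (B * ?c (G3 * G4)) * hook_weight (2 * h) {} s) * (?c L2 * ?c (2 * s * s))"
    unfolding key using w unfolding C_def[symmetric] by (simp only: of_nat_mult mult_ac)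
  finally have "?c (n + 1 + s) * (A * ?c (G1 * G2)) = ?c (n + 1 - s) * (B * ?c (G3 * G4)) * hook_weight (2 * h) {} s"
    using L2nz s by (simp only: mult_cancel_right of_nat_eq_0_iff mult_eq_0_iff) auto
  then show ?thesis unfolding split P1 P2 A_def[symmetric] B_def[symmetric] unfolding hs .
qed

definition flip' :: "nat \<Rightarrow> nat set \<Rightarrow> nat \<Rightarrow> nat" where
  "flip' n S t = (if t \<in> S then n + 1 + t else n + 1 - t)"

text \<open>The elements of S are flipped in increasing order. A hook weight looks only at smaller
  elements, so a new maximum s leaves the earlier weights unchanged and contributes exactly its
  own.\<close>

lemma weyl_dim_flip':
  assumes "S \<subseteq> {1..n}"
  shows "weyl_dim n (flip' n S) = weyl_dim n (flip' n {}) * set_weight (of_nat (2 * n + 2)) S"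
proof -
  have "finite S" using assms finite_subset by blast
  then show ?thesis using assms
  proof (induction S rule: finite_linorder_max_induct)
    case empty
    show ?case by (simp add: set_weight_def)
  next
    case (insert s S)
    define h where "h = (of_nat (n + 1) :: complex)"
    let ?c = "of_nat :: nat \<Rightarrow> complex"
    let ?J = "{1..n} - {s}"
    have s: "1 \<le> s" "s \<le> n" "s \<notin> S" and S: "S \<subseteq> {1..<s}" using insert by force+
    have N: "2 * h = ?c (2 * n + 2)" by (simp add: h_def)
    have b: "?c (flip' n X t) = (if t \<in> X then h + ?c t else h - ?c t)" if "t \<le> n" for X t
      using that by (simp add: flip'_def h_def of_nat_diff)
    define \<epsilon> where "\<epsilon> = (\<Prod>k\<in>?J. if s < k then 1 else - 1 :: complex)"
    have D: "weyl_dim n a = (\<Prod>t\<in>?J. ?c (a t)) * \<epsilon> * (\<Prod>(i, j)\<in>pairs ?J. (?c (a i))\<^sup>2 - (?c (a j))\<^sup>2) * (?c (a s) * (\<Prod>t\<in>?J. (?c (a s))\<^sup>2 - (?c (a t))\<^sup>2))" for a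
    proof -
      have ins: "{1..n} = insert s ?J" using s by auto
      have "(\<Prod>(i, j)\<in>pairs (insert s ?J). (?c (a i))\<^sup>2 - (?c (a j))\<^sup>2) = \<epsilon> * (\<Prod>(i, j)\<in>pairs ?J. (?c (a i))\<^sup>2 - (?c (a j))\<^sup>2) * (\<Prod>t\<in>?J. (?c (a s))\<^sup>2 - (?c (a t))\<^sup>2)"
        unfolding \<epsilon>_def by (rule prod_pairs_isolate) auto
      moreover have "(\<Prod>i\<in>insert s ?J. ?c (a i)) = ?c (a s) * (\<Prod>t\<in>?J. ?c (a t))"
        by (rule prod.insert) auto
      ultimately show ?thesis unfolding weyl_dim_def ins[symmetric] by (simp only: mult_ac)
    qed
    define f where "f = (\<lambda>t. 1 - (2 * h)\<^sup>2 / (?c s - ?c t)\<^sup>2)"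
    define g where "g = (\<lambda>t. 1 - (2 * h)\<^sup>2 / (?c s + ?c t)\<^sup>2)"
    define p where "p = (\<lambda>t. (h + ?c s)\<^sup>2 - (?c (flip' n S t))\<^sup>2)"
    define m where "m = (\<lambda>t. (h - ?c s)\<^sup>2 - (?c (flip' n S t))\<^sup>2)"
    define p0 where "p0 = (\<lambda>t. (h + ?c s)\<^sup>2 - (h - ?c t)\<^sup>2)"
    define m0 where "m0 = (\<lambda>t. (h - ?c s)\<^sup>2 - (h - ?c t)\<^sup>2)"
    \<comment> \<open>If t < s has already been flipped, the gain from flipping s changes by g t / f
      t, which is the exchange of s - t for s + t in the weight. Stated without quotients.\<close>
    have tS: "p t * m0 t * f t = m t * p0 t * g t" if t: "t \<in> S" for t
    proof -
      have st: "?c s - ?c t \<noteq> 0" "?c s + ?c t \<noteq> 0" using t S s by (auto simp flip: of_nat_add)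
      have pt: "p t = (?c s - ?c t) * (2 * h + ?c s + ?c t)" "m t = - ((?c s + ?c t) * (2 * h - ?c s + ?c t))"
        "p0 t = (?c s + ?c t) * (2 * h + ?c s - ?c t)" "m0 t = - ((?c s - ?c t) * (2 * h - ?c s - ?c t))"
        using t S s b[of t S] by (auto simp: p_def m_def p0_def m0_def power2_eq_square algebra_simps)
      define u v z where "u = ?c s - ?c t" and "v = ?c s + ?c t" and "z = 2 * h"
      have pt': "p t = u * (z + v)" "m t = - (v * (z - u))" "p0 t = v * (z + u)" "m0 t = - (u * (z - v))"
        unfolding pt u_def v_def z_def by (simp_all add: algebra_simps)
      have F: "u\<^sup>2 * f t = u\<^sup>2 - z\<^sup>2" "v\<^sup>2 * g t = v\<^sup>2 - z\<^sup>2"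
        using st by (simp_all add: f_def g_def u_def v_def z_def right_diff_distrib)
      have "p t * m0 t * f t = - ((z + v) * (z - v) * (u\<^sup>2 * f t))"
        unfolding pt' by (simp add: power2_eq_square algebra_simps)
      also have "\<dots> = - ((z - u) * (z + u) * (v\<^sup>2 * g t))"
        unfolding F by (simp add: power2_eq_square algebra_simps)
      also have "\<dots> = m t * p0 t * g t"
        unfolding pt' by (simp add: power2_eq_square algebra_simps)
      finally show ?thesis .
    qed
    have m0nz: "m0 t \<noteq> 0" if "t \<in> ?J" for t
    proof -
      have "m0 t = (?c t - ?c s) * ?c (2 * n + 2 - s - t)"
        using that s by (simp add: m0_def h_def of_nat_diff power2_eq_square algebra_simps)
      then show ?thesis using that s by (simp del: of_nat_diff) 
    qed
    \<comment> \<open>A zero would mean 2 n + 2 = s - t, impossible for s <= n.\<close>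
    have fnz: "f t \<noteq> 0" if "t \<in> S" for t
    proof
      assume "f t = 0"
      moreover have "?c s - ?c t \<noteq> 0" using that s S by auto
      ultimately have "(2 * h)\<^sup>2 = (?c s - ?c t)\<^sup>2" by (simp add: f_def field_simps)
      then have "(?c (2 * n + 2))\<^sup>2 = (?c (s - t))\<^sup>2" using that S unfolding N by (auto simp: of_nat_diff)
      then have "(2 * n + 2)\<^sup>2 = (s - t)\<^sup>2" by (metis of_nat_power of_nat_eq_iff)
      then have "2 * n + 2 = s - t" by (simp only: power2_eq_iff_nonneg zero_le)
      then show False using s by linarith
    qed
    have SJ: "S \<subseteq> ?J" using S s by force
    have split: "(\<Prod>t\<in>?J. k t) = (\<Prod>t\<in>?J - S. k t) * (\<Prod>t\<in>S. k t)" for k :: "nat \<Rightarrow> complex"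
      by (rule prod.subset_diff[OF SJ]) simp
    have base: "(h + ?c s) * (\<Prod>t\<in>?J. p0 t) = (h - ?c s) * (\<Prod>t\<in>?J. m0 t) * hook_weight (2 * h) {} s"
      unfolding p0_def m0_def h_def by (rule hook_weight_empty[OF s(1,2)])
    have outside: "(\<Prod>t\<in>?J - S. p t) = (\<Prod>t\<in>?J - S. p0 t)" "(\<Prod>t\<in>?J - S. m t) = (\<Prod>t\<in>?J - S. m0 t)"
      by (intro prod.cong refl; simp add: p_def m_def p0_def m0_def b)+
    have inside: "(\<Prod>t\<in>S. p t) * (\<Prod>t\<in>S. m0 t) * (\<Prod>t\<in>S. f t) = (\<Prod>t\<in>S. m t) * (\<Prod>t\<in>S. p0 t) * (\<Prod>t\<in>S. g t)"
      unfolding prod.distrib[symmetric] by (intro prod.cong refl tS)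
    have hw: "hook_weight (2 * h) (insert s S) s * (\<Prod>t\<in>S. f t) = hook_weight (2 * h) {} s * (\<Prod>t\<in>S. g t)"
    proof -
      have "{1..<s} - insert s S = {1..<s} - S" "insert s S \<inter> {1..<s} = S" using S by auto
      moreover have "(\<Prod>t\<in>{1..<s}. f t) = (\<Prod>t\<in>{1..<s} - S. f t) * (\<Prod>t\<in>S. f t)"
        by (rule prod.subset_diff[OF S]) simp
      ultimately show ?thesis unfolding hook_weight_def f_def[symmetric] g_def[symmetric] by simp
    qed
    have nz: "(\<Prod>t\<in>S. m0 t) * (\<Prod>t\<in>S. f t) \<noteq> 0"
    proof -
      have "\<forall>t\<in>S. m0 t \<noteq> 0" using m0nz SJ by blast
      then show ?thesis using fnz insert.hyps(1) by (simp add: prod_zero_iff)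
    qed
    have main: "(h + ?c s) * (\<Prod>t\<in>?J. p t) = (h - ?c s) * (\<Prod>t\<in>?J. m t) * hook_weight (2 * h) (insert s S) s"
    proof -
      have "((h + ?c s) * (\<Prod>t\<in>?J. p t)) * ((\<Prod>t\<in>S. m0 t) * (\<Prod>t\<in>S. f t))
         = (h + ?c s) * (\<Prod>t\<in>?J - S. p0 t) * ((\<Prod>t\<in>S. p t) * (\<Prod>t\<in>S. m0 t) * (\<Prod>t\<in>S. f t))"
        unfolding split[of p] outside by (simp only: mult_ac)
      also have "\<dots> = ((h + ?c s) * (\<Prod>t\<in>?J. p0 t)) * ((\<Prod>t\<in>S. m t) * (\<Prod>t\<in>S. g t))"
        unfolding inside split[of p0] by (simp only: mult_ac)
      also have "\<dots> = (h - ?c s) * (\<Prod>t\<in>?J - S. m t) * (\<Prod>t\<in>S. m0 t) * (\<Prod>t\<in>S. m t) * (hook_weight (2 * h) {} s * (\<Prod>t\<in>S. g t))"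
        unfolding base split[of m0] outside by (simp only: mult_ac)
      also have "\<dots> = ((h - ?c s) * (\<Prod>t\<in>?J. m t) * hook_weight (2 * h) (insert s S) s) * ((\<Prod>t\<in>S. m0 t) * (\<Prod>t\<in>S. f t))"
        unfolding hw[symmetric] split[of m] by (simp only: mult_ac)
      finally show ?thesis using nz by (simp only: mult_cancel_right) simp
    qed
    have same: "flip' n (insert s S) t = flip' n S t" if "t \<in> ?J" for t using that by (simp add: flip'_def)
    have "weyl_dim n (flip' n (insert s S)) = (\<Prod>t\<in>?J. ?c (flip' n S t)) * \<epsilon> * (\<Prod>(i, j)\<in>pairs ?J. (?c (flip' n S i))\<^sup>2 - (?c (flip' n S j))\<^sup>2) * ((h + ?c s) * (\<Prod>t\<in>?J. p t))"
    proof -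
      have "(\<Prod>t\<in>?J. ?c (flip' n (insert s S) t)) = (\<Prod>t\<in>?J. ?c (flip' n S t))"
        by (intro prod.cong refl) (simp only: same)
      moreover have "(\<Prod>(i, j)\<in>pairs ?J. (?c (flip' n (insert s S) i))\<^sup>2 - (?c (flip' n (insert s S) j))\<^sup>2) = (\<Prod>(i, j)\<in>pairs ?J. (?c (flip' n S i))\<^sup>2 - (?c (flip' n S j))\<^sup>2)"
        by (intro prod.cong refl) (auto simp: pairs_def same)
      moreover have "(\<Prod>t\<in>?J. (?c (flip' n (insert s S) s))\<^sup>2 - (?c (flip' n (insert s S) t))\<^sup>2) = (\<Prod>t\<in>?J. p t)"
        using b[of s "insert s S"] s by (intro prod.cong refl) (simp add: same p_def)
      moreover have "?c (flip' n (insert s S) s) = h + ?c s" using b[of s "insert s S"] s by simp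
      ultimately show ?thesis unfolding D[of "flip' n (insert s S)"] by (simp only:)
    qed
    also have "\<dots> = weyl_dim n (flip' n S) * hook_weight (2 * h) (insert s S) s"
    proof -
      have "?c (flip' n S s) = h - ?c s" using b[of s S] s by simp
      then show ?thesis unfolding main D[of "flip' n S"] m_def by (simp only: mult_ac)
    qed
    also have "weyl_dim n (flip' n S) = weyl_dim n (flip' n {}) * set_weight (2 * h) S"
      unfolding N by (rule insert.IH) (use insert.prems in auto)
    also have "weyl_dim n (flip' n {}) * set_weight (2 * h) S * hook_weight (2 * h) (insert s S) s = weyl_dim n (flip' n {}) * set_weight (2 * h) (insert s S)"
    proof -
      have "hook_weight (2 * h) (insert s S) t = hook_weight (2 * h) S t" if "t \<in> S" for t
      proof -
        have "{1..<t} - insert s S = {1..<t} - S" "insert s S \<inter> {1..<t} = S \<inter> {1..<t}" using that S by auto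
        then show ?thesis by (simp add: hook_weight_def)
      qed
      then show ?thesis unfolding set_weight_def using insert.hyps(1) s(3) by simp
    qed
    finally show ?case unfolding N .
  qed
qed

lemma weyl_dim_reverse: "weyl_dim n (\<lambda>i. a (n + 1 - i)) = (-1) ^ card (pairs {1..n}) * weyl_dim n a"
proof -
  let ?c = "of_nat :: nat \<Rightarrow> complex"
  have "(\<Prod>i=1..n. ?c (a (n + 1 - i))) = (\<Prod>i=1..n. ?c (a i))"
    by (rule prod.reindex_bij_witness[of _ "\<lambda>i. n + 1 - i" "\<lambda>i. n + 1 - i"]) auto
  moreover have "(\<Prod>(i, j)\<in>pairs {1..n}. (?c (a (n + 1 - i)))\<^sup>2 - (?c (a (n + 1 - j)))\<^sup>2) = (\<Prod>(i, j)\<in>pairs {1..n}. (-1) * ((?c (a i))\<^sup>2 - (?c (a j))\<^sup>2))"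
    by (rule prod.reindex_bij_witness[of _ "\<lambda>(i, j). (n + 1 - j, n + 1 - i)" "\<lambda>(i, j). (n + 1 - j, n + 1 - i)"]) (auto simp: pairs_def)
  ultimately show ?thesis unfolding weyl_dim_def by (simp only: prod.distrib case_prod_unfold prod_constant mult_ac)
qed

text \<open>The change of index s = n + 1 - r turns the exponent of T into the sum of S. The sign
  from reversing the positions occurs in both dimensions of the quotient and cancels.\<close>

theorem qfact_power_cong:
  "fps_cong n (qfact n ^ (2 * n\<^sup>2 + n)) (\<Sum>S\<in>Pow {1..n}. fps_const ((-1) ^ card S * set_weight (of_nat (2 * n + 2)) S) * fps_X ^ (\<Sum>S))"
proof -
  let ?r = "\<lambda>i. n + 1 - i"
  have inj: "inj_on ?r {1..n}" by (auto simp: inj_on_def)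
  have "(\<Sum>R\<in>Pow {1..n}. fps_const ((-1) ^ card R * (weyl_dim n (flip n R) / weyl_dim n (\<lambda>i. i))) * fps_X ^ (\<Sum>r\<in>R. n + 1 - r))
     = (\<Sum>S\<in>Pow {1..n}. fps_const ((-1) ^ card S * set_weight (of_nat (2 * n + 2)) S) * fps_X ^ (\<Sum>S))"
  proof (rule sum.reindex_bij_witness[of _ "image ?r" "image ?r"])
    fix R assume R: "R \<in> Pow {1..n}"
    show "?r ` ?r ` R = R" using R by (force simp: image_image)
    show rR: "?r ` R \<in> Pow {1..n}" using R by force
    have injR: "inj_on ?r R" using inj R by (auto intro: inj_on_subset)
    have sm: "(\<Sum>s\<in>?r ` R. s) = (\<Sum>r\<in>R. n + 1 - r)" using injR by (simp add: sum.reindex)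
    have cd: "card (?r ` R) = card R" using injR by (rule card_image)
    have wc: "weyl_dim n a = weyl_dim n a'" if "\<And>i. i \<in> {1..n} \<Longrightarrow> a i = a' i" for a a'
      unfolding weyl_dim_def using that by (intro arg_cong2[of _ _ _ _ "(*)"] prod.cong refl) (auto simp: pairs_def)
    have "weyl_dim n (flip n R) = weyl_dim n (\<lambda>i. flip' n (?r ` R) (n + 1 - i))"
    proof (rule wc)
      fix i assume i: "i \<in> {1..n}"
      have "n + 1 - i \<in> ?r ` R \<longleftrightarrow> i \<in> R"
        using inj_on_image_mem_iff[OF inj i, of R] R by auto
      moreover have "n + 1 + (n + 1 - i) = 2 * n + 2 - i" "n + 1 - (n + 1 - i) = i" using i by auto
      ultimately show "flip n R i = flip' n (?r ` R) (n + 1 - i)" by (simp only: flip_def flip'_def)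
    qed
    then have A: "weyl_dim n (flip n R) = (-1) ^ card (pairs {1..n}) * weyl_dim n (flip' n (?r ` R))"
      by (simp only: weyl_dim_reverse)
    have "weyl_dim n (\<lambda>i. i) = weyl_dim n (\<lambda>i. flip' n {} (n + 1 - i))"
      by (rule wc) (auto simp: flip'_def)
    then have B: "weyl_dim n (\<lambda>i. i) = (-1) ^ card (pairs {1..n}) * weyl_dim n (flip' n {})"
      by (simp only: weyl_dim_reverse)
    have "weyl_dim n (flip' n {}) \<noteq> 0" using B weyl_dim_id_nz[of n] by auto
    then have "weyl_dim n (flip n R) / weyl_dim n (\<lambda>i. i) = set_weight (of_nat (2 * n + 2)) (?r ` R)"
      unfolding A B using weyl_dim_flip'[of "?r ` R" n] rR by simp
    then show "fps_const ((-1) ^ card (?r ` R) * set_weight (of_nat (2 * n + 2)) (?r ` R)) * fps_X ^ (\<Sum>(?r ` R))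
      = fps_const ((-1) ^ card R * (weyl_dim n (flip n R) / weyl_dim n (\<lambda>i. i))) * fps_X ^ (\<Sum>r\<in>R. n + 1 - r)"
      unfolding cd using sm by simp
  next
    fix S assume S: "S \<in> Pow {1..n}"
    show "?r ` ?r ` S = S" using S by (force simp: image_image)
    show "?r ` S \<in> Pow {1..n}" using S by force
  qed
  then show ?thesis using macdonald_C_dimensions[of n] by simp
qed

subsection \<open>Adding a principal hook\<close>

text \<open>\<open>wrap s l\<close> puts a first row of \<open>s + 1\<close> boxes and a first column of \<open>s\<close> boxes around \<open>l\<close>.\<close>

definition wrap :: "nat \<Rightarrow> nat list \<Rightarrow> nat list" where
  "wrap s l = (s + 1) # map Suc l @ replicate (s - 1 - length l) 1"

lemma part_0 [simp]: "part l 0 = 0" by (simp add: part_def)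

lemma part_pos_iff: "is_partition l \<Longrightarrow> 1 \<le> i \<Longrightarrow> 0 < part l i \<longleftrightarrow> i \<le> length l"
  by (auto simp: part_def is_partition_def) (metis One_nat_def Suc_le_eq Suc_pred nth_mem gr0I less_le_trans)

lemma partition_eqI:
  assumes "is_partition l" "is_partition l'" "\<And>i. 1 \<le> i \<Longrightarrow> part l i = part l' i"
  shows "l = l'"
proof (rule nth_equalityI)
  have *: "i \<le> length l \<longleftrightarrow> i \<le> length l'" if "1 \<le> i" for i
    using part_pos_iff[OF assms(1) that] part_pos_iff[OF assms(2) that] assms(3)[OF that] by simp
  show len: "length l = length l'"
  proof (rule antisym)
    show "length l \<le> length l'" using *[of "length l"] by (cases "length l") auto
    show "length l' \<le> length l" using *[of "length l'"] by (cases "length l'") auto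
  qed
  fix i assume "i < length l"
  then show "l ! i = l' ! i" using assms(3)[of "Suc i"] len by (simp add: part_def)
qed

lemma le_part_iff_le_durfee:
  assumes "is_partition l" "1 \<le> i"
  shows "i \<le> part l i \<longleftrightarrow> i \<le> durfee l"
proof
  assume "i \<le> durfee l"
  then show "i \<le> part l i" using part_antimono[OF assms, of "durfee l"] durfee_le_part[of l] by linarith
qed (rule le_durfee)

lemma part_conjugate_eqI:
  assumes "is_partition l" "1 \<le> j" "\<And>i. 1 \<le> i \<Longrightarrow> j \<le> part l i \<longleftrightarrow> i \<le> m"
  shows "part (conjugate l) j = m"
proof -
  have *: "i \<le> part (conjugate l) j \<longleftrightarrow> i \<le> m" if "1 \<le> i" for i
    using column_iff[OF assms(1) that assms(2)] assms(3)[OF that] by simp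
  show ?thesis
  proof (rule antisym)
    show "part (conjugate l) j \<le> m" using *[of "part (conjugate l) j"] by (cases "part (conjugate l) j") auto
    show "m \<le> part (conjugate l) j" using *[of m] by (cases m) auto
  qed
qed

lemma durfee_eqI:
  assumes "is_partition l" "\<And>i. 1 \<le> i \<Longrightarrow> i \<le> part l i \<longleftrightarrow> i \<le> m"
  shows "durfee l = m"
proof (rule antisym)
  show "durfee l \<le> m" using le_part_iff_le_durfee[OF assms(1), of "durfee l"] assms(2)[of "durfee l"] by (cases "durfee l") auto
  show "m \<le> durfee l" using le_part_iff_le_durfee[OF assms(1), of m] assms(2)[of m] by (cases m) auto
qed

lemma hook_length_formula:
  assumes l: "is_partition l" and s: "(i, j) \<in> ferrers l"
  shows "hook_length l (i, j) + i + j = part l i + part (conjugate l) j + 1"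
proof -
  have ij: "1 \<le> i" "1 \<le> j" "j \<le> part l i" using s by (auto simp: ferrers_def)
  then have ij': "i \<le> part (conjugate l) j" using column_iff[OF l] by blast
  have "{t \<in> ferrers l. (fst t = fst (i, j) \<and> snd t \<ge> snd (i, j)) \<or> (snd t = snd (i, j) \<and> fst t \<ge> fst (i, j))}
     = Pair i ` {j..part l i} \<union> (\<lambda>k. (k, j)) ` {i<..part (conjugate l) j}"
    using ij column_iff[OF l _ ij(2)] by (auto simp: ferrers_alt image_iff)
  moreover have "Pair i ` {j..part l i} \<inter> (\<lambda>k. (k, j)) ` {i<..part (conjugate l) j} = {}" by auto
  ultimately have "hook_length l (i, j) = (Suc (part l i) - j) + (part (conjugate l) j - i)"
    unfolding hook_length_def by (simp add: card_Un_disjoint card_image inj_on_def)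
  then show ?thesis using ij ij' by simp
qed

text \<open>The new hook has s boxes to the right of its corner and s - 1 below it; these are
  exactly the bounds within which l fits.\<close>

locale wrapping =
  fixes s :: nat and l :: "nat list"
  assumes l: "is_partition l" and len: "length l < s" and part1: "part l 1 \<le> s"
begin

lemma s_pos: "1 \<le> s" using len by simp

lemma length_wrap: "length (wrap s l) = s" using len by (simp add: wrap_def)

lemma part_wrap_1: "part (wrap s l) (Suc 0) = s + 1"
  by (simp add: part_def wrap_def)

lemma part_wrap_Suc: "1 \<le> i \<Longrightarrow> part (wrap s l) (Suc i) = (if i < s then Suc (part l i) else 0)"
proof -
  assume i: "1 \<le> i"
  have "wrap s l ! i = Suc (part l i)" if "i < s"
  proof -
    have "wrap s l ! i = (map Suc l @ replicate (s - 1 - length l) 1) ! (i - 1)"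
      using i by (simp add: wrap_def nth_Cons')
    also have "\<dots> = Suc (part l i)"
      using i that len by (auto simp: nth_append part_def)
    finally show ?thesis .
  qed
  then show ?thesis using i unfolding part_def[of "wrap s l"] length_wrap by auto
qed

lemma is_partition_wrap: "is_partition (wrap s l)"
proof -
  have "x \<le> s + 1" if "x \<in> set (map Suc l @ replicate (s - 1 - length l) 1)" for x
  proof -
    have "y \<le> s" if y: "y \<in> set l" for y
    proof -
      obtain k where k: "k < length l" "y = l ! k" using y by (auto simp: in_set_conv_nth)
      then have "part l (Suc k) = y" by (simp add: part_def)
      then show ?thesis using part_antimono[OF l, of 1 "Suc k"] part1 by simp
    qed
    then show ?thesis using that s_pos by auto
  qed
  moreover have "sorted_wrt (\<ge>) (replicate k (1 :: nat))" for k by (induction k) auto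
  then have "sorted_wrt (\<ge>) (map Suc l @ replicate (s - 1 - length l) 1)"
    using l by (auto simp: is_partition_def sorted_wrt_append sorted_wrt_map)
  moreover have "0 \<notin> set (wrap s l)" by (auto simp: wrap_def)
  ultimately show ?thesis unfolding is_partition_def by (auto simp: wrap_def)
qed

lemma durfee_wrap: "durfee (wrap s l) = Suc (durfee l)"
proof (rule durfee_eqI[OF is_partition_wrap])
  fix i :: nat assume "1 \<le> i"
  then obtain k where i: "i = Suc k" by (cases i) auto
  show "i \<le> part (wrap s l) i \<longleftrightarrow> i \<le> Suc (durfee l)"
  proof (cases "k = 0")
    case False
    have "k \<le> part l k \<Longrightarrow> k < s"
      using False len part_pos_iff[OF l, of k] by (cases "part l k") auto
    then show ?thesis using False le_part_iff_le_durfee[OF l, of k] i by (auto simp: part_wrap_Suc)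
  qed (simp add: i part_wrap_1)
qed

lemma conjugate_wrap_1: "part (conjugate (wrap s l)) (Suc 0) = s"
proof (rule part_conjugate_eqI[OF is_partition_wrap])
  fix i :: nat assume "1 \<le> i"
  then show "Suc 0 \<le> part (wrap s l) i \<longleftrightarrow> i \<le> s"
    using part_pos_iff[OF is_partition_wrap, of i] length_wrap by (simp add: Suc_le_eq)
qed simp

lemma conjugate_wrap_Suc:
  assumes j: "1 \<le> j"
  shows "part (conjugate (wrap s l)) (Suc j) = (if j \<le> s then Suc (part (conjugate l) j) else 0)"
proof (rule part_conjugate_eqI[OF is_partition_wrap])
  fix i :: nat assume "1 \<le> i"
  then obtain k where i: "i = Suc k" by (cases i) auto
  show "Suc j \<le> part (wrap s l) i \<longleftrightarrow> i \<le> (if j \<le> s then Suc (part (conjugate l) j) else 0)"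
  proof (cases "k = 0")
    case False
    then have k: "1 \<le> k" by simp
    have 1: "j \<le> part l k \<longleftrightarrow> k \<le> part (conjugate l) j" by (rule column_iff[OF l k j])
    have 2: "j \<le> part l k \<Longrightarrow> k < s" using j len part_pos_iff[OF l k] by auto
    have 3: "j \<le> part l k \<Longrightarrow> j \<le> s" using part_antimono[OF l, of 1 k] k part1 by simp
    show ?thesis using 1 2 3 k by (auto simp: i part_wrap_Suc)
  qed (simp add: i part_wrap_1)
qed simp

text \<open>At i = 1 the condition reads s + 1 = s + 1. At later indices up to the Durfee size,
  wrapping adds one to both sides of the condition for l.\<close>

lemma wrap_in_DD_iff: "wrap s l \<in> DD \<longleftrightarrow> l \<in> DD"
proof -
  have "(\<forall>i. 1 \<le> i \<and> i \<le> Suc (durfee l) \<longrightarrow> part (wrap s l) i = part (conjugate (wrap s l)) i + 1)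
    \<longleftrightarrow> (\<forall>i. 1 \<le> i \<and> i \<le> durfee l \<longrightarrow> part l i = part (conjugate l) i + 1)" (is "(\<forall>i. ?P i) \<longleftrightarrow> (\<forall>i. ?Q i)")
  proof -
    have "?P 0" by simp
    moreover have "?P (Suc 0)" by (simp add: part_wrap_1 conjugate_wrap_1)
    moreover have "?P (Suc i) \<longleftrightarrow> ?Q i" if i: "1 \<le> i" for i
    proof (cases "i \<le> durfee l")
      case True
      then have "i \<le> part l i" using le_part_iff_le_durfee[OF l i] by simp
      then have "i < s" using i len part_pos_iff[OF l i] by auto
      then show ?thesis using i by (simp add: part_wrap_Suc conjugate_wrap_Suc)
    qed simp
    moreover have "?Q 0" by simp
    ultimately show ?thesis by (metis One_nat_def Suc_le_eq not0_implies_Suc zero_less_Suc neq0_conv)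
  qed
  then show ?thesis using l is_partition_wrap by (simp add: DD_def durfee_wrap)
qed

lemma ferrers_wrap:
  "ferrers (wrap s l) = {(1, 1)} \<union> (\<lambda>j. (1, Suc j)) ` {1..s} \<union> (\<lambda>i. (Suc i, 1)) ` {1..<s} \<union> (\<lambda>(i, j). (Suc i, Suc j)) ` ferrers l"
proof (rule set_eqI)
  fix b :: "nat \<times> nat"
  obtain i j where b: "b = (i, j)" by force
  have sh: "(i, j) \<in> (\<lambda>(i, j). (Suc i, Suc j)) ` ferrers l \<longleftrightarrow> (\<exists>i' j'. i = Suc i' \<and> j = Suc j' \<and> (i', j') \<in> ferrers l)" by force
  have r: "(i, j) \<in> (\<lambda>j. (1, Suc j)) ` {1..s} \<longleftrightarrow> i = 1 \<and> 2 \<le> j \<and> j \<le> s + 1"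
    by (cases j) (auto simp: image_iff)
  have c: "(i, j) \<in> (\<lambda>i. (Suc i, 1)) ` {1..<s} \<longleftrightarrow> j = 1 \<and> 2 \<le> i \<and> i \<le> s"
    by (cases i) (auto simp: image_iff)
  show "b \<in> ferrers (wrap s l) \<longleftrightarrow> b \<in> {(1, 1)} \<union> (\<lambda>j. (1, Suc j)) ` {1..s} \<union> (\<lambda>i. (Suc i, 1)) ` {1..<s} \<union> (\<lambda>(i, j). (Suc i, Suc j)) ` ferrers l"
  proof (cases "i \<le> 1 \<or> j = 0")
    case True
    then consider "i = 0" | "i = 1" | "j = 0" by linarith
    then show ?thesis
    proof cases
      case 2
      then show ?thesis unfolding b Un_iff sh r c by (auto simp: ferrers_alt part_wrap_1)
    qed (auto simp: b sh r c ferrers_alt)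
  next
    case False
    then obtain k m where km: "i = Suc k" "1 \<le> k" "j = Suc m" by (cases i; cases j) auto
    have "1 \<le> m \<Longrightarrow> m \<le> part l k \<Longrightarrow> k < s" using km len part_pos_iff[OF l, of k] by auto
    then show ?thesis unfolding b Un_iff sh r c using km by (auto simp: ferrers_alt part_wrap_Suc)
  qed
qed

lemma finite_ferrers: "finite (ferrers l)"
proof -
  have "ferrers l = (SIGMA i:{1..length l}. {1..part l i})" by (auto simp: ferrers_def)
  then show ?thesis by simp
qed

lemma prod_ferrers_wrap:
  fixes f :: "nat \<times> nat \<Rightarrow> 'a :: comm_monoid_mult"
  shows "(\<Prod>b\<in>ferrers (wrap s l). f b) = f (1, 1) * (\<Prod>j=1..s. f (1, Suc j)) * (\<Prod>i\<in>{1..<s}. f (Suc i, 1)) * (\<Prod>(i, j)\<in>ferrers l. f (Suc i, Suc j))"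
proof -
  let ?A = "(\<lambda>j. (1::nat, Suc j)) ` {1..s}" and ?B = "(\<lambda>i. (Suc i, 1::nat)) ` {1..<s}" and ?C = "(\<lambda>(i, j). (Suc i, Suc j)) ` ferrers l"
  have C: "(i, j) \<in> ?C \<Longrightarrow> 2 \<le> i \<and> 2 \<le> j" for i j by (auto simp: ferrers_def)
  have "(\<Prod>b\<in>ferrers (wrap s l). f b) = prod f ({(1, 1)} \<union> ?A \<union> ?B) * prod f ?C"
    unfolding ferrers_wrap by (rule prod.union_disjoint) (use C finite_ferrers in force)+
  also have "prod f ({(1, 1)} \<union> ?A \<union> ?B) = prod f ({(1, 1)} \<union> ?A) * prod f ?B"
    by (rule prod.union_disjoint) auto
  also have "prod f ({(1, 1)} \<union> ?A) = prod f {(1, 1)} * prod f ?A"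
    by (rule prod.union_disjoint) auto
  also have "prod f ?A = (\<Prod>j=1..s. f (1, Suc j))" by (subst prod.reindex) (auto simp: inj_on_def)
  also have "prod f ?B = (\<Prod>i\<in>{1..<s}. f (Suc i, 1))" by (subst prod.reindex) (auto simp: inj_on_def)
  also have "prod f ?C = (\<Prod>(i, j)\<in>ferrers l. f (Suc i, Suc j))"
    by (subst prod.reindex) (auto simp: inj_on_def case_prod_unfold)
  finally show ?thesis by simp
qed

lemma hook_wrap_inner:
  assumes "(i, j) \<in> ferrers l"
  shows "hook_length (wrap s l) (Suc i, Suc j) = hook_length l (i, j)"
proof -
  have ij: "1 \<le> i" "1 \<le> j" "j \<le> part l i" using assms by (auto simp: ferrers_def)
  have "i < s" using ij len part_pos_iff[OF l, of i] by auto
  have "j \<le> s" using ij part_antimono[OF l, of 1 i] part1 by simp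
  have "(Suc i, Suc j) \<in> ferrers (wrap s l)" unfolding ferrers_wrap using assms by force
  from hook_length_formula[OF is_partition_wrap this] hook_length_formula[OF l assms]
  show ?thesis using ij \<open>i < s\<close> \<open>j \<le> s\<close> by (simp add: part_wrap_Suc conjugate_wrap_Suc)
qed

lemma hook_wrap_corner: "hook_length (wrap s l) (1, 1) = 2 * s"
proof -
  have "(1, 1) \<in> ferrers (wrap s l)" unfolding ferrers_wrap by simp
  from hook_length_formula[OF is_partition_wrap this] show ?thesis by (simp add: part_wrap_1 conjugate_wrap_1)
qed

text \<open>Written as s plus a term that depends on l alone, the form in which
  \<open>dd_of_maya\<close> evaluates the product over the row.\<close>

lemma hook_wrap_row:
  assumes "1 \<le> j" "j \<le> s"
  shows "int (hook_length (wrap s l) (1, Suc j)) = int s + (int (part (conjugate l) j) - int j + 1)"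
proof -
  have "(1, Suc j) \<in> ferrers (wrap s l)" unfolding ferrers_wrap using assms by auto
  from hook_length_formula[OF is_partition_wrap this] show ?thesis using assms by (simp add: part_wrap_1 conjugate_wrap_Suc)
qed

lemma hook_wrap_column:
  assumes "1 \<le> i" "i < s"
  shows "int (hook_length (wrap s l) (Suc i, 1)) = int s + (int (part l i) - int i)"
proof -
  have "(Suc i, 1) \<in> ferrers (wrap s l)" unfolding ferrers_wrap using assms by auto
  from hook_length_formula[OF is_partition_wrap this] show ?thesis using assms by (simp add: part_wrap_Suc conjugate_wrap_1)
qed

lemma sum_list_wrap: "sum_list (wrap s l) = sum_list l + 2 * s"
proof -
  have "sum_list (map Suc l) = sum_list l + length l" by (induction l) auto
  then show ?thesis using len by (simp add: wrap_def sum_list_replicate)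
qed

end

section \<open>Removing the outermost principal hook\<close>

lemma partition_decompose:
  assumes "sorted_wrt (\<ge>) xs" "0 \<notin> set xs"
  shows "xs = map Suc (map (\<lambda>x. x - 1) (filter (\<lambda>x. 1 < x) xs)) @ replicate (length xs - length (filter (\<lambda>x. 1 < x) xs)) 1"
  using assms
proof (induction xs)
  case (Cons x xs)
  show ?case
  proof (cases "1 < x")
    case False
    then have x: "x = 1" using Cons.prems by auto
    then have "\<forall>y\<in>set xs. y = 1" using Cons.prems by (auto simp: le_Suc_eq)
    then have "filter (\<lambda>x. 1 < x) xs = []" "xs = replicate (length xs) 1"
      by (auto simp: filter_empty_conv) (metis replicate_length_same)
    then show ?thesis using x by simp
  qed (use Cons in \<open>auto simp: Suc_diff_le length_filter_le\<close>)
qed simp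

lemma DD_unwrap:
  assumes "l \<in> DD" "l \<noteq> []"
  shows "\<exists>s l'. wrapping s l' \<and> l = wrap s l' \<and> l' \<in> DD"
proof -
  have l: "is_partition l" using assms by (simp add: DD_def)
  define s where "s = length l"
  have s: "s \<ge> 1" using assms(2) by (simp add: s_def Suc_le_eq)
  \<comment> \<open>The Durfee size is positive, so the defining condition of \<open>DD\<close>
    applies at i = 1: the first row is one box longer than the first column.\<close>
  have p1: "1 \<le> part l 1" using part_pos_iff[OF l, of 1] s by (simp add: s_def)
  then have "1 \<le> durfee l" by (rule le_durfee)
  then have "part l 1 = part (conjugate l) 1 + 1" using assms(1) by (auto simp: DD_def)
  moreover have "part (conjugate l) 1 = s"
  proof (rule part_conjugate_eqI[OF l])
    fix i :: nat assume "1 \<le> i"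
    then show "1 \<le> part l i \<longleftrightarrow> i \<le> s" using part_pos_iff[OF l, of i] by (simp add: s_def Suc_le_eq)
  qed simp
  ultimately have hd: "part l 1 = s + 1" by simp
  obtain x xs where lx: "l = x # xs" using assms(2) by (cases l) auto
  have x: "x = s + 1" using hd lx by (simp add: part_def)
  define l' where "l' = map (\<lambda>x. x - 1) (filter (\<lambda>x. 1 < x) xs)"
  have xs: "sorted_wrt (\<ge>) xs" "0 \<notin> set xs" "\<forall>y\<in>set xs. y \<le> x" using l lx by (auto simp: is_partition_def)
  have len: "length l' \<le> length xs" by (simp add: l'_def)
  have eq: "l = wrap s l'"
  proof -
    have "xs = map Suc l' @ replicate (length xs - length l') 1"
      using partition_decompose[OF xs(1,2)] by (simp only: l'_def length_map)
    moreover have "s - 1 = length xs" by (simp add: s_def lx)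
    ultimately have "wrap s l' = (s + 1) # xs" by (simp only: wrap_def)
    then show ?thesis by (simp only: lx x)
  qed
  have l': "is_partition l'"
    unfolding is_partition_def
  proof
    show "sorted_wrt (\<ge>) l'"
      unfolding l'_def sorted_wrt_map
      by (rule sorted_wrt_mono_rel[OF _ sorted_wrt_filter[OF xs(1)]]) auto
    show "0 \<notin> set l'" by (auto simp: l'_def)
  qed
  have "wrapping s l'"
  proof
    show "length l' < s" using len by (simp add: s_def lx)
    show "part l' 1 \<le> s"
    proof (cases l')
      case (Cons y ys)
      then have "y \<in> set l'" by simp
      then have "y + 1 \<in> set xs" by (auto simp: l'_def)
      then show ?thesis using xs(3) x Cons by (auto simp: part_def)
    qed (simp add: part_def)
  qed (rule l')
  moreover from this have "l' \<in> DD" using wrapping.wrap_in_DD_iff assms(1) eq by blast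
  ultimately show ?thesis using eq by blast
qed

subsection \<open>Doubled distinct partitions and finite sets\<close>

text \<open>In Frobenius notation \<open>dd_of S\<close> has the arms \<open>S\<close> and the legs \<open>s - 1\<close> for \<open>s\<close> in \<open>S\<close>.\<close>

definition dd_of :: "nat set \<Rightarrow> nat list" where
  "dd_of S = foldr wrap (rev (sorted_list_of_set S)) []"

lemma dd_of_empty [simp]: "dd_of {} = []" by (simp add: dd_of_def)

lemma dd_of_insert:
  assumes "finite S" "\<forall>t\<in>S. t < s"
  shows "dd_of (insert s S) = wrap s (dd_of S)"
proof -
  have "s \<notin> S" using assms(2) by blast
  then have "sorted_list_of_set (insert s S) = insort s (sorted_list_of_set S)" using assms(1) by simp
  also have "\<dots> = sorted_list_of_set S @ [s]"
    using assms by (intro sorted_insort_is_snoc) (auto intro: less_imp_le)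
  finally show ?thesis by (simp add: dd_of_def)
qed

definition shape_prod :: "complex \<Rightarrow> nat list \<Rightarrow> complex" where
  "shape_prod z l = (\<Prod>b\<in>ferrers l. 1 - z * eps b / of_nat (hook_length l b))"

lemma dd_of_bounds:
  assumes "finite S" "0 \<notin> S"
  shows "dd_of S \<in> DD \<and> (\<forall>t. (\<forall>s\<in>S. s \<le> t) \<longrightarrow> length (dd_of S) \<le> t \<and> part (dd_of S) 1 \<le> t + 1)"
  using assms
proof (induction S rule: finite_linorder_max_induct)
  case empty
  have "durfee [] = 0" by (rule durfee_eqI) (auto simp: is_partition_def part_def)
  then show ?case by (auto simp: DD_def is_partition_def part_def)
next
  case (insert s S)
  then have IH: "dd_of S \<in> DD" "\<And>t. (\<forall>s\<in>S. s \<le> t) \<Longrightarrow> length (dd_of S) \<le> t \<and> part (dd_of S) 1 \<le> t + 1" by auto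
  have s: "1 \<le> s" using insert.prems by (cases s) auto
  have "\<forall>t\<in>S. t \<le> s - 1" using insert.hyps by force
  then interpret wrapping s "dd_of S"
    using IH(2)[of "s - 1"] IH(1) s by unfold_locales (auto simp: DD_def)
  have eq: "dd_of (insert s S) = wrap s (dd_of S)" using insert by (intro dd_of_insert) auto
  show ?case unfolding eq using wrap_in_DD_iff IH(1) by (auto simp: length_wrap part_wrap_1)
qed

lemma dd_of_wrapping:
  assumes "finite S" "0 \<notin> S" "\<forall>t\<in>S. t < s" "1 \<le> s"
  shows "wrapping s (dd_of S)"
proof
  have "\<forall>t\<in>S. t \<le> s - 1" using assms by force
  then have "length (dd_of S) \<le> s - 1 \<and> part (dd_of S) 1 \<le> (s - 1) + 1" using dd_of_bounds[OF assms(1,2)] by blast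
  then show "length (dd_of S) < s" "part (dd_of S) 1 \<le> s" using assms(4) by auto
  show "is_partition (dd_of S)" using dd_of_bounds[OF assms(1,2)] by (simp add: DD_def)
qed

lemma dd_of_induct [consumes 2, case_names empty insert]:
  assumes "finite S" "0 \<notin> S"
    and "P {}"
    and "\<And>s S. finite S \<Longrightarrow> 0 \<notin> S \<Longrightarrow> \<forall>t\<in>S. t < s \<Longrightarrow> 1 \<le> s \<Longrightarrow> dd_of (insert s S) = wrap s (dd_of S) \<Longrightarrow>
       wrapping s (dd_of S) \<Longrightarrow> P S \<Longrightarrow> P (insert s S)"
  shows "P S"
  using assms(1,2)
proof (induction S rule: finite_linorder_max_induct)
  case (insert s S)
  then have "1 \<le> s" "0 \<notin> S" by (auto simp: Suc_le_eq intro!: gr0I)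
  then show ?case using insert dd_of_insert[of S s] dd_of_wrapping[of S s] assms(4)[of S s] by auto
qed (rule assms(3))

text \<open>The differences of part and index along the diagonal are the arms of the principal
  hooks. That they recover S makes \<open>dd_of\<close> injective.\<close>

lemma dd_of_statistics:
  assumes "finite S" "0 \<notin> S"
  shows "durfee (dd_of S) = card S \<and> sum_list (dd_of S) = 2 * \<Sum>S \<and> (\<lambda>i. part (dd_of S) i - i) ` {1..durfee (dd_of S)} = S"
  using assms
proof (induction S rule: dd_of_induct)
  case empty
  have "durfee [] = 0" by (rule durfee_eqI) (auto simp: is_partition_def part_def)
  then show ?case by simp
next
  case (insert s S)
  interpret wrapping s "dd_of S" by fact
  have "s \<notin> S" using insert by blast
  have "(\<lambda>i. part (wrap s (dd_of S)) i - i) ` {1..Suc (durfee (dd_of S))} = insert s ((\<lambda>i. part (dd_of S) i - i) ` {1..durfee (dd_of S)})"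
  proof -
    have "{1..Suc (durfee (dd_of S))} = insert 1 (Suc ` {1..durfee (dd_of S)})"
      by (auto simp: image_Suc_atLeastAtMost)
    moreover have "part (wrap s (dd_of S)) (Suc i) - Suc i = part (dd_of S) i - i" if "i \<in> {1..durfee (dd_of S)}" for i
    proof -
      have "i \<le> part (dd_of S) i" using le_part_iff_le_durfee[OF l, of i] that by simp
      then have "i < s" using that len part_pos_iff[OF l, of i] by auto
      then show ?thesis using that by (simp add: part_wrap_Suc)
    qed
    moreover have "part (wrap s (dd_of S)) 1 - 1 = s" by (simp add: part_wrap_1)
    ultimately show ?thesis by (simp only: image_insert image_image cong: image_cong)
  qed
  moreover have IH: "durfee (dd_of S) = card S" "sum_list (dd_of S) = 2 * \<Sum>S" "(\<lambda>i. part (dd_of S) i - i) ` {1..durfee (dd_of S)} = S"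
    using insert.IH by blast+
  ultimately have "(\<lambda>i. part (wrap s (dd_of S)) i - i) ` {1..Suc (durfee (dd_of S))} = insert s S" by (simp only:)
  then show ?case unfolding insert.hyps(5) durfee_wrap sum_list_wrap
    using IH(1,2) insert.hyps(1) \<open>s \<notin> S\<close> by (simp del: image_cong)
qed

lemma dd_of_inj: "finite S \<Longrightarrow> 0 \<notin> S \<Longrightarrow> finite T \<Longrightarrow> 0 \<notin> T \<Longrightarrow> dd_of S = dd_of T \<Longrightarrow> S = T"
  using dd_of_statistics by metis

lemma DD_imp_dd_of:
  assumes "l \<in> DD"
  shows "\<exists>S. finite S \<and> 0 \<notin> S \<and> l = dd_of S"
  using assms
proof (induction "length l" arbitrary: l rule: less_induct)
  case less
  show ?case
  proof (cases "l = []")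
    case True
    then show ?thesis by (intro exI[of _ "{}"]) simp
  next
    case False
    then obtain s l' where w: "wrapping s l'" "l = wrap s l'" "l' \<in> DD" using DD_unwrap less.prems by blast
    interpret wrapping s l' by fact
    have "length l' < length l" using len length_wrap w(2) by simp
    then obtain S where S: "finite S" "0 \<notin> S" "l' = dd_of S" using less.hyps w(3) by blast
    \<comment> \<open>Every arm of l' is at most its first part minus 1, hence below s. So s is a
      new maximum.\<close>
    have "\<forall>t\<in>S. t < s"
    proof
      fix t assume "t \<in> S"
      then obtain i where i: "1 \<le> i" "t = part l' i - i" using dd_of_statistics[OF S(1,2)] S(3) by force
      then show "t < s" using part_antimono[OF l, of 1 i] part1 s_pos by simp
    qed
    then have "l = dd_of (insert s S)" using dd_of_insert[OF S(1)] w(2) S(3) by simp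
    then show ?thesis using S s_pos by (intro exI[of _ "insert s S"]) auto
  qed
qed

text \<open>The Maya diagram: the numbers \<open>part l i - i\<close> run through \<open>S\<close> and the negatives of its complement.
  This yields the hook lengths in the first row and column of \<open>wrap s (dd_of S)\<close>.\<close>

lemma dd_of_maya:
  fixes f :: "int \<Rightarrow> 'a :: comm_monoid_mult"
  assumes "finite S" "0 \<notin> S" "\<forall>t\<in>S. t \<le> m"
  shows "(\<Prod>i=1..m. f (int (part (dd_of S) i) - int i)) = (\<Prod>t\<in>S. f (int t)) * (\<Prod>t\<in>{1..m} - S. f (- int t))"
    and "(\<Prod>j=1..Suc m. f (int (part (conjugate (dd_of S)) j) - int j + 1)) = f 0 * ((\<Prod>t\<in>S. f (int t)) * (\<Prod>t\<in>{1..m} - S. f (- int t)))"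
proof -
  have "(\<Prod>i=1..m. f (int (part (dd_of S) i) - int i)) = (\<Prod>t\<in>S. f (int t)) * (\<Prod>t\<in>{1..m} - S. f (- int t)) \<and>
     (\<Prod>j=1..Suc m. f (int (part (conjugate (dd_of S)) j) - int j + 1)) = f 0 * ((\<Prod>t\<in>S. f (int t)) * (\<Prod>t\<in>{1..m} - S. f (- int t)))"
    using assms
  proof (induction S arbitrary: m rule: dd_of_induct)
    case empty
    have 1: "part (conjugate []) j = 0" for j by (simp add: conjugate_def part_def)
    have "(\<Prod>j=1..Suc m. f (1 - int j)) = f 0 * (\<Prod>j=1..m. f (- int j))"
    proof -
      have "(\<Prod>j=1..Suc m. f (1 - int j)) = f (1 - int 1) * (\<Prod>j=Suc 1..Suc m. f (1 - int j))"
        by (rule prod.atLeast_Suc_atMost) simp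
      also have "(\<Prod>j=Suc 1..Suc m. f (1 - int j)) = (\<Prod>j=1..m. f (1 - int (Suc j)))"
        by (rule prod.shift_bounds_cl_Suc_ivl)
      finally show ?thesis by simp
    qed
    moreover have 2: "part [] i = 0" for i by (simp add: part_def)
    ultimately show ?case unfolding dd_of_empty 1 2 by simp
  next
    case (insert s S)
    interpret wrapping s "dd_of S" by fact
    have sm: "s \<le> m" using insert.prems by simp
    have sS: "s \<notin> S" using insert.hyps by blast
    define r where "r = s - 1"
    have r: "s = Suc r" using insert.hyps by (simp add: r_def)
    have "\<forall>t\<in>S. t \<le> r" using insert.hyps r by auto
    note IH = insert.IH[OF this]
    let ?B = "(\<Prod>t\<in>S. f (int t)) * (\<Prod>t\<in>{1..r} - S. f (- int t))"
    have tail: "(\<Prod>t\<in>insert s S. f (int t)) * (\<Prod>t\<in>{1..m} - insert s S. f (- int t)) = f (int s) * ?B * (\<Prod>t\<in>{s<..m}. f (- int t))"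
    proof -
      have "{1..m} - insert s S = ({1..r} - S) \<union> {s<..m}" using insert.hyps sm r by auto
      moreover have "(\<Prod>t\<in>({1..r} - S) \<union> {s<..m}. f (- int t)) = (\<Prod>t\<in>{1..r} - S. f (- int t)) * (\<Prod>t\<in>{s<..m}. f (- int t))"
        by (rule prod.union_disjoint) (auto simp: r)
      ultimately show ?thesis using insert.hyps sS by (simp add: mult_ac)
    qed
    have sp: "(\<Prod>i=1..b. g i) = (\<Prod>i=1..a. g i) * (\<Prod>i\<in>{a<..b}. g i)" if "a \<le> b" for a b :: nat and g :: "nat \<Rightarrow> 'a"
    proof -
      have "{1..b} = {1..a} \<union> {a<..b}" using that by auto
      moreover have "(\<Prod>i\<in>{1..a} \<union> {a<..b}. g i) = (\<Prod>i=1..a. g i) * (\<Prod>i\<in>{a<..b}. g i)"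
        by (rule prod.union_disjoint) auto
      ultimately show ?thesis by simp
    qed
    have first: "(\<Prod>i=1..Suc k. g i) = g 1 * (\<Prod>i=1..k. g (Suc i))" for k and g :: "nat \<Rightarrow> 'a"
      using prod.atLeast_Suc_atMost[of 1 "Suc k" g] prod.shift_bounds_cl_Suc_ivl[of g 1 k] by simp
    obtain m' where m': "m = Suc m'" using sm r by (cases m) auto
    have pw: "part (wrap s (dd_of S)) (Suc i) = Suc (part (dd_of S) i)" if "i \<in> {1..r}" for i
      using part_wrap_Suc[of i] that r by simp
    have pw': "part (wrap s (dd_of S)) (Suc i) = 0" if "i \<in> {r<..m'}" for i
      using part_wrap_Suc[of i] that r by simp
    \<comment> \<open>Row 1 contributes s. Rows 2..s are rows of \<open>dd_of S\<close> moved
      diagonally, which keeps part minus index, and the rows after s are empty and contribute the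
      negatives beyond s.\<close>
    have A: "(\<Prod>i=1..m. f (int (part (wrap s (dd_of S)) i) - int i)) = f (int s) * ?B * (\<Prod>t\<in>{s<..m}. f (- int t))"
    proof -
      have "(\<Prod>i=1..m. f (int (part (wrap s (dd_of S)) i) - int i)) = f (int s) * (\<Prod>i=1..m'. f (int (part (wrap s (dd_of S)) (Suc i)) - int (Suc i)))"
        unfolding m' first by (simp add: part_wrap_1)
      also have "(\<Prod>i=1..m'. f (int (part (wrap s (dd_of S)) (Suc i)) - int (Suc i))) =
         (\<Prod>i=1..r. f (int (part (wrap s (dd_of S)) (Suc i)) - int (Suc i))) * (\<Prod>i\<in>{r<..m'}. f (int (part (wrap s (dd_of S)) (Suc i)) - int (Suc i)))"
        by (rule sp) (use sm r m' in simp)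
      also have "(\<Prod>i=1..r. f (int (part (wrap s (dd_of S)) (Suc i)) - int (Suc i))) = (\<Prod>i=1..r. f (int (part (dd_of S) i) - int i))"
        by (intro prod.cong refl) (simp add: pw)
      also have "\<dots> = ?B" using IH by simp
      also have "(\<Prod>i\<in>{r<..m'}. f (int (part (wrap s (dd_of S)) (Suc i)) - int (Suc i))) = (\<Prod>i\<in>{r<..m'}. f (- int (Suc i)))"
        by (intro prod.cong refl) (simp add: pw')
      also have "\<dots> = (\<Prod>t\<in>{s<..m}. f (- int t))"
        by (rule prod.reindex_bij_witness[of _ "\<lambda>t. t - 1" Suc]) (auto simp: r m')
      finally show ?thesis by (simp add: mult_ac)
    qed
    have B: "(\<Prod>j=1..Suc m. f (int (part (conjugate (wrap s (dd_of S))) j) - int j + 1)) = f 0 * (f (int s) * ?B * (\<Prod>t\<in>{s<..m}. f (- int t)))"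
    proof -
      have "(\<Prod>j=1..Suc m. f (int (part (conjugate (wrap s (dd_of S))) j) - int j + 1)) = f (int s) * (\<Prod>j=1..m. f (int (part (conjugate (wrap s (dd_of S))) (Suc j)) - int (Suc j) + 1))"
        unfolding first by (simp add: conjugate_wrap_1)
      also have "(\<Prod>j=1..m. f (int (part (conjugate (wrap s (dd_of S))) (Suc j)) - int (Suc j) + 1)) =
         (\<Prod>j=1..s. f (int (part (conjugate (wrap s (dd_of S))) (Suc j)) - int (Suc j) + 1)) * (\<Prod>j\<in>{s<..m}. f (int (part (conjugate (wrap s (dd_of S))) (Suc j)) - int (Suc j) + 1))"
        by (rule sp[OF sm])
      also have "(\<Prod>j=1..s. f (int (part (conjugate (wrap s (dd_of S))) (Suc j)) - int (Suc j) + 1)) = (\<Prod>j=1..Suc r. f (int (part (conjugate (dd_of S)) j) - int j + 1))"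
        unfolding r[symmetric] by (intro prod.cong refl) (simp add: conjugate_wrap_Suc)
      also have "\<dots> = f 0 * ?B" using IH by simp
      also have "(\<Prod>j\<in>{s<..m}. f (int (part (conjugate (wrap s (dd_of S))) (Suc j)) - int (Suc j) + 1)) = (\<Prod>t\<in>{s<..m}. f (- int t))"
        by (intro prod.cong refl) (simp add: conjugate_wrap_Suc)
      finally show ?thesis by (simp add: mult_ac)
    qed
    show ?case unfolding insert.hyps(5) tail A B by simp
  qed
  then show "(\<Prod>i=1..m. f (int (part (dd_of S) i) - int i)) = (\<Prod>t\<in>S. f (int t)) * (\<Prod>t\<in>{1..m} - S. f (- int t))"
    and "(\<Prod>j=1..Suc m. f (int (part (conjugate (dd_of S)) j) - int j + 1)) = f 0 * ((\<Prod>t\<in>S. f (int t)) * (\<Prod>t\<in>{1..m} - S. f (- int t)))"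
    by blast+
qed

text \<open>In the outer hook, first-row boxes carry 1 - z / h and first-column boxes 1 + z / h. By
  the Maya diagram they share the hook lengths s + v, and pair up to 1 - z^2 / (s + v)^2. Unpaired
  are the corner, with hook 2 s, and the row box with v = 0, with hook s.\<close>

lemma shape_prod_dd_of:
  assumes "finite S" "0 \<notin> S"
  shows "shape_prod z (dd_of S) = set_weight z S"
  using assms
proof (induction S rule: dd_of_induct)
  case empty
  have "ferrers [] = {}" by (auto simp: ferrers_def)
  then show ?case by (simp add: shape_prod_def set_weight_def)
next
  case (insert s S)
  interpret wrapping s "dd_of S" by fact
  define r where "r = s - 1"
  have r: "s = Suc r" using insert.hyps by (simp add: r_def)
  have Sr: "\<forall>t\<in>S. t \<le> r" and sS: "s \<notin> S" using insert.hyps r by auto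
  let ?c = "of_int :: int \<Rightarrow> complex"
  define p m where "p = (\<lambda>v. 1 + z / ?c (int s + v))" and "m = (\<lambda>v. 1 - z / ?c (int s + v))"
  let ?F = "\<lambda>b. 1 - z * eps b / of_nat (hook_length (wrap s (dd_of S)) b)"
  have row: "(\<Prod>j=1..s. ?F (1, Suc j)) = m 0 * ((\<Prod>t\<in>S. m (int t)) * (\<Prod>t\<in>{1..r} - S. m (- int t)))"
  proof -
    have "(\<Prod>j=1..s. ?F (1, Suc j)) = (\<Prod>j=1..s. m (int (part (conjugate (dd_of S)) j) - int j + 1))"
    proof (intro prod.cong refl)
      fix j assume "j \<in> {1..s}"
      then have "?c (int (hook_length (wrap s (dd_of S)) (1, Suc j))) = ?c (int s + (int (part (conjugate (dd_of S)) j) - int j + 1))"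
        using hook_wrap_row[of j] by (simp only: atLeastAtMost_iff)
      then show "?F (1, Suc j) = m (int (part (conjugate (dd_of S)) j) - int j + 1)"
        unfolding m_def by (simp only: of_int_of_nat_eq) (simp add: eps_def)
    qed
    then show ?thesis using dd_of_maya(2)[OF insert.hyps(1,2) Sr, of m] r by simp
  qed
  have col: "(\<Prod>i\<in>{1..<s}. ?F (Suc i, 1)) = (\<Prod>t\<in>S. p (int t)) * (\<Prod>t\<in>{1..r} - S. p (- int t))"
  proof -
    have "(\<Prod>i\<in>{1..<s}. ?F (Suc i, 1)) = (\<Prod>i=1..r. p (int (part (dd_of S) i) - int i))"
    proof (intro prod.cong)
      show "{1..<s} = {1..r}" using r by auto
      fix i assume i: "i \<in> {1..r}"
      then have "?c (int (hook_length (wrap s (dd_of S)) (Suc i, 1))) = ?c (int s + (int (part (dd_of S) i) - int i))"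
        using hook_wrap_column[of i] r by (simp only: atLeastAtMost_iff) simp
      then show "?F (Suc i, 1) = p (int (part (dd_of S) i) - int i)"
        unfolding p_def using i by (simp only: of_int_of_nat_eq) (simp add: eps_def)
    qed
    then show ?thesis using dd_of_maya(1)[OF insert.hyps(1,2) Sr, of p] by simp
  qed
  have inner: "(\<Prod>(i, j)\<in>ferrers (dd_of S). ?F (Suc i, Suc j)) = shape_prod z (dd_of S)"
    unfolding shape_prod_def by (intro prod.cong refl) (auto simp: hook_wrap_inner eps_def)
  have corner: "?F (1, 1) = 1 - z / of_nat (2 * s)" unfolding hook_wrap_corner by (simp add: eps_def)
  have mp: "m v * p v = 1 - z\<^sup>2 / (?c (int s + v))\<^sup>2" for v
    by (simp add: m_def p_def power2_eq_square algebra_simps)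
  have hw: "hook_weight z (insert s S) s = ?F (1, 1) * (\<Prod>j=1..s. ?F (1, Suc j)) * (\<Prod>i\<in>{1..<s}. ?F (Suc i, 1))"
  proof -
    have sets: "{1..<s} - insert s S = {1..r} - S" "insert s S \<inter> {1..<s} = S"
      using insert.hyps r by (auto simp: Suc_le_eq intro!: gr0I)
    have "?F (1, 1) * (\<Prod>j=1..s. ?F (1, Suc j)) * (\<Prod>i\<in>{1..<s}. ?F (Suc i, 1)) =
       m 0 * (1 - z / of_nat (2 * s)) * (\<Prod>t\<in>{1..r} - S. m (- int t) * p (- int t)) * (\<Prod>t\<in>S. m (int t) * p (int t))"
      unfolding row col corner prod.distrib by (simp only: mult_ac)
    then show ?thesis unfolding hook_weight_def sets mp by (simp add: m_def)
  qed
  have "shape_prod z (wrap s (dd_of S)) = hook_weight z (insert s S) s * set_weight z S"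
    unfolding hw insert.IH[symmetric] shape_prod_def[of z "wrap s (dd_of S)"] prod_ferrers_wrap inner ..
  moreover have "hook_weight z (insert s S) t = hook_weight z S t" if "t \<in> S" for t
  proof -
    have "t < s" using that insert.hyps by blast
    then have "{1..<t} - insert s S = {1..<t} - S" "insert s S \<inter> {1..<t} = S \<inter> {1..<t}" by auto
    then show ?thesis by (simp add: hook_weight_def)
  qed
  ultimately show ?case unfolding insert.hyps(5) set_weight_def using insert.hyps(1) sS by simp
qed

subsection \<open>Conjugation\<close>

lemma is_partition_conjugate:
  assumes "is_partition l"
  shows "is_partition (conjugate l)"
  unfolding is_partition_def
proof
  show "sorted_wrt (\<ge>) (conjugate l)"
    unfolding conjugate_def sorted_wrt_map
  proof (rule sorted_wrt_mono_rel[OF _ sorted_wrt_upt])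
    fix x y :: nat assume "x < y"
    then show "card {i. 1 \<le> i \<and> i \<le> length l \<and> x \<le> part l i} \<ge> card {i. 1 \<le> i \<and> i \<le> length l \<and> y \<le> part l i}"
      by (intro card_mono) auto
  qed
  have "card {i. 1 \<le> i \<and> i \<le> length l \<and> j \<le> part l i} \<noteq> 0" if "j \<in> set [1..<Suc (part l 1)]" for j
  proof -
    have "1 \<in> {i. 1 \<le> i \<and> i \<le> length l \<and> j \<le> part l i}" using that by (auto simp: part_def split: if_splits)
    moreover have "finite {i. 1 \<le> i \<and> i \<le> length l \<and> j \<le> part l i}" by simp
    ultimately show ?thesis by (metis card_0_eq empty_iff)
  qed
  then show "0 \<notin> set (conjugate l)" unfolding conjugate_def by (metis (no_types, lifting) imageE list.set_map)
qed

lemma conjugate_inj: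
  assumes "is_partition l" "is_partition l'" "conjugate l = conjugate l'"
  shows "l = l'"
proof (rule partition_eqI[OF assms(1,2)])
  fix i :: nat assume i: "1 \<le> i"
  have *: "j \<le> part l i \<longleftrightarrow> j \<le> part l' i" if "1 \<le> j" for j
    using column_iff[OF assms(1) i that] column_iff[OF assms(2) i that] assms(3) by simp
  show "part l i = part l' i"
    using *[of "part l i"] *[of "part l' i"] by (cases "part l i"; cases "part l' i") auto
qed

lemma durfee_conjugate:
  assumes "is_partition l"
  shows "durfee (conjugate l) = durfee l"
  by (rule durfee_eqI[OF is_partition_conjugate[OF assms]])
    (use column_iff[OF assms] le_part_iff_le_durfee[OF assms] in blast)

lemma hook_length_conjugate:
  assumes "is_partition l"
  shows "hook_length (conjugate l) (j, i) = hook_length l (i, j)"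
proof -
  let ?sw = "\<lambda>(i::nat, j::nat). (j, i)"
  have "{t \<in> ferrers (conjugate l). (fst t = fst (j, i) \<and> snd t \<ge> snd (j, i)) \<or> (snd t = snd (j, i) \<and> fst t \<ge> fst (j, i))}
     = ?sw ` {t \<in> ferrers l. (fst t = fst (i, j) \<and> snd t \<ge> snd (i, j)) \<or> (snd t = snd (i, j) \<and> fst t \<ge> fst (i, j))}"
    unfolding ferrers_conjugate[OF assms] by force
  moreover have "inj_on ?sw A" for A by (auto simp: inj_on_def)
  ultimately show ?thesis unfolding hook_length_def by (simp add: card_image)
qed

text \<open>Reflecting a box turns \<open>eps\<close> into minus \<open>eps'\<close>; boxes on the
  diagonal, where the two signs also differ, obey the same rule.\<close>

lemma shape_prod_conjugate:
  assumes "is_partition l"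
  shows "(\<Prod>b\<in>ferrers (conjugate l). 1 + z * eps' b / of_nat (hook_length (conjugate l) b)) = shape_prod z l"
proof -
  have "inj_on (\<lambda>(i::nat, j::nat). (j, i)) (ferrers l)" by (auto simp: inj_on_def)
  then have "(\<Prod>b\<in>ferrers (conjugate l). 1 + z * eps' b / of_nat (hook_length (conjugate l) b))
    = (\<Prod>(i, j)\<in>ferrers l. 1 + z * eps' (j, i) / of_nat (hook_length (conjugate l) (j, i)))"
    unfolding ferrers_conjugate[OF assms] by (simp add: prod.reindex case_prod_unfold)
  also have "\<dots> = shape_prod z l"
    unfolding shape_prod_def
    by (intro prod.cong refl) (auto simp: hook_length_conjugate[OF assms] eps_def eps'_def)
  finally show ?thesis .
qed

subsection \<open>Sums of formal power series\<close>

lemma fps_has_sumI: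
  fixes f :: "'i \<Rightarrow> 'a :: comm_ring_1 fps"
  assumes "\<And>k. finite (B k)" "\<And>k. B k \<subseteq> A" "\<And>k l. l \<in> A - B k \<Longrightarrow> fps_nth (f l) k = 0"
    and "\<And>k. (\<Sum>l\<in>B k. fps_nth (f l) k) = fps_nth F k"
  shows "(f has_sum F) A"
  unfolding has_sum_def tendsto_fps_iff
proof
  fix k
  show "eventually (\<lambda>Y. fps_nth (sum f Y) k = fps_nth F k) (finite_subsets_at_top A)"
    unfolding eventually_finite_subsets_at_top
  proof (intro exI[of _ "B k"] conjI allI impI)
    fix Y assume Y: "finite Y \<and> B k \<subseteq> Y \<and> Y \<subseteq> A"
    have "(\<Sum>l\<in>Y. fps_nth (f l) k) = (\<Sum>l\<in>B k. fps_nth (f l) k)"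
      by (rule sum.mono_neutral_right) (use Y assms(3) in auto)
    then show "fps_nth (sum f Y) k = fps_nth F k" by (simp add: fps_sum_nth assms(4))
  qed (use assms in auto)
qed

lemma euler_product_cong: "fps_cong n euler_product (qfact n)"
  unfolding fps_cong_def
proof (intro allI impI)
  fix k assume k: "k \<le> n"
  have "(\<lambda>n. \<Prod>j\<le>n. 1 - fps_X ^ Suc j) \<longlonglongrightarrow> euler_product"
    using euler_product_has_prod one_minus_X_power_nz by (auto simp: has_prod_def raw_has_prod_def simp del: power_Suc)
  then have "\<forall>\<^sub>F N in sequentially. fps_nth (\<Prod>j\<le>N. 1 - fps_X ^ Suc j) k = fps_nth euler_product k"
    unfolding tendsto_fps_iff by (rule spec)
  then have "\<forall>\<^sub>F N in sequentially. k \<le> N \<and> fps_nth (\<Prod>j\<le>N. 1 - fps_X ^ Suc j) k = fps_nth euler_product k"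
    using eventually_ge_at_top[of k] by eventually_elim simp
  then obtain N where N: "k \<le> N" "fps_nth (\<Prod>j\<le>N. 1 - fps_X ^ Suc j) k = fps_nth euler_product k"
    by (auto simp: eventually_sequentially)
  have "(\<Prod>j\<le>N. 1 - fps_X ^ Suc j) = qfact (Suc N)"
    unfolding qfact_def by (rule prod.reindex_bij_witness[of _ "\<lambda>j. j - 1" Suc]) auto
  then have "fps_nth euler_product k = fps_nth (qfact (Suc N)) k" using N(2) by simp
  also have "\<dots> = fps_nth (qfact k) k" using qfact_cong[of k "Suc N"] N(1) by (simp add: fps_cong_def)
  also have "\<dots> = fps_nth (qfact n) k" using qfact_cong[OF k] by (simp add: fps_cong_def)
  finally show "fps_nth euler_product k = fps_nth (qfact n) k" .
qed

lemma fps_cpow_of_nat: "fps_cpow euler_product (of_nat m) = euler_product ^ m"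
proof -
  have 0: "fps_nth (euler_product - 1) 0 = 0" by (simp add: euler_product_nth_0)
  have "fps_cpow euler_product (of_nat m) = ((1 + fps_X) oo (euler_product - 1)) ^ m"
    unfolding fps_cpow_def fps_binomial_of_nat by (rule fps_compose_power[OF 0, symmetric])
  also have "(1 + fps_X) oo (euler_product - 1) = euler_product"
    by (simp add: fps_compose_add_distrib fps_X_fps_compose_startby0[OF 0])
  finally show ?thesis .
qed

subsection \<open>Polynomial dependence on the parameter\<close>

definition poly_fun :: "(complex \<Rightarrow> complex) \<Rightarrow> bool" where
  "poly_fun f \<longleftrightarrow> (\<exists>p. f = poly p)"

lemma poly_fun_const: "poly_fun (\<lambda>_. c)"
  by (auto simp: poly_fun_def fun_eq_iff intro!: exI[of _ "[:c:]"])

lemma poly_fun_id: "poly_fun (\<lambda>z. z)"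
  by (auto simp: poly_fun_def fun_eq_iff intro!: exI[of _ "[:0, 1:]"])

lemma poly_fun_add: "poly_fun f \<Longrightarrow> poly_fun g \<Longrightarrow> poly_fun (\<lambda>z. f z + g z)"
  unfolding poly_fun_def by (auto simp: fun_eq_iff) (metis poly_add)

lemma poly_fun_mult: "poly_fun f \<Longrightarrow> poly_fun g \<Longrightarrow> poly_fun (\<lambda>z. f z * g z)"
  unfolding poly_fun_def by (auto simp: fun_eq_iff) (metis poly_mult)

lemma poly_fun_diff: "poly_fun f \<Longrightarrow> poly_fun g \<Longrightarrow> poly_fun (\<lambda>z. f z - g z)"
  unfolding poly_fun_def by (auto simp: fun_eq_iff) (metis poly_diff)

lemma poly_fun_divide: "poly_fun f \<Longrightarrow> poly_fun (\<lambda>z. f z / c)"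
  using poly_fun_mult[OF _ poly_fun_const[of "1 / c"]] by simp

lemma poly_fun_power: "poly_fun f \<Longrightarrow> poly_fun (\<lambda>z. f z ^ m)"
  by (induction m) (auto intro: poly_fun_const poly_fun_mult)

lemma poly_fun_sum: "(\<And>i. i \<in> A \<Longrightarrow> poly_fun (f i)) \<Longrightarrow> poly_fun (\<lambda>z. \<Sum>i\<in>A. f i z)"
  by (induction A rule: infinite_finite_induct) (auto intro: poly_fun_const poly_fun_add)

lemma poly_fun_prod: "(\<And>i. i \<in> A \<Longrightarrow> poly_fun (f i)) \<Longrightarrow> poly_fun (\<lambda>z. \<Prod>i\<in>A. f i z)"
  by (induction A rule: infinite_finite_induct) (auto intro: poly_fun_const poly_fun_mult)

lemmas poly_fun_intros = poly_fun_const poly_fun_id poly_fun_add poly_fun_mult poly_fun_diff poly_fun_divide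
  poly_fun_power poly_fun_sum poly_fun_prod

text \<open>The difference polynomial would have the infinitely many roots -n with n >= k.\<close>

lemma poly_fun_eqI:
  assumes "poly_fun f" "poly_fun g" "\<And>n. n \<ge> k \<Longrightarrow> f (- of_nat n) = g (- of_nat n)"
  shows "f = g"
proof -
  obtain p q where pq: "f = poly p" "g = poly q" using assms(1,2) by (auto simp: poly_fun_def)
  have "p = q"
  proof (rule ccontr)
    assume "p \<noteq> q"
    then have "finite {x. poly (p - q) x = 0}" by (intro poly_roots_finite) simp
    moreover have "(\<lambda>n. - of_nat n) ` {k..} \<subseteq> {x. poly (p - q) x = 0}" using assms(3) pq by auto
    ultimately have "finite ((\<lambda>n. - of_nat n :: complex) ` {k..})" by (rule rev_finite_subset)
    moreover have "inj_on (\<lambda>n. - of_nat n :: complex) {k..}" by (auto simp: inj_on_def)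
    ultimately show False using finite_imageD infinite_Ici by blast
  qed
  then show ?thesis using pq by simp
qed

lemma poly_fun_set_weight: "poly_fun (\<lambda>z. set_weight (2 - 2 * z) S)"
  unfolding set_weight_def hook_weight_def by (intro poly_fun_intros)

text \<open>A coefficient of the composition is a finite sum of constants times generalised
  binomials of the exponent, each a product of linear factors in it.\<close>

lemma poly_fun_cpow: "poly_fun (\<lambda>z. fps_nth (fps_cpow F (2 * z\<^sup>2 - z)) k)"
  unfolding fps_cpow_def fps_compose_nth fps_binomial_nth gbinomial_prod_rev by (intro poly_fun_intros)

section \<open>Comparison of coefficients\<close>

definition sets_of_sum :: "nat \<Rightarrow> nat set set" where
  "sets_of_sum k = {S. S \<subseteq> {1..k} \<and> \<Sum>S = k}"

lemma sets_of_sum_alt: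
  assumes "k \<le> n"
  shows "sets_of_sum k = {S \<in> Pow {1..n}. \<Sum>S = k}"
proof -
  have "S \<subseteq> {1..k}" if S: "S \<subseteq> {1..n}" "\<Sum>S = k" for S
  proof
    fix s assume s: "s \<in> S"
    have "finite S" using S(1) finite_subset by blast
    then have "s \<le> \<Sum>S" using s by (intro member_le_sum) auto
    then show "s \<in> {1..k}" using S s by auto
  qed
  then show ?thesis using assms by (auto simp: sets_of_sum_def)
qed

lemma finite_sets_of_sum: "finite (sets_of_sum k)"
  unfolding sets_of_sum_def by (rule finite_subset[of _ "Pow {1..k}"]) auto

text \<open>For fixed k every n >= k is admissible: the truncated identity is exact in degree k, and
  subsets of {1..n} with sum k already lie in {1..k}. Thus the index set does not depend on n, as
  comparing polynomials requires.\<close>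

lemma coefficient_identity:
  "(\<Sum>S\<in>sets_of_sum k. (-1) ^ card S * set_weight (2 - 2 * z) S) = fps_nth (fps_cpow euler_product (2 * z\<^sup>2 - z)) k"
proof -
  let ?f = "\<lambda>z. \<Sum>S\<in>sets_of_sum k. (-1) ^ card S * set_weight (2 - 2 * z) S"
  let ?g = "\<lambda>z. fps_nth (fps_cpow euler_product (2 * z\<^sup>2 - z)) k"
  have "?f = ?g"
  proof (rule poly_fun_eqI)
    show "poly_fun ?f" by (intro poly_fun_sum poly_fun_mult poly_fun_const poly_fun_set_weight)
    show "poly_fun ?g" by (rule poly_fun_cpow)
    fix n assume n: "k \<le> n"
    \<comment> \<open>At z = -n the exponent is the natural number 2 n^2 + n, so the complex power
      is an ordinary one.\<close>
    have z: "2 * (- of_nat n)\<^sup>2 - (- of_nat n) = (of_nat (2 * n\<^sup>2 + n) :: complex)"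
      and w: "2 - 2 * (- of_nat n) = (of_nat (2 * n + 2) :: complex)" by simp_all
    have "fps_cong n (\<Prod>i<2 * n\<^sup>2 + n. euler_product) (\<Prod>i<2 * n\<^sup>2 + n. qfact n)"
      by (intro fps_cong_prod euler_product_cong)
    then have "fps_nth (euler_product ^ (2 * n\<^sup>2 + n)) k = fps_nth (qfact n ^ (2 * n\<^sup>2 + n)) k"
      using n by (simp add: fps_cong_def)
    also have "\<dots> = (\<Sum>S\<in>Pow {1..n}. (-1) ^ card S * set_weight (of_nat (2 * n + 2)) S * (if k = \<Sum>S then 1 else 0))"
      using qfact_power_cong[of n] n by (simp add: fps_cong_def fps_sum_nth fps_X_power_nth)
    also have "\<dots> = (\<Sum>S\<in>sets_of_sum k. (-1) ^ card S * set_weight (of_nat (2 * n + 2)) S)"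
      unfolding sets_of_sum_alt[OF n] by (rule sum.mono_neutral_cong_right) auto
    finally show "?f (- of_nat n) = ?g (- of_nat n)"
      unfolding z w fps_cpow_of_nat by simp
  qed
  then show ?thesis by (rule fun_cong)
qed

lemma DD_has_sum:
  "((\<lambda>l. fps_const ((-1) ^ durfee l * shape_prod (2 - 2 * z) l) * fps_X ^ (sum_list l div 2))
     has_sum fps_cpow euler_product (2 * z\<^sup>2 - z)) DD"
proof (rule fps_has_sumI)
  let ?f = "\<lambda>l. fps_const ((-1) ^ durfee l * shape_prod (2 - 2 * z) l) * fps_X ^ (sum_list l div 2)"
  fix k
  have S: "finite S" "0 \<notin> S" "\<Sum>S = k" if "S \<in> sets_of_sum k" for S
    using that finite_subset[of S "{1..k}"] by (auto simp: sets_of_sum_def)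
  show "finite (dd_of ` sets_of_sum k)" using finite_sets_of_sum by simp
  show "dd_of ` sets_of_sum k \<subseteq> DD" using dd_of_bounds[OF S(1,2)] by auto
  show "fps_nth (?f l) k = 0" if l: "l \<in> DD - dd_of ` sets_of_sum k" for l
  proof -
    obtain S where S: "finite S" "0 \<notin> S" "l = dd_of S" using DD_imp_dd_of l by blast
    then have "sum_list l div 2 = \<Sum>S" using dd_of_statistics[OF S(1,2)] by simp
    moreover have "\<Sum>S \<noteq> k"
    proof
      assume k: "\<Sum>S = k"
      have "S \<subseteq> {1..k}"
      proof
        fix s assume s: "s \<in> S"
        then have "s \<le> \<Sum>S" using S(1) by (intro member_le_sum) auto
        moreover have "s \<noteq> 0" using s S(2) by (cases "s = 0") simp_all
        ultimately show "s \<in> {1..k}" using k by auto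
      qed
      then show False using l S(3) k by (auto simp: sets_of_sum_def)
    qed
    ultimately show ?thesis by (simp add: fps_X_power_nth)
  qed
  have "inj_on dd_of (sets_of_sum k)" 
    by (rule inj_onI) (rule dd_of_inj; simp add: S)
  then have "(\<Sum>l\<in>dd_of ` sets_of_sum k. fps_nth (?f l) k) = (\<Sum>S\<in>sets_of_sum k. fps_nth (?f (dd_of S)) k)"
    by (simp add: sum.reindex)
  also have "\<dots> = (\<Sum>S\<in>sets_of_sum k. (-1) ^ card S * set_weight (2 - 2 * z) S)"
  proof (rule sum.cong[OF refl])
    fix T assume T: "T \<in> sets_of_sum k"
    show "fps_nth (?f (dd_of T)) k = (-1) ^ card T * set_weight (2 - 2 * z) T"
      using dd_of_statistics[OF S(1,2)[OF T]] shape_prod_dd_of[OF S(1,2)[OF T]] S(3)[OF T]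
      by (simp add: fps_X_power_nth)
  qed
  also have "\<dots> = fps_nth (fps_cpow euler_product (2 * z\<^sup>2 - z)) k" by (rule coefficient_identity)
  finally show "(\<Sum>l\<in>dd_of ` sets_of_sum k. fps_nth (?f l) k) = fps_nth (fps_cpow euler_product (2 * z\<^sup>2 - z)) k" .
qed

theorem mainTheorem4:
  fixes z :: complex
  shows "((\<lambda>l. fps_const ((-1) ^ durfee l *
              (\<Prod>s\<in>ferrers l. 1 - (2 * z - 2) * eps' s / of_nat (hook_length l s)))
            * fps_X ^ (sum_list l div 2))
          has_sum fps_cpow euler_product (2 * z\<^sup>2 - z)) DD'
       \<and> ((\<lambda>l. fps_const ((-1) ^ durfee l *
              (\<Prod>s\<in>ferrers l. 1 + (2 * z - 2) * eps s / of_nat (hook_length l s)))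
            * fps_X ^ (sum_list l div 2))
          has_sum fps_cpow euler_product (2 * z\<^sup>2 - z)) DD"
proof
  have neg: "(2 * z - 2) * a / b = - ((2 - 2 * z) * a / b)" for a b :: complex
    by (simp add: minus_divide_left algebra_simps)
  have sp: "(\<Prod>s\<in>ferrers l. 1 + (2 * z - 2) * eps s / of_nat (hook_length l s)) = shape_prod (2 - 2 * z) l" for l
    unfolding shape_prod_def neg by simp
  show "((\<lambda>l. fps_const ((-1) ^ durfee l *
              (\<Prod>s\<in>ferrers l. 1 + (2 * z - 2) * eps s / of_nat (hook_length l s)))
            * fps_X ^ (sum_list l div 2))
          has_sum fps_cpow euler_product (2 * z\<^sup>2 - z)) DD"
    unfolding sp by (rule DD_has_sum)
  have inj: "inj_on conjugate DD" by (rule inj_onI) (auto simp: DD_def intro: conjugate_inj)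
  show "((\<lambda>l. fps_const ((-1) ^ durfee l *
              (\<Prod>s\<in>ferrers l. 1 - (2 * z - 2) * eps' s / of_nat (hook_length l s)))
            * fps_X ^ (sum_list l div 2))
          has_sum fps_cpow euler_product (2 * z\<^sup>2 - z)) DD'"
    unfolding DD'_def has_sum_reindex[OF inj]
  proof (rule has_sum_cong[THEN iffD1, OF _ DD_has_sum])
    fix l assume "l \<in> DD"
    then have l: "is_partition l" by (simp add: DD_def)
    have "(\<Prod>s\<in>ferrers (conjugate l). 1 - (2 * z - 2) * eps' s / of_nat (hook_length (conjugate l) s)) = shape_prod (2 - 2 * z) l"
      using shape_prod_conjugate[OF l, of "2 - 2 * z"] unfolding neg by simp
    then show "fps_const ((-1) ^ durfee l * shape_prod (2 - 2 * z) l) * fps_X ^ (sum_list l div 2)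
      = ((\<lambda>l. fps_const ((-1) ^ durfee l *
              (\<Prod>s\<in>ferrers l. 1 - (2 * z - 2) * eps' s / of_nat (hook_length l s)))
            * fps_X ^ (sum_list l div 2)) \<circ> conjugate) l"
      using durfee_conjugate[OF l] sum_list_conjugate[OF l] by simp
  qed
qed

end
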